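(* Up to separate permutations of upper and lower parameters and up to Euler's transformation, the intersection of the $3$-planes on the Dixon--Watson--Whipple $\mathfrak{T}$-orbit and the $3$-planes on the Whipple ${}_2F_1(-1)$ $\mathfrak{T}$-orbit, when projected to $\mathbb{C}^2\times\mathbb{C}^1$ via the map $P$ of Whipple's identity, comprises (a) the Kummer $2$-plane, and (b) exactly four lines. The latter correspond to the following (the lines being those traced out, as $a$ ranges over $\mathbb{C}$, by the parameter vectors of the ${}_2F_1(-1)$'s). (i) $${}_2F_1\left(\begin{array}{c}a-4,\ \frac23a-1\\ 1+\frac13a\end{array}\middle|-1\right)=\Gamma\left[\begin{array}{c}\frac12,\ \frac13a,\ 1+\frac13a,\ \frac23a-\frac32,\ \frac23a-2\\ \frac12a-\frac32,\ \frac16a,\ \frac12+\frac16a,\ 2-\frac16a,\ \frac43a-3\end{array}\right],$$ (ii) $${}_2F_1\left(\begin{array}{c}a-\frac32,\ \frac14a+\frac14\\ \frac34a-\frac14\end{array}\middle|-1\right)=\Gamma\left[\begin{array}{c}\frac12,\ \frac32,\ \frac34+\frac14a,\ \frac12a,\ \frac34a-\frac14\\ \frac78,\ \frac98,\ a,\ \frac18+\frac14a,\ \frac38+\frac14a\end{array}\right],$$ (iii) $${}_2F_1\left(\begin{array}{c}a-\frac12,\ \frac14a\\ \frac34a\end{array}\middle|-1\right)=\Gamma\left[\begin{array}{c}\frac12,\ \frac12,\ \frac12+\frac14a,\ \frac12+\frac12a,\ \frac34a\\ \frac38,\ \frac58,\ a,\ \frac38+\frac14a,\ \frac58+\frac14a\end{array}\right],$$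 (iv) $${}_2F_1\left(\begin{array}{c}a+2,\ \frac23a\\ \frac13a\end{array}\middle|-1\right)=\Gamma\left[\begin{array}{c}\frac12,\ \frac13a,\ 1+\frac13a,\ \frac32+\frac23a,\ 2+\frac23a\\ \frac32+\frac12a,\ \frac12+\frac16a,\ 1+\frac16a,\ -\frac16a,\ 2+\frac43a\end{array}\right].$$ In each of the identities (i), (ii), (iii), (iv) it is assumed that the parametric excess of the ${}_2F_1(-1)$ series has real part greater than $-1$, with no lower parameter of the series or upper parameter of the gamma quotient equal to a non-positive integer.
   Context: ${}_2F_1\left(\begin{array}{c}a,b\\ c\end{array}\middle|-1\right)=\sum_{k\ge0}\frac{(a)_k(b)_k}{(c)_k\,k!}(-1)^k$ with $(a)_k=a(a+1)\cdots(a+k-1)$, $(a)_0=1$. Its parametric excess is $c-a-b$; it converges if $\operatorname{Re}(c-a-b)>-1$. $\Gamma\left[\begin{array}{c}p_1,\ldots,p_m\\ q_1,\ldots,q_n\end{array}\right]$ denotes the gamma quotient $\Gamma(p_1)\cdots\Gamma(p_m)/(\Gamma(q_1)\cdots\Gamma(q_n))$; if a denominator argument is a non-positive integer it is interpreted as zero. Points of $\mathbb{C}^3\times\mathbb{C}^2$ are written $(a,b,c;d,e)$ (upper parameters $a,b,c$, lower $d,e$ of a ${}_3F_2$), and points of $\mathbb{C}^2\times\mathbb{C}^1$ are written $(a,b;c)$ (parameters of a ${}_2F_1$). A $3$-plane (resp. $2$-plane) is an affine subspace of dimension $3$ (resp. $2$). The Thomae group $\mathfrak{T}\subset GL(5,\mathbb{C})$,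 isomorphic to $S_5$: introduce linear coordinates $(x,y,z;u,v)$ on $\mathbb{C}^3\times\mathbb{C}^2$ by $(a,b,c;d,e)=(x,y,z;u,v)A$ (row vectors), with $$A=\begin{pmatrix}1&0&0&1&1\\0&1&0&1&1\\0&0&1&1&1\\1&1&1&2&1\\1&1&1&1&2\end{pmatrix};$$ $\mathfrak{T}$ is the group of linear transformations induced by all $5!$ permutations of $x,y,z,u,v$. The Dixon--Watson--Whipple orbit is the $\mathfrak{T}$-orbit of the $3$-plane $\{d=1+a-b,\ e=1+a-c\}$. The Whipple ${}_2F_1(-1)$ orbit is the $\mathfrak{T}$-orbit of the $3$-plane $\mathcal{W}_0=\{b=a+\frac12,\ e=d+\frac12\}$. Projection: the map $P:\mathcal{W}_0\to\mathbb{C}^2\times\mathbb{C}^1$ is $P(\alpha,\alpha+\tfrac12,\beta;\gamma,\gamma+\tfrac12)=(2\alpha,\beta;2\gamma-\beta)$. It comes from Whipple's identity $${}_2F_1\left(\begin{array}{c}2\alpha,\beta\\ 2\gamma-\beta\end{array}\middle|-1\right)=\frac{\Gamma(2\gamma-2\alpha)\Gamma(2\gamma-\beta)}{\Gamma(2\gamma-2\alpha-\beta)\Gamma(2\gamma)}\;{}_3F_2\left(\begin{array}{c}\alpha,\frac12+\alpha,\beta\\ \gamma,\frac12+\gamma\end{array}\middle|1\right).$$ A $3$-plane $\mathcal{W}=T\mathcal{W}_0$, $T\in\mathfrak{T}$, is projected onto $\mathbb{C}^2\times\mathbb{C}^1$ by $PT^{-1}$; this map depends on the choice of $T$ only up to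 permutation of the upper parameters and up to Euler's transformation. The projected intersection is the union of the images of all $\mathcal{V}\cap\mathcal{W}$, with $\mathcal{V}$ on the first orbit and $\mathcal{W}$ on the second. Euler's transformation acts on $\mathbb{C}^2\times\mathbb{C}^1$ by $(a,b;c)\mapsto(c-a,c-b;c)$. Permutation of upper parameters acts on $\mathbb{C}^2\times\mathbb{C}^1$ by $(a,b;c)\mapsto(b,a;c)$. The Kummer $2$-plane is $\{(a,b;c): c=1+a-b\}$. *)

theory Defs
  imports "HOL-Analysis.Analysis"
begin

text \<open>
  Points \<open>(a,b,c;d,e)\<close> of \<open>\<complex>\<^sup>3 \<times> \<complex>\<^sup>2\<close> are vectors of type \<open>complex^5\<close>, points \<open>(a,b;c)\<close> of
  \<open>\<complex>\<^sup>2 \<times> \<complex>\<^sup>1\<close> are vectors of type \<open>complex^3\<close>, with components in the order written.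
\<close>

definition thomae_matrix :: "complex^5^5" where
  "thomae_matrix = vector
    [vector [1, 0, 0, 1, 1],
     vector [0, 1, 0, 1, 1],
     vector [0, 0, 1, 1, 1],
     vector [1, 1, 1, 2, 1],
     vector [1, 1, 1, 1, 2]]"

text \<open>
  A point \<open>p\<close> has the coordinates \<open>(x,y,z;u,v) = p v* matrix_inv thomae_matrix\<close>, a row vector.
\<close>

definition thomae_map :: "(5 \<Rightarrow> 5) \<Rightarrow> complex^5 \<Rightarrow> complex^5" where
  "thomae_map \<sigma> p = (\<chi> i. (p v* matrix_inv thomae_matrix) $ \<sigma> i) v* thomae_matrix"

definition thomae_group :: "(complex^5 \<Rightarrow> complex^5) set" where
  "thomae_group = {thomae_map \<sigma> | \<sigma>. \<sigma> permutes UNIV}"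

definition thomae_orbit :: "(complex^5) set \<Rightarrow> (complex^5) set set" where
  "thomae_orbit S = {T ` S | T. T \<in> thomae_group}"

definition dixon_plane :: "(complex^5) set" where
  "dixon_plane = {p. p$4 = 1 + p$1 - p$2 \<and> p$5 = 1 + p$1 - p$3}"

definition whipple_plane :: "(complex^5) set" where
  "whipple_plane = {p. p$2 = p$1 + 1/2 \<and> p$5 = p$4 + 1/2}"

text \<open>
  \<open>P(\<alpha>, \<alpha> + 1/2, \<beta>; \<gamma>, \<gamma> + 1/2) = (2\<alpha>, \<beta>; 2\<gamma> - \<beta>)\<close>; only its values on
  \<^const>\<open>whipple_plane\<close> matter.
\<close>

definition whipple_proj :: "complex^5 \<Rightarrow> complex^3" where
  "whipple_proj p = vector [2 * p$1, p$3, 2 * p$4 - p$3]"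

text \<open>
  For each \<open>W\<close> on the second orbit, every \<open>T\<close> with \<open>W = T ` whipple_plane\<close> is used.
\<close>

definition projected_intersection :: "(complex^3) set" where
  "projected_intersection =
    \<Union> {(whipple_proj \<circ> inv T) ` (V \<inter> W) | V W T.
         V \<in> thomae_orbit dixon_plane \<and> W \<in> thomae_orbit whipple_plane \<and>
         T \<in> thomae_group \<and> W = T ` whipple_plane}"

definition upper_swap :: "complex^3 \<Rightarrow> complex^3" where
  "upper_swap p = vector [p$2, p$1, p$3]"

definition euler_map :: "complex^3 \<Rightarrow> complex^3" where
  "euler_map p = vector [p$3 - p$1, p$3 - p$2, p$3]"

text \<open>
  Both generators are involutions, so the monoid they generate is the group they generate.
\<close>

inductive_set symmetries :: "(complex^3 \<Rightarrow> complex^3) set" where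
  "id \<in> symmetries"
| "g \<in> symmetries \<Longrightarrow> upper_swap \<circ> g \<in> symmetries"
| "g \<in> symmetries \<Longrightarrow> euler_map \<circ> g \<in> symmetries"

definition saturation :: "(complex^3) set \<Rightarrow> (complex^3) set" where
  "saturation S = (\<Union>g\<in>symmetries. g ` S)"

definition kummer_plane :: "(complex^3) set" where
  "kummer_plane = {p. p$3 = 1 + p$1 - p$2}"

definition line_i :: "complex \<Rightarrow> complex^3" where
  "line_i a = vector [a - 4, 2/3 * a - 1, 1 + 1/3 * a]"

definition line_ii :: "complex \<Rightarrow> complex^3" where
  "line_ii a = vector [a - 3/2, 1/4 * a + 1/4, 3/4 * a - 1/4]"

definition line_iii :: "complex \<Rightarrow> complex^3" where
  "line_iii a = vector [a - 1/2, 1/4 * a, 3/4 * a]"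

definition line_iv :: "complex \<Rightarrow> complex^3" where
  "line_iv a = vector [a + 2, 2/3 * a, 1/3 * a]"

definition hyp2F1_term :: "complex^3 \<Rightarrow> nat \<Rightarrow> complex" where
  "hyp2F1_term p k =
    pochhammer (p$1) k * pochhammer (p$2) k / (pochhammer (p$3) k * fact k) * (-1) ^ k"

definition excess :: "complex^3 \<Rightarrow> complex" where
  "excess p = p$3 - p$1 - p$2"

text \<open>
  \<^const>\<open>rGamma\<close> is the reciprocal of \<^const>\<open>Gamma\<close> and vanishes at the non-positive integers, so
  the quotient is zero if a lower argument is a non-positive integer.
\<close>

definition gamma_quotient :: "complex list \<Rightarrow> complex list \<Rightarrow> complex" where
  "gamma_quotient ps qs = (\<Prod>p\<leftarrow>ps. Gamma p) * (\<Prod>q\<leftarrow>qs. rGamma q)"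

text \<open>
  Convergence of the series at \<open>-1\<close> (possibly only conditional) is part of the claim.
\<close>

definition gamma_evaluation :: "complex^3 \<Rightarrow> complex list \<Rightarrow> complex list \<Rightarrow> bool" where
  "gamma_evaluation p us ls \<longleftrightarrow>
    (Re (excess p) > -1 \<and> p$3 \<notin> \<int>\<^sub>\<le>\<^sub>0 \<and> (\<forall>u\<in>set us. u \<notin> \<int>\<^sub>\<le>\<^sub>0) \<longrightarrow>
     hyp2F1_term p sums gamma_quotient us ls)"

end

theory Submission
  imports Defs "HOL-Complex_Analysis.Conformal_Mappings"
begin

text \<open>
  In the coordinates \<open>(x,y,z;u,v)\<close> permuted by the Thomae group, a plane on the
  Dixon--Watson--Whipple orbit says that two disjoint pairs of coordinates each sum to \<open>1/3\<close>, and
  a point of the Whipple plane is \<open>(x, x + 1/2, z, u, u + 1/2)\<close>. Hence the projected intersection is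
  the union of the projections obtained from the 15 ways to choose two disjoint pairs; each of them
  is empty, or lies in the Kummer plane, or is one of the four lines, up to the symmetries.

  After multiplication by reciprocal Gamma functions, both sides of each evaluation are holomorphic
  in \<open>a\<close> on the half-plane where the series converges, so it suffices to treat real \<open>a\<close> in a short
  interval. On lines (i) and (iv) the series is contiguous to a series summed by Kummer's theorem, and
  the second term of the general three-term contiguous relation happens to vanish. On lines (ii) and
  (iii) the substitution \<open>x = tan\<^sup>2 u\<close> turns Euler's integral into an integral over \<open>[0, \<pi>/4]\<close> of
  \<open>sin (4 u)\<close> to a power times \<open>sin u\<close> or \<open>cos u\<close>, which obeys a first-order
  recurrence in the exponent and whose mass concentrates at \<open>u = \<pi>/8\<close>.
\<close>

subsection \<open>Orbits and their intersections\<close>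

text \<open>The hypothesis on the excess admits conditionally convergent series, so the terms
  themselves have no summable majorant, and holomorphy in \<open>a\<close> has to be drawn from
  consecutive differences of the coefficients. Dividing by \<open>Gamma\<close> of the lower
  parameter removes the poles and leaves a whole half-plane, which is connected. The real intervals
  are dictated by Euler's integral: where an upper parameter is negative, the binomial series that
  represents its factor converges absolutely up to the endpoint 1, and termwise integration is
  legitimate. The recurrence for the trigonometric integrals determines them only up to a factor of
  period 2 in the exponent. Concentration fixes this factor as cos(pi/8) or sin(pi/8), and the
  reflection formula turns these numbers into the gamma values at eighths in (iii) and (ii). On
  lines (i) and (iv) the vanishing of the second contiguous term takes the form of a telescoping
  identity between term sequences; its boundary term tends to zero because the terms of a convergent
  series do.\<close>

lemma exhaust_5:
  fixes x :: 5
  shows "x = 1 \<or> x = 2 \<or> x = 3 \<or> x = 4 \<or> x = 5"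
proof (induct x)
  case (of_int z)
  then have "z = 0 \<or> z = 1 \<or> z = 2 \<or> z = 3 \<or> z = 4" by fastforce
  then show ?case by auto
qed

lemma forall_5: "(\<forall>i::5. P i) \<longleftrightarrow> P 1 \<and> P 2 \<and> P 3 \<and> P 4 \<and> P 5"
  by (metis exhaust_5)

lemma UNIV_5: "UNIV = {1, 2, 3, 4, 5::5}"
  using exhaust_5 by auto

lemma sum_5: "sum f (UNIV::5 set) = f 1 + f 2 + f 3 + f 4 + f 5"
  unfolding UNIV_5 by (simp add: ac_simps)

lemma vector_5 [simp]:
  "(vector [x,y,z,u,v] :: ('a::zero)^5)$1 = x"
  "(vector [x,y,z,u,v] :: ('a::zero)^5)$2 = y"
  "(vector [x,y,z,u,v] :: ('a::zero)^5)$3 = z"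
  "(vector [x,y,z,u,v] :: ('a::zero)^5)$4 = u"
  "(vector [x,y,z,u,v] :: ('a::zero)^5)$5 = v"
  unfolding vector_def by simp_all

lemma vec3_eq_iff: "(p::'a^3) = q \<longleftrightarrow> p$1 = q$1 \<and> p$2 = q$2 \<and> p$3 = q$3"
  by (simp add: vec_eq_iff forall_3)

lemma vec5_eq_iff: "(p::'a^5) = q \<longleftrightarrow> p$1 = q$1 \<and> p$2 = q$2 \<and> p$3 = q$3 \<and> p$4 = q$4 \<and> p$5 = q$5"
  by (simp add: vec_eq_iff forall_5)

abbreviation from_coords :: "complex^5 \<Rightarrow> complex^5" where
  "from_coords X \<equiv> X v* thomae_matrix"

lemma from_coords_nth:
  "from_coords X $ 1 = X$1 + X$4 + X$5"
  "from_coords X $ 2 = X$2 + X$4 + X$5"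
  "from_coords X $ 3 = X$3 + X$4 + X$5"
  "from_coords X $ 4 = X$1 + X$2 + X$3 + 2 * X$4 + X$5"
  "from_coords X $ 5 = X$1 + X$2 + X$3 + X$4 + 2 * X$5"
  by (simp_all add: vector_matrix_mult_def sum_5 thomae_matrix_def)

lemma invertible_thomae_matrix: "invertible thomae_matrix"
proof -
  have "x = 0" if "thomae_matrix *v x = 0" for x :: "complex^5"
  proof -
    have "x$1 + x$4 + x$5 = 0" "x$2 + x$4 + x$5 = 0" "x$3 + x$4 + x$5 = 0"
      "x$1 + x$2 + x$3 + 2 * x$4 + x$5 = 0" "x$1 + x$2 + x$3 + x$4 + 2 * x$5 = 0"
      using that by (simp_all add: matrix_vector_mult_def sum_5 thomae_matrix_def vec5_eq_iff)
    then have "x$1 = 0" "x$2 = 0" "x$3 = 0" "x$4 = 0" "x$5 = 0"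
      by algebra+
    then show ?thesis by (simp add: vec5_eq_iff)
  qed
  then show ?thesis
    by (simp add: invertible_left_inverse matrix_left_invertible_ker)
qed

lemma coords_from_coords: "from_coords X v* matrix_inv thomae_matrix = X"
  and from_coords_coords: "from_coords (p v* matrix_inv thomae_matrix) = p"
proof -
  have "thomae_matrix ** matrix_inv thomae_matrix = mat 1 \<and>
      matrix_inv thomae_matrix ** thomae_matrix = mat 1"
    using invertible_thomae_matrix unfolding invertible_def matrix_inv_def by (rule someI_ex)
  then show "from_coords X v* matrix_inv thomae_matrix = X"
    and "from_coords (p v* matrix_inv thomae_matrix) = p"
    by (simp_all only: vector_matrix_mul_assoc vector_matrix_mul_rid)
qed

lemma thomae_map_from_coords:
  "thomae_map \<sigma> (from_coords X) = from_coords (\<chi> i. X $ \<sigma> i)"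
  by (simp add: thomae_map_def coords_from_coords)

lemma thomae_map_inverse:
  assumes "\<sigma> permutes UNIV"
  shows "inv (thomae_map \<sigma>) = thomae_map (inv \<sigma>)"
proof (rule inv_equality)
  have *: "\<exists>X. p = from_coords X" for p
    using from_coords_coords[of p] by metis
  show "thomae_map (inv \<sigma>) (thomae_map \<sigma> p) = p" for p
    using *[of p] assms by (auto simp: thomae_map_from_coords permutes_inverses)
  show "thomae_map \<sigma> (thomae_map (inv \<sigma>) p) = p" for p
    using *[of p] assms by (auto simp: thomae_map_from_coords permutes_inverses)
qed

text \<open>In the pair sums s = \<open>X$2 + X$4\<close> and s' = \<open>X$3 + X$5\<close> the two
  equations of the plane read 2 s + s' = 1 and s + 2 s' = 1. This is the origin of 1/3.\<close>

lemma from_coords_dixon_iff: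
  "from_coords X \<in> dixon_plane \<longleftrightarrow> X$2 + X$4 = 1/3 \<and> X$3 + X$5 = 1/3"
proof -
  have "from_coords X \<in> dixon_plane \<longleftrightarrow>
      2 * (X$2 + X$4) + (X$3 + X$5) = 1 \<and> (X$2 + X$4) + 2 * (X$3 + X$5) = 1"
    by (simp add: dixon_plane_def from_coords_nth) (safe; algebra)
  also have "\<dots> \<longleftrightarrow> X$2 + X$4 = 1/3 \<and> X$3 + X$5 = 1/3"
  proof safe
    assume *: "2 * (X$2 + X$4) + (X$3 + X$5) = 1" "(X$2 + X$4) + 2 * (X$3 + X$5) = 1"
    have "3 * (X$2 + X$4) = 1" "3 * (X$3 + X$5) = 1"
      using * by algebra+
    then show "X$2 + X$4 = 1/3" "X$3 + X$5 = 1/3"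
      by (simp_all add: field_simps)
  qed (simp_all only:, simp_all)
  finally show ?thesis .
qed

definition whipple_coords :: "complex \<Rightarrow> complex \<Rightarrow> complex \<Rightarrow> complex^5" where
  "whipple_coords x z u = vector [x, x + 1/2, z, u, u + 1/2]"

lemma from_coords_whipple_iff:
  "from_coords X \<in> whipple_plane \<longleftrightarrow> (\<exists>x z u. X = whipple_coords x z u)"
proof -
  have "from_coords X \<in> whipple_plane \<longleftrightarrow> X$2 = X$1 + 1/2 \<and> X$5 = X$4 + 1/2"
    by (simp add: whipple_plane_def from_coords_nth)
  also have "\<dots> \<longleftrightarrow> (\<exists>x z u. X = whipple_coords x z u)"
    by (auto simp: vec5_eq_iff whipple_coords_def)
  finally show ?thesis .
qed

lemma whipple_proj_coords:
  "whipple_proj (from_coords (whipple_coords x z u)) =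
     vector [2 * x + 4 * u + 1, z + 2 * u + 1/2, 4 * x + z + 4 * u + 3/2]"
  by (simp add: whipple_proj_def vec3_eq_iff from_coords_nth whipple_coords_def algebra_simps)

lemma id_in_thomae_group: "id \<in> thomae_group"
proof -
  have "thomae_map id = id"
    by (simp add: fun_eq_iff thomae_map_def from_coords_coords)
  then show ?thesis
    unfolding thomae_group_def by (metis (mono_tags, lifting) mem_Collect_eq permutes_id)
qed

text \<open>At a common point \<open>S d = T w\<close> the projection returns
  \<open>whipple_proj w\<close>, so only the relative permutation \<open>\<rho>\<close> of the two
  planes matters. Conversely, every \<open>\<rho>\<close> is realised with \<open>T = id\<close> by
  moving the Dixon plane with \<open>inv \<rho>\<close>.\<close>

lemma mem_projected_intersection:
  "q \<in> projected_intersection \<longleftrightarrow>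
    (\<exists>\<rho> x z u. \<rho> permutes UNIV \<and>
       whipple_coords x z u $ \<rho> 2 + whipple_coords x z u $ \<rho> 4 = 1/3 \<and>
       whipple_coords x z u $ \<rho> 3 + whipple_coords x z u $ \<rho> 5 = 1/3 \<and>
       q = vector [2 * x + 4 * u + 1, z + 2 * u + 1/2, 4 * x + z + 4 * u + 3/2])"
    (is "?L \<longleftrightarrow> ?R")
proof
  assume ?L
  then obtain S T d w where S: "S \<in> thomae_group" and T: "T \<in> thomae_group"
    and d: "d \<in> dixon_plane" and w: "w \<in> whipple_plane" and eq: "S d = T w"
    and q: "q = whipple_proj (inv T (T w))"
    by (auto simp: projected_intersection_def thomae_orbit_def)
  obtain \<sigma> \<tau> where \<sigma>: "\<sigma> permutes UNIV" "S = thomae_map \<sigma>"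
    and \<tau>: "\<tau> permutes UNIV" "T = thomae_map \<tau>"
    using S T by (auto simp: thomae_group_def)
  obtain X where X: "d = from_coords X"
    using from_coords_coords by metis
  obtain x z u where Y: "w = from_coords (whipple_coords x z u)"
    using w from_coords_whipple_iff from_coords_coords by metis
  define \<rho> where "\<rho> = \<tau> \<circ> inv \<sigma>"
  have \<rho>: "\<rho> permutes UNIV"
    unfolding \<rho>_def using \<sigma> \<tau> by (intro permutes_compose permutes_inv)
  have "(\<chi> i. X $ \<sigma> i) = (\<chi> i. whipple_coords x z u $ \<tau> i)"
    using eq coords_from_coords unfolding \<sigma> \<tau> X Y thomae_map_from_coords by metis
  then have "X $ \<sigma> i = whipple_coords x z u $ \<tau> i" for i
    by (simp add: vec_eq_iff)
  from this[of "inv \<sigma> i" for i] have "X $ i = whipple_coords x z u $ \<rho> i" for i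
    using \<sigma> by (simp add: \<rho>_def permutes_inverses)
  then have "whipple_coords x z u $ \<rho> 2 + whipple_coords x z u $ \<rho> 4 = 1/3 \<and>
     whipple_coords x z u $ \<rho> 3 + whipple_coords x z u $ \<rho> 5 = 1/3"
    using d unfolding X from_coords_dixon_iff by simp
  moreover have "inv T (T w) = w"
    using \<tau> by (simp add: thomae_map_inverse Y thomae_map_from_coords permutes_inverses)
  ultimately show ?R
    using \<rho> unfolding q Y by (auto simp: whipple_proj_coords)
next
  assume ?R
  then obtain \<rho> x z u where \<rho>: "\<rho> permutes UNIV"
    and 1: "whipple_coords x z u $ \<rho> 2 + whipple_coords x z u $ \<rho> 4 = 1/3"
    and 2: "whipple_coords x z u $ \<rho> 3 + whipple_coords x z u $ \<rho> 5 = 1/3"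
    and q: "q = vector [2 * x + 4 * u + 1, z + 2 * u + 1/2, 4 * x + z + 4 * u + 3/2]"
    by blast
  define w d where "w = from_coords (whipple_coords x z u)"
    and "d = from_coords (\<chi> i. whipple_coords x z u $ \<rho> i)"
  have "d \<in> dixon_plane"
    unfolding d_def from_coords_dixon_iff using 1 2 by simp
  moreover have "thomae_map (inv \<rho>) d = w"
    using \<rho> by (simp add: d_def w_def thomae_map_from_coords permutes_inverses)
  ultimately have wV: "w \<in> thomae_map (inv \<rho>) ` dixon_plane"
    by blast
  have wW: "w \<in> whipple_plane"
    unfolding w_def from_coords_whipple_iff by blast
  have V: "thomae_map (inv \<rho>) ` dixon_plane \<in> thomae_orbit dixon_plane"
    using \<rho> permutes_inv unfolding thomae_orbit_def thomae_group_def by blast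
  have W: "whipple_plane \<in> thomae_orbit whipple_plane"
    using id_in_thomae_group unfolding thomae_orbit_def mem_Collect_eq
    by (intro exI[of _ id]) simp
  have "q = (whipple_proj \<circ> inv id) w"
    by (simp add: q w_def whipple_proj_coords)
  then have "q \<in> (whipple_proj \<circ> inv id) ` (thomae_map (inv \<rho>) ` dixon_plane \<inter> whipple_plane)"
    using wV wW by blast
  moreover have "whipple_plane = id ` whipple_plane" by simp
  ultimately show ?L
    using V W id_in_thomae_group unfolding projected_intersection_def by blast
qed

section \<open>The symmetry group of order four and saturations\<close>

text \<open>Swap and Euler's transformation are commuting involutions, so they generate a Klein
  four-group.\<close>

lemma symmetries_eq: "symmetries = {id, upper_swap, euler_map, upper_swap \<circ> euler_map}"
proof -
  have rules: "upper_swap (upper_swap p) = p" "euler_map (euler_map p) = p"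
    "euler_map (upper_swap p) = upper_swap (euler_map p)" for p
    by (simp_all add: upper_swap_def euler_map_def vec3_eq_iff)
  have "g \<in> {id, upper_swap, euler_map, upper_swap \<circ> euler_map}" if "g \<in> symmetries" for g
    using that
    by induction (auto simp: rules comp_def id_def)
  moreover have "id \<in> symmetries" "upper_swap \<circ> id \<in> symmetries" "euler_map \<circ> id \<in> symmetries"
    "upper_swap \<circ> (euler_map \<circ> id) \<in> symmetries"
    by (intro symmetries.intros)+
  ultimately show ?thesis by auto
qed

text \<open>Each of the four symmetries is its own inverse, so membership of \<open>p\<close> in an
  image of \<open>S\<close> can be tested by applying the same symmetry to \<open>p\<close>.\<close>

lemma mem_saturation:
  "p \<in> saturation S \<longleftrightarrow> p \<in> S \<or> vector [p$2, p$1, p$3] \<in> S \<or>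
     vector [p$3 - p$1, p$3 - p$2, p$3] \<in> S \<or> vector [p$3 - p$2, p$3 - p$1, p$3] \<in> S"
proof -
  have inv: "p \<in> g ` S \<longleftrightarrow> g p \<in> S" if "\<And>p. g (g p) = p" for g :: "complex^3 \<Rightarrow> complex^3"
    using that by (metis imageE image_eqI)
  have "p \<in> upper_swap ` S \<longleftrightarrow> upper_swap p \<in> S" "p \<in> euler_map ` S \<longleftrightarrow> euler_map p \<in> S"
    "p \<in> (upper_swap \<circ> euler_map) ` S \<longleftrightarrow> (upper_swap \<circ> euler_map) p \<in> S"
    by (intro inv; simp add: upper_swap_def euler_map_def vec3_eq_iff)+
  then show ?thesis
    by (auto simp: saturation_def symmetries_eq upper_swap_def euler_map_def)
qed

lemma saturation_mono: "S \<subseteq> T \<Longrightarrow> saturation S \<subseteq> saturation T"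
  by (auto simp: saturation_def)

lemma saturation_idem: "saturation (saturation S) = saturation S"
proof -
  have "vector [p$1, p$2, p$3] = p" for p :: "complex^3"
    by (simp add: vec3_eq_iff)
  then show ?thesis
    by (auto simp: mem_saturation)
qed

lemma range_line_eqs:
  "range line_i = {p. p$2 = 2/3 * (p$1 + 4) - 1 \<and> p$3 = 1 + 1/3 * (p$1 + 4)}"
  "range line_ii = {p. p$2 = 1/4 * (p$1 + 3/2) + 1/4 \<and> p$3 = 3/4 * (p$1 + 3/2) - 1/4}"
  "range line_iii = {p. p$2 = 1/4 * (p$1 + 1/2) \<and> p$3 = 3/4 * (p$1 + 1/2)}"
  "range line_iv = {p. p$2 = 2/3 * (p$1 - 2) \<and> p$3 = 1/3 * (p$1 - 2)}"
proof -
  \<comment> \<open>\<open>f\<close> recovers the parameter from the first component of a point, in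
    which the parameter has coefficient 1 on all four lines.\<close>
  have *: "range L = {p. P p}"
    if "\<And>a. P (L a)" "\<And>p. P p \<Longrightarrow> L (f p) = p" for L :: "complex \<Rightarrow> complex^3" and P f
    using that by (metis (mono_tags) rangeI mem_Collect_eq equalityI image_subsetI subsetI)
  show "range line_i = {p. p$2 = 2/3 * (p$1 + 4) - 1 \<and> p$3 = 1 + 1/3 * (p$1 + 4)}"
    by (rule *[where f = "\<lambda>p. p$1 + 4"]) (auto simp: line_i_def vec3_eq_iff)
  show "range line_ii = {p. p$2 = 1/4 * (p$1 + 3/2) + 1/4 \<and> p$3 = 3/4 * (p$1 + 3/2) - 1/4}"
    by (rule *[where f = "\<lambda>p. p$1 + 3/2"]) (auto simp: line_ii_def vec3_eq_iff)
  show "range line_iii = {p. p$2 = 1/4 * (p$1 + 1/2) \<and> p$3 = 3/4 * (p$1 + 1/2)}"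
    by (rule *[where f = "\<lambda>p. p$1 + 1/2"]) (auto simp: line_iii_def vec3_eq_iff)
  show "range line_iv = {p. p$2 = 2/3 * (p$1 - 2) \<and> p$3 = 1/3 * (p$1 - 2)}"
    by (rule *[where f = "\<lambda>p. p$1 - 2"]) (auto simp: line_iv_def vec3_eq_iff)
qed

section \<open>The fifteen choices of two disjoint pairs\<close>

text \<open>Five omitted indices times three pairings of the remaining four, listed by omitted
  index. \<open>Q\<close> takes a set, so the order within a pair is immaterial; all quadruples are
  checked by enumeration.\<close>

lemma disjoint_pairs_5:
  fixes i j k l :: 5
  assumes "distinct [i, j, k, l]" "Q {i, j}" "Q {k, l}"
  shows "Q {2,3} \<and> Q {4,5} \<or> Q {2,4} \<and> Q {3,5} \<or> Q {2,5} \<and> Q {3,4} \<or>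
     Q {1,3} \<and> Q {4,5} \<or> Q {1,4} \<and> Q {3,5} \<or> Q {1,5} \<and> Q {3,4} \<or>
     Q {1,2} \<and> Q {4,5} \<or> Q {1,4} \<and> Q {2,5} \<or> Q {1,5} \<and> Q {2,4} \<or>
     Q {1,2} \<and> Q {3,5} \<or> Q {1,3} \<and> Q {2,5} \<or> Q {1,5} \<and> Q {2,3} \<or>
     Q {1,2} \<and> Q {3,4} \<or> Q {1,3} \<and> Q {2,4} \<or> Q {1,4} \<and> Q {2,3}"
proof -
  have "\<forall>i j k l :: 5. distinct [i, j, k, l] \<longrightarrow> Q {i, j} \<longrightarrow> Q {k, l} \<longrightarrow>
     Q {2,3} \<and> Q {4,5} \<or> Q {2,4} \<and> Q {3,5} \<or> Q {2,5} \<and> Q {3,4} \<or>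
     Q {1,3} \<and> Q {4,5} \<or> Q {1,4} \<and> Q {3,5} \<or> Q {1,5} \<and> Q {3,4} \<or>
     Q {1,2} \<and> Q {4,5} \<or> Q {1,4} \<and> Q {2,5} \<or> Q {1,5} \<and> Q {2,4} \<or>
     Q {1,2} \<and> Q {3,5} \<or> Q {1,3} \<and> Q {2,5} \<or> Q {1,5} \<and> Q {2,3} \<or>
     Q {1,2} \<and> Q {3,4} \<or> Q {1,3} \<and> Q {2,4} \<or> Q {1,4} \<and> Q {2,3}"
    unfolding forall_5 by (intro conjI; simp add: insert_commute)
  from this[THEN spec, THEN spec, THEN spec, THEN spec, THEN mp, THEN mp, THEN mp, OF assms]
  show ?thesis .
qed

text \<open>The argument order follows the Dixon conditions: {i, j} and {k, l} become the two pairs,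
  and \<open>m\<close> is the omitted index.\<close>

lemma permutation_5:
  fixes i j k l m :: 5
  assumes "distinct [m, i, k, j, l]"
  obtains \<rho> where "\<rho> permutes UNIV" "\<rho> 1 = m" "\<rho> 2 = i" "\<rho> 3 = k" "\<rho> 4 = j" "\<rho> 5 = l"
proof
  let ?\<rho> = "\<lambda>n::5. if n = 1 then m else if n = 2 then i else if n = 3 then k else if n = 4 then j else l"
  have "inj ?\<rho>"
    using assms by (auto simp: inj_def forall_5)
  then show "?\<rho> permutes UNIV"
    by (intro inj_imp_permutes) auto
qed simp_all

text \<open>Euler's transformation keeps \<open>p$3\<close> and reverses the sign of
  \<open>p$1 - p$2\<close>, so it affects the Kummer equation just as the swap does, and only two
  equations remain.\<close>

lemma kummer_saturation:
  "p \<in> saturation kummer_plane \<longleftrightarrow> p$3 = 1 + p$1 - p$2 \<or> p$3 = 1 + p$2 - p$1"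
  by (auto simp: mem_saturation kummer_plane_def algebra_simps)

text \<open>The pairs {1,4} and {2,3} give x = 1/3 - u and z = u - 1/2, and u is then matched to the
  parameter of the line. The next three lemmas use {1,2}, {3,4} for (ii), {1,2}, {3,5} for (iii) and
  {1,3}, {2,5} for (iv).\<close>

lemma line_i_mem_projected: "line_i a \<in> saturation projected_intersection"
proof -
  obtain \<rho> :: "5 \<Rightarrow> 5" where \<rho>: "\<rho> permutes UNIV" "\<rho> 1 = 5" "\<rho> 2 = 1" "\<rho> 3 = 2" "\<rho> 4 = 4" "\<rho> 5 = 3"
    using permutation_5[of 5 1 2 4 3] by auto
  define u where "u = (a - 4) / 3"
  have "vector [2/3 * a - 1, a - 4, 1 + 1/3 * a] \<in> projected_intersection"
    unfolding mem_projected_intersection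
    by (rule exI[of _ \<rho>], rule exI[of _ "1/3 - u"], rule exI[of _ "u - 1/2"], rule exI[of _ u])
       (simp add: \<rho> whipple_coords_def vec3_eq_iff u_def field_simps)
  then show ?thesis by (simp add: mem_saturation line_i_def)
qed

lemma line_ii_mem_projected: "line_ii a \<in> saturation projected_intersection"
proof -
  obtain \<rho> :: "5 \<Rightarrow> 5" where \<rho>: "\<rho> permutes UNIV" "\<rho> 1 = 5" "\<rho> 2 = 1" "\<rho> 3 = 3" "\<rho> 4 = 2" "\<rho> 5 = 4"
    using permutation_5[of 5 1 3 2 4] by auto
  define u where "u = (a - 7/3) / 4"
  have "vector [a - 3/2, 1/4 * a + 1/4, 3/4 * a - 1/4] \<in> projected_intersection"
    unfolding mem_projected_intersection
    by (rule exI[of _ \<rho>], rule exI[of _ "-1/12"], rule exI[of _ "1/3 - u"], rule exI[of _ u])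
       (simp add: \<rho> whipple_coords_def vec3_eq_iff u_def field_simps)
  then show ?thesis by (simp add: mem_saturation line_ii_def)
qed

lemma line_iii_mem_projected: "line_iii a \<in> saturation projected_intersection"
proof -
  obtain \<rho> :: "5 \<Rightarrow> 5" where \<rho>: "\<rho> permutes UNIV" "\<rho> 1 = 4" "\<rho> 2 = 1" "\<rho> 3 = 3" "\<rho> 4 = 2" "\<rho> 5 = 5"
    using permutation_5[of 4 1 3 2 5] by auto
  define u where "u = (a - 4/3) / 4"
  have "vector [a - 1/2, 1/4 * a, 3/4 * a] \<in> projected_intersection"
    unfolding mem_projected_intersection
    by (rule exI[of _ \<rho>], rule exI[of _ "-1/12"], rule exI[of _ "-1/6 - u"], rule exI[of _ u])
       (simp add: \<rho> whipple_coords_def vec3_eq_iff u_def field_simps)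
  then show ?thesis by (simp add: mem_saturation line_iii_def)
qed

lemma line_iv_mem_projected: "line_iv a \<in> saturation projected_intersection"
proof -
  obtain \<rho> :: "5 \<Rightarrow> 5" where \<rho>: "\<rho> permutes UNIV" "\<rho> 1 = 4" "\<rho> 2 = 1" "\<rho> 3 = 2" "\<rho> 4 = 3" "\<rho> 5 = 5"
    using permutation_5[of 4 1 2 3 5] by auto
  define u where "u = (a + 1/2) / 3"
  have "vector [2/3 * a, a + 2, 1/3 * a] \<in> projected_intersection"
    unfolding mem_projected_intersection
    by (rule exI[of _ \<rho>], rule exI[of _ "-2/3 - u"], rule exI[of _ "1 + u"], rule exI[of _ u])
       (simp add: \<rho> whipple_coords_def vec3_eq_iff u_def field_simps)
  then show ?thesis by (simp add: mem_saturation line_iv_def)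
qed

text \<open>For the pairs {1,5} and {2,4} both conditions say x + u = -1/6, so two free parameters
  survive. This is the only choice with a two-dimensional solution set.\<close>

lemma kummer_mem_projected:
  assumes "p \<in> kummer_plane"
  shows "p \<in> saturation projected_intersection"
proof -
  obtain \<rho> :: "5 \<Rightarrow> 5" where \<rho>: "\<rho> permutes UNIV" "\<rho> 1 = 3" "\<rho> 2 = 1" "\<rho> 3 = 2" "\<rho> 4 = 5" "\<rho> 5 = 4"
    using permutation_5[of 3 1 2 5 4] by auto
  define u where "u = (p$2 - 2/3) / 2"
  have "vector [p$2, p$1, 1 + p$1 - p$2] \<in> projected_intersection"
    unfolding mem_projected_intersection
    by (rule exI[of _ \<rho>], rule exI[of _ "-1/6 - u"], rule exI[of _ "p$1 - 2 * u - 1/2"], rule exI[of _ u])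
       (simp add: \<rho> whipple_coords_def vec3_eq_iff u_def field_simps)
  then show ?thesis using assms by (simp add: mem_saturation kummer_plane_def)
qed

text \<open>One choice is contradictory and one gives the whole Kummer plane. The four further
  choices containing {1,5} or {2,4} impose the same equation x + u = -1/6 and thus lie in that plane
  up to symmetry, as does {1,2}, {4,5}. The remaining eight produce each of the four lines twice,
  once directly and once through Euler's transformation.\<close>

lemma projected_intersection_subset: "projected_intersection \<subseteq> saturation
    (kummer_plane \<union> range line_i \<union> range line_ii \<union> range line_iii \<union> range line_iv)"
proof
  fix q assume "q \<in> projected_intersection"
  then obtain \<rho> x z u where \<rho>: "\<rho> permutes UNIV"
    and 1: "whipple_coords x z u $ \<rho> 2 + whipple_coords x z u $ \<rho> 4 = 1/3"
    and 2: "whipple_coords x z u $ \<rho> 3 + whipple_coords x z u $ \<rho> 5 = 1/3"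
    and q: "q = vector [2 * x + 4 * u + 1, z + 2 * u + 1/2, 4 * x + z + 4 * u + 3/2]"
    unfolding mem_projected_intersection by blast
  define Q where "Q = (\<lambda>s. (\<Sum>i\<in>s. whipple_coords x z u $ i) = 1/3)"
  have Q: "Q {1,2} \<longleftrightarrow> x + (x + 1/2) = 1/3" "Q {1,3} \<longleftrightarrow> x + z = 1/3" "Q {1,4} \<longleftrightarrow> x + u = 1/3" "Q {1,5} \<longleftrightarrow> x + (u + 1/2) = 1/3" "Q {2,3} \<longleftrightarrow> (x + 1/2) + z = 1/3" "Q {2,4} \<longleftrightarrow> (x + 1/2) + u = 1/3" "Q {2,5} \<longleftrightarrow> (x + 1/2) + (u + 1/2) = 1/3" "Q {3,4} \<longleftrightarrow> z + u = 1/3" "Q {3,5} \<longleftrightarrow> z + (u + 1/2) = 1/3" "Q {4,5} \<longleftrightarrow> u + (u + 1/2) = 1/3"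
    by (simp_all add: Q_def whipple_coords_def add_ac)
  have "inj \<rho>" using \<rho> by (rule permutes_inj)
  then have distinct: "distinct [\<rho> 2, \<rho> 4, \<rho> 3, \<rho> 5]"
    by (simp add: inj_eq)
  then have "Q {\<rho> 2, \<rho> 4}" "Q {\<rho> 3, \<rho> 5}"
    using 1 2 by (simp_all add: Q_def)
  from disjoint_pairs_5[where Q = Q, OF distinct this] show "q \<in> saturation
    (kummer_plane \<union> range line_i \<union> range line_ii \<union> range line_iii \<union> range line_iv)"
  proof (elim disjE conjE, goal_cases)
    case 1
    then have "x = -1/6 - z" "u = -1/12"
      unfolding Q by algebra+
    then show ?case
      by (simp only: q) (simp add: mem_saturation range_line_eqs kummer_plane_def field_simps)
  next
    case 2
    then have "x = -1/6 - u" "z = -1/6 - u"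
      unfolding Q by algebra+
    then show ?case
      by (simp only: q) (simp add: mem_saturation range_line_eqs kummer_plane_def field_simps)
  next
    case 3
    then have "x = -2/3 - u" "z = 1/3 - u"
      unfolding Q by algebra+
    then show ?case
      by (simp only: q) (simp add: mem_saturation range_line_eqs kummer_plane_def field_simps)
  next
    case 4
    then have "x = 1/3 - z" "u = -1/12"
      unfolding Q by algebra+
    then show ?case
      by (simp only: q) (simp add: mem_saturation range_line_eqs kummer_plane_def field_simps)
  next
    case 5
    then have "x = 1/3 - u" "z = -1/6 - u"
      unfolding Q by algebra+
    then show ?case
      by (simp only: q) (simp add: mem_saturation range_line_eqs kummer_plane_def field_simps)
  next
    case 6
    then have "x = -1/6 - u" "z = 1/3 - u"
      unfolding Q by algebra+
    then show ?case
      by (simp only: q) (simp add: mem_saturation range_line_eqs kummer_plane_def field_simps)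
  next
    case 7
    then have "x = -1/12" "u = -1/12"
      unfolding Q by algebra+
    then show ?case
      by (simp only: q) (simp add: mem_saturation range_line_eqs kummer_plane_def field_simps)
  next
    case 8
    \<comment> \<open>The pairs {1,4} and {2,5} demand x + u = 1/3 and x + u = -2/3.\<close>
    then have False unfolding Q by algebra
    then show ?case ..
  next
    case 9
    then have "x = -1/6 - u"
      unfolding Q by algebra+
    then show ?case
      by (simp only: q) (simp add: mem_saturation range_line_eqs kummer_plane_def field_simps)
  next
    case 10
    then have "x = -1/12" "z = -1/6 - u"
      unfolding Q by algebra+
    then show ?case
      by (simp only: q) (simp add: mem_saturation range_line_eqs kummer_plane_def field_simps)
  next
    case 11
    then have "x = -2/3 - u" "z = 1 + u"
      unfolding Q by algebra+
    then show ?case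
      by (simp only: q) (simp add: mem_saturation range_line_eqs kummer_plane_def field_simps)
  next
    case 12
    then have "x = -1/6 - u" "z = 0 + u"
      unfolding Q by algebra+
    then show ?case
      by (simp only: q) (simp add: mem_saturation range_line_eqs kummer_plane_def field_simps)
  next
    case 13
    then have "x = -1/12" "z = 1/3 - u"
      unfolding Q by algebra+
    then show ?case
      by (simp only: q) (simp add: mem_saturation range_line_eqs kummer_plane_def field_simps)
  next
    case 14
    then have "x = -1/6 - u" "z = 1/2 + u"
      unfolding Q by algebra+
    then show ?case
      by (simp only: q) (simp add: mem_saturation range_line_eqs kummer_plane_def field_simps)
  next
    case 15
    then have "x = 1/3 - u" "z = -1/2 + u"
      unfolding Q by algebra+
    then show ?case
      by (simp only: q) (simp add: mem_saturation range_line_eqs kummer_plane_def field_simps)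

  qed
qed

lemma saturation_projected_intersection: "saturation projected_intersection = saturation
    (kummer_plane \<union> range line_i \<union> range line_ii \<union> range line_iii \<union> range line_iv)"
proof
  show "saturation projected_intersection \<subseteq> saturation
    (kummer_plane \<union> range line_i \<union> range line_ii \<union> range line_iii \<union> range line_iv)"
    using saturation_mono[OF projected_intersection_subset] by (simp add: saturation_idem)
  have "kummer_plane \<union> range line_i \<union> range line_ii \<union> range line_iii \<union> range line_iv
      \<subseteq> saturation projected_intersection"
    using kummer_mem_projected line_i_mem_projected line_ii_mem_projected line_iii_mem_projected
      line_iv_mem_projected by auto
  from saturation_mono[OF this] show "saturation
    (kummer_plane \<union> range line_i \<union> range line_ii \<union> range line_iii \<union> range line_iv) \<subseteq> saturation projected_intersection"
    by (simp add: saturation_idem)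
qed

text \<open>Two saturations differ as soon as one point lies in only one of them. The parameter 10
  is generic enough to separate each line from all later ones.\<close>

lemma card_line_saturations:
  "card (saturation ` {range line_i, range line_ii, range line_iii, range line_iv}) = 4"
proof -
  have m: "line_i 10 \<in> saturation (range line_i)" "line_ii 10 \<in> saturation (range line_ii)"
    "line_iii 10 \<in> saturation (range line_iii)"
    by (auto simp: mem_saturation)
  have "line_i 10 \<notin> saturation (range line_ii)" "line_i 10 \<notin> saturation (range line_iii)"
    "line_i 10 \<notin> saturation (range line_iv)"
    "line_ii 10 \<notin> saturation (range line_iii)" "line_ii 10 \<notin> saturation (range line_iv)"
    "line_iii 10 \<notin> saturation (range line_iv)"
    unfolding mem_saturation range_line_eqs
    by (simp_all add: line_i_def line_ii_def line_iii_def field_simps)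
  with m have "saturation (range line_i) \<noteq> saturation (range line_ii)"
     "saturation (range line_i) \<noteq> saturation (range line_iii)"
     "saturation (range line_i) \<noteq> saturation (range line_iv)"
     "saturation (range line_ii) \<noteq> saturation (range line_iii)"
     "saturation (range line_ii) \<noteq> saturation (range line_iv)"
     "saturation (range line_iii) \<noteq> saturation (range line_iv)"
    by blast+
  then show ?thesis by simp
qed

lemma lines_not_kummer:
  "\<forall>L\<in>{range line_i, range line_ii, range line_iii, range line_iv}. \<not> L \<subseteq> saturation kummer_plane"
proof -
  have "line_i 1 \<notin> saturation kummer_plane" "line_ii 0 \<notin> saturation kummer_plane"
    "line_iii 0 \<notin> saturation kummer_plane" "line_iv 0 \<notin> saturation kummer_plane"
    unfolding kummer_saturation by (simp_all add: line_i_def line_ii_def line_iii_def line_iv_def)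
  then show ?thesis by blast
qed

subsection \<open>Holomorphic continuation of the series\<close>

text \<open>The coefficient of the series divided by \<open>Gamma c\<close>, written so as to be
  entire in \<open>a\<close>, \<open>b\<close> and \<open>c\<close>; it stays meaningful where
  \<open>c\<close> is a non-positive integer.\<close>

definition hyp_coeff :: "complex \<Rightarrow> complex \<Rightarrow> complex \<Rightarrow> nat \<Rightarrow> complex" where
  "hyp_coeff a b c k = pochhammer a k * pochhammer b k * rGamma (c + of_nat k) / fact k"

text \<open>Kept free of division, so that it also covers the indices at which
  \<open>c + of_nat k\<close> vanishes.\<close>

lemma hyp_coeff_Suc:
  "(c + of_nat k) * of_nat (Suc k) * hyp_coeff a b c (Suc k) = (a + of_nat k) * (b + of_nat k) * hyp_coeff a b c k"
proof -
  have "(c + of_nat k) * rGamma (c + of_nat (Suc k)) = rGamma (c + of_nat k)"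
    using rGamma_plus1[of "c + of_nat k"] by (simp add: add_ac)
  then have "(c + of_nat k) * of_nat (Suc k) * hyp_coeff a b c (Suc k) =
      pochhammer a (Suc k) * pochhammer b (Suc k) * rGamma (c + of_nat k) * (of_nat (Suc k) / fact (Suc k))"
    by (simp add: hyp_coeff_def mult_ac)
  also have "of_nat (Suc k) / fact (Suc k) = (1 / fact k :: complex)"
    by (simp add: field_simps del: of_nat_Suc)
  finally show ?thesis
    by (simp add: hyp_coeff_def pochhammer_Suc mult_ac)
qed

section \<open>Decay of the coefficients, uniformly in the parameters\<close>

text \<open>With s = Re w + |w|^2 / 2 the square of the left side is 1 + 2 s, which is at most (1 +
  s)^2. Unlike the triangle inequality this retains the sign of Re w to first order.\<close>

lemma norm_one_plus_le: "norm (1 + w) \<le> 1 + Re w + (norm w)\<^sup>2 / 2" for w :: complex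
proof (rule power2_le_imp_le)
  have sq: "(norm w)\<^sup>2 = (Re w)\<^sup>2 + (Im w)\<^sup>2"
    by (rule cmod_power2)
  have "(norm (1 + w))\<^sup>2 = 1 + 2 * (Re w + (norm w)\<^sup>2 / 2)"
    unfolding sq cmod_power2 by (simp add: power2_eq_square algebra_simps)
  also have "\<dots> \<le> (1 + Re w + (norm w)\<^sup>2 / 2)\<^sup>2"
    using zero_le_power2[of "Re w + (norm w)\<^sup>2 / 2"] by (simp add: power2_sum algebra_simps)
  finally show "(norm (1 + w))\<^sup>2 \<le> (1 + Re w + (norm w)\<^sup>2 / 2)\<^sup>2" .
  have "0 \<le> (1 + Re w)\<^sup>2 + (Im w)\<^sup>2 + 1" by simp
  then show "0 \<le> 1 + Re w + (norm w)\<^sup>2 / 2"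
    unfolding sq by (simp add: power2_eq_square field_simps)
qed

text \<open>With n = k + 1 the ratio of consecutive coefficients is 1 + \<open>\<delta>\<close>/n +
  \<open>\<epsilon>\<close>, where \<open>\<delta>\<close> = a + b - c - 1 has real part at most -2
  \<open>\<sigma>\<close> and \<open>\<epsilon>\<close> is of order 1/n^2. Half of the gain 2
  \<open>\<sigma>\<close>/n absorbs the quadratic errors. The constants depend on the parameters
  only through \<open>L\<close> and \<open>\<sigma>\<close>.\<close>

lemma hyp_coeff_step:
  fixes L \<sigma> :: real
  assumes L: "norm (a - 1) \<le> L" "norm (b - 1) \<le> L" "norm (c - 1) \<le> L"
    and \<sigma>: "\<sigma> > 0" "Re (a + b - c) \<le> 1 - 2 * \<sigma>"
    and k: "real (Suc k) > 2 * L" "real (Suc k) \<ge> 13 * L\<^sup>2 / \<sigma>"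
  shows "norm (hyp_coeff a b c (Suc k)) \<le> (1 - \<sigma> / real (Suc k)) * norm (hyp_coeff a b c k)"
    and "norm (hyp_coeff a b c k - hyp_coeff a b c (Suc k)) \<le> (3 * L + 8 * L\<^sup>2) / real (Suc k) * norm (hyp_coeff a b c k)"
proof -
  define n where "n = real (Suc k)"
  define \<delta> where "\<delta> = a + b - c - 1"
  define \<epsilon> where "\<epsilon> = ((a - 1) * (b - 1) - \<delta> * (c - 1)) / ((of_real n + (c - 1)) * of_real n)"
  have n: "n \<ge> 1" "n > 2 * L" "n \<ge> 13 * L\<^sup>2 / \<sigma>" using k by (simp_all add: n_def)
  have L0: "L \<ge> 0" using L(1) norm_ge_zero order_trans by blast
  have nk: "of_real n = (1 + of_nat k :: complex)" by (simp add: n_def)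
  have \<delta>: "norm \<delta> \<le> 3 * L"
  proof -
    have "norm \<delta> = norm ((a - 1) + (b - 1) - (c - 1))" by (simp add: \<delta>_def algebra_simps)
    also have "\<dots> \<le> norm (a - 1) + norm (b - 1) + norm (c - 1)"
      using norm_triangle_ineq4[of "(a - 1) + (b - 1)" "c - 1"] norm_triangle_ineq[of "a - 1" "b - 1"]
      by linarith
    finally show ?thesis using L by linarith
  qed
  \<comment> \<open>The condition n > 2 L is there for this bound.\<close>
  have den: "norm (of_real n + (c - 1)) \<ge> n / 2"
    using norm_diff_ineq[of "of_real n" "c - 1"] L n by simp
  have P: "of_real n + (c - 1) \<noteq> 0"
    using den n by auto
  have n0: "of_real n \<noteq> (0::complex)" using n by simp
  have E: "norm \<epsilon> \<le> 8 * L\<^sup>2 / n\<^sup>2"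
  proof -
    have "norm ((a - 1) * (b - 1) - \<delta> * (c - 1)) \<le> norm (a - 1) * norm (b - 1) + norm \<delta> * norm (c - 1)"
      using norm_triangle_ineq4[of "(a - 1) * (b - 1)" "\<delta> * (c - 1)"] by (simp add: norm_mult)
    also have "\<dots> \<le> L * L + 3 * L * L"
      using L \<delta> L0 by (intro add_mono mult_mono) auto
    finally have num: "norm ((a - 1) * (b - 1) - \<delta> * (c - 1)) \<le> 4 * L\<^sup>2"
      by (simp add: power2_eq_square)
    have "norm \<epsilon> = norm ((a - 1) * (b - 1) - \<delta> * (c - 1)) / (norm (of_real n + (c - 1)) * n)"
      using n by (simp add: \<epsilon>_def norm_divide norm_mult)
    also have "\<dots> \<le> 4 * L\<^sup>2 / (n / 2 * n)"
      using num den n by (intro frac_le mult_mono) auto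
    also have "\<dots> = 8 * L\<^sup>2 / n\<^sup>2" by (simp add: power2_eq_square)
    finally show ?thesis .
  qed
  have r: "hyp_coeff a b c (Suc k) = (1 + \<delta> / of_real n + \<epsilon>) * hyp_coeff a b c k"
  proof -
    have nz: "(of_real n + (c - 1)) * of_real n \<noteq> 0"
      using P n0 by simp
    have "(1 + \<delta> / of_real n + \<epsilon>) * ((of_real n + (c - 1)) * of_real n) = (a + of_nat k) * (b + of_nat k)"
    proof -
      have "(1 + \<delta> / of_real n + \<epsilon>) * ((of_real n + (c - 1)) * of_real n)
          = (of_real n + (c - 1)) * of_real n + \<delta> * (of_real n + (c - 1)) + ((a - 1) * (b - 1) - \<delta> * (c - 1))"
      proof -
        have "(1 + \<delta> / m + X / (Q * m)) * (Q * m) = Q * m + \<delta> * Q + X"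
          if "Q \<noteq> 0" "m \<noteq> 0" for Q m X :: complex
          using that by (simp add: field_simps)
        from this[OF P n0] show ?thesis by (simp add: \<epsilon>_def)
      qed
      also have "\<dots> = (a + of_nat k) * (b + of_nat k)"
        unfolding nk \<delta>_def by (simp add: algebra_simps)
      finally show ?thesis .
    qed
    then have "(of_real n + (c - 1)) * of_real n * hyp_coeff a b c (Suc k)
        = (of_real n + (c - 1)) * of_real n * ((1 + \<delta> / of_real n + \<epsilon>) * hyp_coeff a b c k)"
      using hyp_coeff_Suc[of c k a b] by (simp add: nk mult_ac add_ac)
    then show ?thesis using nz by (metis mult_cancel_left)
  qed
  have "norm (1 + \<delta> / of_real n + \<epsilon>) \<le> 1 - \<sigma> / n"
  proof -
    have "norm (1 + \<delta> / of_real n) \<le> 1 + Re \<delta> / n + (norm \<delta> / n)\<^sup>2 / 2"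
      using norm_one_plus_le[of "\<delta> / of_real n"] n by (simp add: norm_divide)
    also have "Re \<delta> / n \<le> - 2 * \<sigma> / n"
      using \<sigma> n by (intro divide_right_mono) (auto simp: \<delta>_def)
    also have "(norm \<delta> / n)\<^sup>2 / 2 \<le> (3 * L / n)\<^sup>2 / 2"
      using \<delta> n by (intro divide_right_mono power_mono) auto
    finally have "norm (1 + \<delta> / of_real n + \<epsilon>) \<le> 1 + - 2 * \<sigma> / n + (3 * L / n)\<^sup>2 / 2 + 8 * L\<^sup>2 / n\<^sup>2"
      using E norm_triangle_ineq[of "1 + \<delta> / of_real n" \<epsilon>] by linarith
    \<comment> \<open>12.5 is 9/2 from the square of \<open>\<delta>\<close>/n plus 8 from
      \<open>\<epsilon>\<close>; the hypothesis with 13 dominates it.\<close>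
    also have "(3 * L / n)\<^sup>2 / 2 + 8 * L\<^sup>2 / n\<^sup>2 = (12.5 * L\<^sup>2 / n) / n"
      by (simp add: power2_eq_square field_simps)
    then have "1 + - 2 * \<sigma> / n + (3 * L / n)\<^sup>2 / 2 + 8 * L\<^sup>2 / n\<^sup>2 = 1 + - 2 * \<sigma> / n + (12.5 * L\<^sup>2 / n) / n"
      by linarith
    also have "12.5 * L\<^sup>2 / n \<le> \<sigma>"
    proof -
      have "12.5 * L\<^sup>2 \<le> 13 * L\<^sup>2" by simp
      also have "\<dots> \<le> \<sigma> * n" using n \<sigma> by (simp add: field_simps)
      finally show ?thesis using n by (simp add: field_simps)
    qed
    then have "1 + - 2 * \<sigma> / n + (12.5 * L\<^sup>2 / n) / n \<le> 1 + - 2 * \<sigma> / n + \<sigma> / n"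
      using n by (intro add_left_mono divide_right_mono) auto
    finally show ?thesis by (simp add: field_simps)
  qed
  then show "norm (hyp_coeff a b c (Suc k)) \<le> (1 - \<sigma> / real (Suc k)) * norm (hyp_coeff a b c k)"
    unfolding r norm_mult n_def[symmetric] by (intro mult_right_mono) auto
  have "norm (\<delta> / of_real n + \<epsilon>) \<le> (3 * L + 8 * L\<^sup>2) / n"
  proof -
    have "norm (\<delta> / of_real n + \<epsilon>) \<le> norm \<delta> / n + norm \<epsilon>"
      using norm_triangle_ineq[of "\<delta> / of_real n" \<epsilon>] n by (simp add: norm_divide)
    also have "\<dots> \<le> 3 * L / n + 8 * L\<^sup>2 / n"
    proof (intro add_mono)
      show "norm \<delta> / n \<le> 3 * L / n" using \<delta> n by (intro divide_right_mono) auto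
      have "8 * L\<^sup>2 / n\<^sup>2 \<le> 8 * L\<^sup>2 / n"
        using n by (intro divide_left_mono) (auto simp: power2_eq_square)
      then show "norm \<epsilon> \<le> 8 * L\<^sup>2 / n" using E by linarith
    qed
    finally show ?thesis by (simp add: add_divide_distrib)
  qed
  moreover have "norm (hyp_coeff a b c k - hyp_coeff a b c (Suc k)) = norm (\<delta> / of_real n + \<epsilon>) * norm (hyp_coeff a b c k)"
  proof -
    have "hyp_coeff a b c k - hyp_coeff a b c (Suc k) = - ((\<delta> / of_real n + \<epsilon>) * hyp_coeff a b c k)"
      unfolding r by (simp add: algebra_simps)
    then show ?thesis by (simp only: norm_minus_cancel norm_mult)
  qed
  ultimately show "norm (hyp_coeff a b c k - hyp_coeff a b c (Suc k)) \<le> (3 * L + 8 * L\<^sup>2) / real (Suc k) * norm (hyp_coeff a b c k)"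
    unfolding n_def[symmetric] by (metis mult_right_mono norm_ge_zero)
qed

text \<open>The inequality ln (1 + 1/n) <= 1/n gives 1 - \<open>\<sigma>\<close>/n <= exp
  (-\<open>\<sigma>\<close>/n) <= (n / (n + 1))^\<open>\<sigma>\<close>, and the product of these
  bounds telescopes.\<close>

lemma power_decay:
  fixes x :: "nat \<Rightarrow> real" and \<sigma> :: real
  assumes step: "\<And>k. k \<ge> N \<Longrightarrow> x (Suc k) \<le> (1 - \<sigma> / real (Suc k)) * x k"
    and nonneg: "\<And>k. x k \<ge> 0" and \<sigma>: "\<sigma> > 0" and "k \<ge> N"
  shows "x k \<le> x N * real (Suc N) powr \<sigma> * real (Suc k) powr - \<sigma>"
  using \<open>k \<ge> N\<close>
proof (induction k rule: dec_induct)
  case base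
  show ?case by (simp add: powr_minus field_simps)
next
  case (step k)
  define n where "n = real (Suc k)"
  have n: "n > 0" by (simp add: n_def)
  have "1 - \<sigma> / n \<le> exp (- (\<sigma> / n))"
    using exp_ge_add_one_self[of "- (\<sigma> / n)"] by simp
  also have "\<dots> \<le> n powr \<sigma> * (n + 1) powr - \<sigma>"
  proof -
    have "ln (1 + 1 / n) \<le> 1 / n" using n by (intro ln_add_one_self_le_self) auto
    also have "1 + 1 / n = (n + 1) / n" using n by (simp add: field_simps)
    finally have "ln (n + 1) - ln n \<le> 1 / n" using n by (simp add: ln_div)
    then have "\<sigma> * (ln (n + 1) - ln n) \<le> \<sigma> * (1 / n)" using \<sigma> by (intro mult_left_mono) auto
    then show ?thesis
      using n by (simp add: powr_def exp_add[symmetric] algebra_simps)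
  qed
  finally have "x (Suc k) \<le> (n powr \<sigma> * (n + 1) powr - \<sigma>) * x k"
    using assms(1)[OF step(1)] nonneg[of k] unfolding n_def[symmetric]
    by (meson mult_right_mono order_trans)
  also have "\<dots> \<le> (n powr \<sigma> * (n + 1) powr - \<sigma>) * (x N * real (Suc N) powr \<sigma> * n powr - \<sigma>)"
    using step.IH n unfolding n_def[symmetric] by (intro mult_left_mono) auto
  also have "\<dots> = x N * real (Suc N) powr \<sigma> * (n + 1) powr - \<sigma>"
    using n by (simp add: powr_minus field_simps)
  finally show ?case by (simp add: n_def add_ac)
qed

text \<open>One step of Euler's transformation of an alternating series: it turns the conditionally
  convergent series into an absolutely and locally uniformly convergent one.\<close>

lemma alternating_sum_differences:
  fixes v :: "nat \<Rightarrow> 'a::field_char_0"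
  shows "(\<Sum>k<n. v k * (-1) ^ k) = (v 0 - v n * (-1) ^ n + (\<Sum>k<n. (v k - v (Suc k)) * (-1) ^ k)) / 2"
  by (induction n) (simp_all add: field_simps)

text \<open>Compactness supplies \<open>L\<close>, \<open>\<sigma>\<close>, \<open>N\<close> and
  \<open>B\<close> valid for all parameters at once. The terms are then of order
  k^(-\<open>\<sigma>\<close>), which need not be summable, but consecutive differences gain a
  factor 1/k and admit the M-test, while the boundary term tends to zero uniformly.\<close>

lemma hyp_series_uniform_limit:
  assumes K: "compact K" "K \<noteq> {}"
    and cont: "continuous_on K a" "continuous_on K b" "continuous_on K c"
    and excess: "\<And>t. t \<in> K \<Longrightarrow> Re (c t - a t - b t) > -1"
  shows "uniform_limit K (\<lambda>n t. \<Sum>k<n. hyp_coeff (a t) (b t) (c t) k * (-1) ^ k)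
     (\<lambda>t. (hyp_coeff (a t) (b t) (c t) 0 + (\<Sum>k. (hyp_coeff (a t) (b t) (c t) k - hyp_coeff (a t) (b t) (c t) (Suc k)) * (-1) ^ k)) / 2)
     sequentially"
proof -
  define v where "v = (\<lambda>k t. hyp_coeff (a t) (b t) (c t) k)"
  have bounded: "\<exists>B\<ge>0. \<forall>t\<in>K. norm (f t) \<le> B" if "continuous_on K f" for f :: "'a \<Rightarrow> complex"
  proof -
    have "compact (f ` K)" using that K(1) by (rule compact_continuous_image)
    then have "bounded (f ` K)" by (rule compact_imp_bounded)
    then obtain B where "\<forall>t\<in>K. norm (f t) \<le> B" unfolding bounded_iff by auto
    then have "\<forall>t\<in>K. norm (f t) \<le> max B 0" by auto
    then show ?thesis by (meson max.cobounded2)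
  qed
  obtain La Lb Lc where "\<forall>t\<in>K. norm (a t - 1) \<le> La" "\<forall>t\<in>K. norm (b t - 1) \<le> Lb" "\<forall>t\<in>K. norm (c t - 1) \<le> Lc"
    using bounded[of "\<lambda>t. a t - 1"] bounded[of "\<lambda>t. b t - 1"] bounded[of "\<lambda>t. c t - 1"]
      continuous_on_diff[OF cont(1) continuous_on_const] continuous_on_diff[OF cont(2) continuous_on_const]
      continuous_on_diff[OF cont(3) continuous_on_const] by metis
  then obtain L where L: "\<And>t. t \<in> K \<Longrightarrow> norm (a t - 1) \<le> L \<and> norm (b t - 1) \<le> L \<and> norm (c t - 1) \<le> L"
    by (metis max.coboundedI1 max.coboundedI2 max.commute)
  have "continuous_on K (\<lambda>t. Re (a t + b t - c t))" by (intro continuous_intros cont)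
  then obtain t0 where t0: "t0 \<in> K" "\<And>t. t \<in> K \<Longrightarrow> Re (a t + b t - c t) \<le> Re (a t0 + b t0 - c t0)"
    using continuous_attains_sup[OF K] by blast
  \<comment> \<open>Half the distance from 1 to the maximum of Re (a + b - c) over the compact
    set.\<close>
  define \<sigma> where "\<sigma> = (1 - Re (a t0 + b t0 - c t0)) / 2"
  have \<sigma>: "\<sigma> > 0" using excess[OF t0(1)] by (simp add: \<sigma>_def)
  have \<sigma>': "Re (a t + b t - c t) \<le> 1 - 2 * \<sigma>" if "t \<in> K" for t
    using t0(2)[OF that] by (simp add: \<sigma>_def field_simps)
  obtain N where N: "real N > max (2 * L) (13 * L\<^sup>2 / \<sigma>)"
    using reals_Archimedean2 by blast
  have large: "real (Suc k) > 2 * L" "real (Suc k) \<ge> 13 * L\<^sup>2 / \<sigma>" if "k \<ge> N" for k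
    using N that by (auto simp: )
  define D where "D = 3 * L + 8 * L\<^sup>2"
  have step: "norm (v (Suc k) t) \<le> (1 - \<sigma> / real (Suc k)) * norm (v k t)"
    and diff: "norm (v k t - v (Suc k) t) \<le> D / real (Suc k) * norm (v k t)" if "t \<in> K" "k \<ge> N" for t k
    unfolding v_def D_def using hyp_coeff_step L[OF that(1)] \<sigma> \<sigma>'[OF that(1)] large[OF that(2)] by blast+
  have "continuous_on K (\<lambda>t. rGamma (c t + of_nat N))"
    by (intro continuous_on_compose2[OF holomorphic_on_imp_continuous_on[OF holomorphic_rGamma[of UNIV]]]
        continuous_intros cont) auto
  then have "continuous_on K (v N)"
    unfolding v_def hyp_coeff_def pochhammer_prod by (intro continuous_intros cont) auto
  then obtain B where B: "B \<ge> 0" "\<And>t. t \<in> K \<Longrightarrow> norm (v N t) \<le> B" using bounded by blast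
  define C where "C = B * real (Suc N) powr \<sigma>"
  have v_le: "norm (v k t) \<le> C * real (Suc k) powr - \<sigma>" if "t \<in> K" "k \<ge> N" for t k
  proof -
    have "norm (v k t) \<le> norm (v N t) * real (Suc N) powr \<sigma> * real (Suc k) powr - \<sigma>"
      using step[OF that(1)] \<sigma> that(2) by (intro power_decay) auto
    also have "\<dots> \<le> C * real (Suc k) powr - \<sigma>"
      unfolding C_def using B(2)[OF that(1)] by (intro mult_right_mono) auto
    finally show ?thesis .
  qed
  obtain s where s: "s \<in> K" using K by blast
  have L0: "L \<ge> 0" using L[OF s] norm_ge_zero order_trans by blast
  then have D0: "D \<ge> 0" by (simp add: D_def)
  have diff_le: "norm ((v k t - v (Suc k) t) * (-1) ^ k) \<le> D * C * real (Suc k) powr (- \<sigma> - 1)"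
    if "t \<in> K" "k \<ge> N" for t k
  proof -
    have "norm ((v k t - v (Suc k) t) * (-1) ^ k) \<le> D / real (Suc k) * norm (v k t)"
      using diff[OF that] by (simp add: norm_mult norm_power)
    also have "\<dots> \<le> D / real (Suc k) * (C * real (Suc k) powr - \<sigma>)"
      using v_le[OF that] D0 by (intro mult_left_mono) auto
    also have "\<dots> = D * C * real (Suc k) powr (- \<sigma> - 1)"
      by (simp add: powr_diff del: of_nat_Suc)
    finally show ?thesis .
  qed
  have "summable (\<lambda>k. real k powr (- \<sigma> - 1))"
    using \<sigma> by (simp add: summable_real_powr_iff)
  then have "summable (\<lambda>k. real (Suc k) powr (- \<sigma> - 1))"
    by (subst summable_Suc_iff)
  then have summable: "summable (\<lambda>k. D * C * real (Suc k) powr (- \<sigma> - 1))"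
    by (rule summable_mult)
  have 1: "uniform_limit K (\<lambda>n t. \<Sum>k<n. (v k t - v (Suc k) t) * (-1) ^ k)
      (\<lambda>t. \<Sum>k. (v k t - v (Suc k) t) * (-1) ^ k) sequentially"
    using summable by (rule Weierstrass_m_test_ev[rotated])
      (use diff_le in \<open>auto simp: eventually_sequentially simp del: of_nat_Suc\<close>)
  have lim0: "(\<lambda>n. C * real (Suc n) powr - \<sigma>) \<longlonglongrightarrow> 0"
  proof -
    have "(\<lambda>n. real (Suc n) powr - \<sigma>) \<longlonglongrightarrow> 0"
      using \<sigma> by (intro tendsto_neg_powr filterlim_compose[OF filterlim_real_sequentially filterlim_Suc]) auto
    then show ?thesis by (auto intro: tendsto_mult_right_zero)
  qed
  have 2: "uniform_limit K (\<lambda>n t. v n t * (-1) ^ n) (\<lambda>t. 0) sequentially"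
  proof (rule uniform_limit_null_comparison)
    show "\<forall>\<^sub>F n in sequentially. \<forall>t\<in>K. norm (v n t * (-1) ^ n) \<le> C * real (Suc n) powr - \<sigma>"
      using v_le by (auto simp: eventually_sequentially norm_mult norm_power intro!: exI[of _ N])
    show "uniform_limit K (\<lambda>n t. C * real (Suc n) powr - \<sigma>) (\<lambda>t. 0) sequentially"
      using lim0 by (auto simp: uniform_limit_iff tendsto_iff elim!: eventually_mono)
  qed
  have "uniform_limit K (\<lambda>n t. (v 0 t - v n t * (-1) ^ n + (\<Sum>k<n. (v k t - v (Suc k) t) * (-1) ^ k)) * (1/2))
     (\<lambda>t. (v 0 t - 0 + (\<Sum>k. (v k t - v (Suc k) t) * (-1) ^ k)) * (1/2)) sequentially"
    by (intro bounded_linear.uniform_limit[OF bounded_linear_mult_left] uniform_limit_add uniform_limit_minus 1 2 uniform_limit_const)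
  moreover have "(v 0 t - v n t * (-1) ^ n + (\<Sum>k<n. (v k t - v (Suc k) t) * (-1) ^ k)) * (1/2)
      = (\<Sum>k<n. v k t * (-1) ^ k)" for n t
    using alternating_sum_differences[of "\<lambda>k. v k t" n] by simp
  ultimately show ?thesis
    by (simp only:) (simp add: v_def)
qed

text \<open>The partial sums are holomorphic because \<open>hyp_coeff\<close> is entire in its
  parameters, and they converge uniformly on small closed discs.\<close>

lemma hyp_series_holomorphic:
  assumes "open S" and hol: "a holomorphic_on S" "b holomorphic_on S" "c holomorphic_on S"
    and excess: "\<And>t. t \<in> S \<Longrightarrow> Re (c t - a t - b t) > -1"
  obtains g where "g holomorphic_on S"
    "\<And>t. t \<in> S \<Longrightarrow> (\<lambda>k. hyp_coeff (a t) (b t) (c t) k * (-1) ^ k) sums g t"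
proof -
  define g where "g = (\<lambda>t. (hyp_coeff (a t) (b t) (c t) 0 + (\<Sum>k. (hyp_coeff (a t) (b t) (c t) k - hyp_coeff (a t) (b t) (c t) (Suc k)) * (-1) ^ k)) / 2)"
  have lim: "\<exists>d>0. cball t d \<subseteq> S \<and> uniform_limit (cball t d)
      (\<lambda>n t. \<Sum>k<n. hyp_coeff (a t) (b t) (c t) k * (-1) ^ k) g sequentially" if t: "t \<in> S" for t
  proof -
    obtain d where d: "d > 0" "cball t d \<subseteq> S"
      using \<open>open S\<close> t by (meson open_contains_cball)
    have "uniform_limit (cball t d) (\<lambda>n t. \<Sum>k<n. hyp_coeff (a t) (b t) (c t) k * (-1) ^ k) g sequentially"
      unfolding g_def
      using d excess by (intro hyp_series_uniform_limit)
        (auto intro!: continuous_on_subset[OF holomorphic_on_imp_continuous_on] hol)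
    with d show ?thesis by blast
  qed
  have "g holomorphic_on S"
  proof (rule holomorphic_uniform_sequence[OF \<open>open S\<close> _ lim])
    show "(\<lambda>t. \<Sum>k<n. hyp_coeff (a t) (b t) (c t) k * (-1) ^ k) holomorphic_on S" for n
      unfolding hyp_coeff_def pochhammer_prod by (intro holomorphic_intros hol) auto
  qed
  moreover have "(\<lambda>k. hyp_coeff (a t) (b t) (c t) k * (-1) ^ k) sums g t" if t: "t \<in> S" for t
  proof -
    obtain d where d: "d > 0" "uniform_limit (cball t d)
      (\<lambda>n t. \<Sum>k<n. hyp_coeff (a t) (b t) (c t) k * (-1) ^ k) g sequentially"
      using lim[OF t] by blast
    then show ?thesis
      unfolding sums_def using tendsto_uniform_limitI[OF d(2), of t] by simp
  qed
  ultimately show ?thesis using that by blast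
qed

section \<open>From a real interval to the half-plane of convergence\<close>

lemma hyp2F1_term_conv_hyp_coeff:
  assumes "p$3 \<notin> \<int>\<^sub>\<le>\<^sub>0"
  shows "hyp_coeff (p$1) (p$2) (p$3) k * (-1) ^ k = rGamma (p$3) * hyp2F1_term p k"
proof -
  have "pochhammer (p$3) k \<noteq> 0"
    using assms pochhammer_eq_0_imp_nonpos_Int by blast
  then show ?thesis
    by (simp add: hyp_coeff_def hyp2F1_term_def pochhammer_rGamma[of "p$3" k])
qed

lemma prod_list_rGamma_holomorphic:
  "\<forall>f\<in>set fs. f holomorphic_on S \<Longrightarrow> (\<lambda>t. \<Prod>f\<leftarrow>fs. rGamma (f t)) holomorphic_on S"
  by (induction fs) (auto intro!: holomorphic_intros)

lemma prod_list_Gamma_rGamma: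
  fixes us :: "complex list"
  shows "\<forall>u\<in>set us. u \<notin> \<int>\<^sub>\<le>\<^sub>0 \<Longrightarrow> (\<Prod>u\<leftarrow>us. Gamma u) * (\<Prod>u\<leftarrow>us. rGamma u) = 1"
proof (induction us)
  case (Cons u us)
  then have "Gamma u * rGamma u = 1" "(\<Prod>u\<leftarrow>us. Gamma u) * (\<Prod>u\<leftarrow>us. rGamma u) = 1"
    by (auto simp: rGamma_inverse_Gamma Gamma_eq_zero_iff)
  moreover have "(\<Prod>u\<leftarrow>u # us. Gamma u) * (\<Prod>u\<leftarrow>u # us. rGamma u) =
      (Gamma u * rGamma u) * ((\<Prod>u\<leftarrow>us. Gamma u) * (\<Prod>u\<leftarrow>us. rGamma u))"
    by (simp add: mult_ac)
  ultimately show ?case by simp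
qed simp

text \<open>\<open>h\<close> is the regularised sum; \<open>F\<close> and \<open>G\<close> are the
  products of reciprocal gammas of the upper and lower arguments. The identity h F =
  \<open>rGamma\<close> (lower parameter) G makes sense on the whole half-plane, including the poles
  of the quotient, so the identity theorem applies; where the hypotheses of the evaluation hold, the
  factors can be divided out again.\<close>

lemma gamma_evaluation_continuation:
  fixes p :: "complex \<Rightarrow> complex^3" and fs gs :: "(complex \<Rightarrow> complex) list" and l r :: real
  assumes p: "\<And>i. (\<lambda>t. p t $ i) holomorphic_on UNIV"
    and fs: "\<forall>f\<in>set fs. f holomorphic_on UNIV" and gs: "\<forall>f\<in>set gs. f holomorphic_on UNIV"
    and conn: "connected {t. Re (excess (p t)) > -1}"
    and "l < r"
    and base: "\<And>x. l < x \<Longrightarrow> x < r \<Longrightarrow> Re (excess (p (of_real x))) > -1 \<and> p (of_real x) $ 3 \<notin> \<int>\<^sub>\<le>\<^sub>0 \<and>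
        (\<forall>f\<in>set fs. f (of_real x) \<notin> \<int>\<^sub>\<le>\<^sub>0) \<and>
        hyp2F1_term (p (of_real x)) sums
          gamma_quotient (map (\<lambda>f. f (of_real x)) fs) (map (\<lambda>f. f (of_real x)) gs)"
  shows "gamma_evaluation (p t) (map (\<lambda>f. f t) fs) (map (\<lambda>f. f t) gs)"
proof -
  define S where "S = {t. Re (excess (p t)) > -1}"
  have "continuous_on UNIV (\<lambda>t. Re (excess (p t)))"
    unfolding excess_def by (intro continuous_intros holomorphic_on_imp_continuous_on p)
  then have "open S"
    unfolding S_def using open_Collect_less[OF continuous_on_const] by blast
  have p': "(\<lambda>t. p t $ i) holomorphic_on S" for i
    using p holomorphic_on_subset by blast
  obtain h where h: "h holomorphic_on S"
    "\<And>t. t \<in> S \<Longrightarrow> (\<lambda>k. hyp_coeff (p t $ 1) (p t $ 2) (p t $ 3) k * (-1) ^ k) sums h t"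
    using hyp_series_holomorphic[OF \<open>open S\<close> p' p' p', of 3 1 2] by (auto simp: S_def excess_def)
  define F G where "F = (\<lambda>t. \<Prod>f\<leftarrow>fs. rGamma (f t))" and "G = (\<lambda>t. \<Prod>f\<leftarrow>gs. rGamma (f t))"
  have FG: "F holomorphic_on S" "G holomorphic_on S"
    unfolding F_def G_def using fs gs by (auto intro!: prod_list_rGamma_holomorphic intro: holomorphic_on_subset)
  have inverse: "(\<Prod>u\<leftarrow>map (\<lambda>f. f t) fs. Gamma u) * F t = 1"
    if "\<forall>f\<in>set fs. f t \<notin> \<int>\<^sub>\<le>\<^sub>0" for t
    using prod_list_Gamma_rGamma[of "map (\<lambda>f. f t) fs"] that by (simp add: F_def comp_def)
  have G_list: "(\<Prod>u\<leftarrow>map (\<lambda>f. f t) gs. rGamma u) = G t" for t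
    by (simp add: G_def comp_def)
  define m where "m = (l + r) / 2"
  have eq: "h t * F t - rGamma (p t $ 3) * G t = 0" if "t \<in> S" for t
  proof (rule analytic_continuation[of "\<lambda>t. h t * F t - rGamma (p t $ 3) * G t" S "of_real ` {l<..<r}" "of_real m"])
    show "(\<lambda>t. h t * F t - rGamma (p t $ 3) * G t) holomorphic_on S"
      by (intro holomorphic_intros h FG p')
    show "connected S" using conn by (simp add: S_def)
    show sub: "of_real ` {l<..<r} \<subseteq> S" using base by (auto simp: S_def)
    show "of_real m \<in> S" using sub \<open>l < r\<close> by (intro subsetD[OF sub] imageI) (simp add: m_def)
    show "of_real m islimpt (of_real ` {l<..<r} :: complex set)"
      unfolding islimpt_approachable
    proof (intro allI impI)
      fix e :: real assume "e > 0"
      define d where "d = min (e / 2) ((r - l) / 4)"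
      have d: "d > 0" "d < e" "m + d < r" "l < m + d"
        using \<open>e > 0\<close> \<open>l < r\<close> by (auto simp: d_def m_def min_def field_simps)
      then have "dist (of_real (m + d) :: complex) (of_real m) < e" "of_real (m + d) \<noteq> (of_real m :: complex)"
        by (simp_all add: dist_norm flip: of_real_diff of_real_add)
      then show "\<exists>x'\<in>of_real ` {l<..<r}. x' \<noteq> (of_real m :: complex) \<and> dist x' (of_real m) < e"
        using d by (intro bexI[of _ "of_real (m + d)"] imageI conjI) (simp_all del: of_real_add)
    qed
    show "h z * F z - rGamma (p z $ 3) * G z = 0" if "z \<in> of_real ` {l<..<r}" for z
    proof -
      have z: "z \<in> S" "p z $ 3 \<notin> \<int>\<^sub>\<le>\<^sub>0" "\<forall>f\<in>set fs. f z \<notin> \<int>\<^sub>\<le>\<^sub>0"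
        "hyp2F1_term (p z) sums gamma_quotient (map (\<lambda>f. f z) fs) (map (\<lambda>f. f z) gs)"
        using that base by (auto simp: S_def)
      have "h z = rGamma (p z $ 3) * gamma_quotient (map (\<lambda>f. f z) fs) (map (\<lambda>f. f z) gs)"
        using h(2)[OF z(1)] sums_mult[OF z(4), of "rGamma (p z $ 3)"]
        unfolding hyp2F1_term_conv_hyp_coeff[OF z(2)] by (rule sums_unique2)
      also have "\<dots> * F z = rGamma (p z $ 3) * G z * ((\<Prod>u\<leftarrow>map (\<lambda>f. f z) fs. Gamma u) * F z)"
        unfolding gamma_quotient_def G_list by (simp only: mult_ac)
      finally show ?thesis by (simp only: inverse[OF z(3)] mult_1_right diff_self)
    qed
  qed (use that \<open>open S\<close> in auto)
  show ?thesis
    unfolding gamma_evaluation_def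
  proof (intro impI, elim conjE)
    assume t: "Re (excess (p t)) > -1" "p t $ 3 \<notin> \<int>\<^sub>\<le>\<^sub>0" "\<forall>u\<in>set (map (\<lambda>f. f t) fs). u \<notin> \<int>\<^sub>\<le>\<^sub>0"
    have tS: "t \<in> S" using t by (simp add: S_def)
    have nz: "rGamma (p t $ 3) \<noteq> 0" using t(2) by (simp add: rGamma_eq_zero_iff)
    have inv: "(\<Prod>u\<leftarrow>map (\<lambda>f. f t) fs. Gamma u) * F t = 1" using t(3) by (intro inverse) auto
    have "(\<lambda>k. rGamma (p t $ 3) * hyp2F1_term (p t) k) sums h t"
      using h(2)[OF tS] unfolding hyp2F1_term_conv_hyp_coeff[OF t(2)] .
    then have "(\<lambda>k. inverse (rGamma (p t $ 3)) * (rGamma (p t $ 3) * hyp2F1_term (p t) k))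
        sums (inverse (rGamma (p t $ 3)) * h t)"
      by (rule sums_mult)
    then have "hyp2F1_term (p t) sums (inverse (rGamma (p t $ 3)) * h t)"
      using nz by (simp flip: mult.assoc)
    also have "inverse (rGamma (p t $ 3)) * h t = gamma_quotient (map (\<lambda>f. f t) fs) (map (\<lambda>f. f t) gs)"
    proof -
      have "h t = (\<Prod>u\<leftarrow>map (\<lambda>f. f t) fs. Gamma u) * (h t * F t)"
        using inv by (simp add: mult_ac)
      also have "h t * F t = rGamma (p t $ 3) * G t" using eq[OF tS] by simp
      finally show ?thesis unfolding gamma_quotient_def G_list using nz by simp
    qed
    finally show "hyp2F1_term (p t) sums gamma_quotient (map (\<lambda>f. f t) fs) (map (\<lambda>f. f t) gs)" .
  qed
qed

subsection \<open>Euler integrals at -1\<close>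

definition real_hyp_term :: "real \<Rightarrow> real \<Rightarrow> real \<Rightarrow> nat \<Rightarrow> real" where
  "real_hyp_term a b c k = pochhammer a k * pochhammer b k / (pochhammer c k * fact k) * (-1) ^ k"

lemma real_hyp_term_commute: "real_hyp_term a b c = real_hyp_term b a c"
  by (simp add: real_hyp_term_def fun_eq_iff mult.commute)

text \<open>The binomial coefficient is of order n^(-z-1), which is summable exactly because z >
  0.\<close>

lemma summable_gbinomial_real:
  fixes z :: real
  assumes "z > 0"
  shows "summable (\<lambda>n. \<bar>z gchoose n\<bar>)"
proof -
  have "convergent (\<lambda>n. (z gchoose n) / ((-1)^n / exp ((z+1) * of_real (ln (real n)))))"
    using gbinomial_asymptotic[of z] convergent_def by blast
  then have "Bseq (\<lambda>n. (z gchoose n) / ((-1)^n / exp ((z+1) * of_real (ln (real n)))))"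
    by (rule convergent_imp_Bseq)
  then obtain B where B: "\<And>n. norm ((z gchoose n) / ((-1)^n / exp ((z+1) * of_real (ln (real n))))) \<le> B"
    by (auto simp: Bseq_def)
  have le: "\<bar>z gchoose n\<bar> \<le> B * real n powr - (z + 1)" if "n \<ge> 1" for n
  proof -
    have "\<bar>z gchoose n\<bar> * exp ((z+1) * ln (real n)) \<le> B"
      using B[of n] by (simp add: abs_mult abs_divide power_abs)
    then have "(\<bar>z gchoose n\<bar> * exp ((z+1) * ln (real n))) * exp (- ((z+1) * ln (real n))) \<le> B * exp (- ((z+1) * ln (real n)))"
      by (rule mult_right_mono) simp
    moreover have "exp (- ((z+1) * ln (real n))) = real n powr - (z + 1)"
      using that by (simp add: powr_def algebra_simps)
    ultimately show ?thesis
      by (simp add: exp_minus mult.assoc)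
  qed
  have "summable (\<lambda>n. B * real n powr - (z + 1))"
    using assms by (intro summable_mult) (simp add: summable_real_powr_iff)
  then show ?thesis
    by (rule summable_comparison_test'[where N = 1]) (use le in simp)
qed

text \<open>The factor x^k shifts the first Beta parameter by k; the quotient of the two Beta values
  is the part (b)_k / (c)_k of the hypergeometric term, with c = b + d.\<close>

lemma Beta_moment:
  fixes b d :: real
  assumes "b > 0" "d > 0"
  shows "set_integrable lborel {0<..<1} (\<lambda>x. x ^ k * (x powr (b - 1) * (1 - x) powr (d - 1)))"
    and "(LINT x:{0<..<1}|lborel. x ^ k * (x powr (b - 1) * (1 - x) powr (d - 1))) =
      Beta b d * pochhammer b k / pochhammer (b + d) k"
proof -
  have eq: "indicator {0<..<1} x *\<^sub>R (x powr (b + real k - 1) * (1 - x) powr (d - 1)) =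
      indicator {0<..<1} x *\<^sub>R (x ^ k * (x powr (b - 1) * (1 - x) powr (d - 1)))" for x :: real
  proof -
    have "x powr (b + real k - 1) = x ^ k * x powr (b - 1)" if "x > 0"
    proof -
      have "x powr (b + real k - 1) = x powr (real k + (b - 1))" by (simp add: algebra_simps)
      then show ?thesis using that by (simp only: powr_add powr_realpow)
    qed
    then show ?thesis by (auto simp: indicator_def)
  qed
  have int0: "set_integrable lborel {0<..<1} (\<lambda>x. x powr (b + real k - 1) * (1 - x) powr (d - 1))"
    using integrable_Beta[of "b + real k" d] assms by (auto intro: set_integrable_subset)
  then show "set_integrable lborel {0<..<1} (\<lambda>x. x ^ k * (x powr (b - 1) * (1 - x) powr (d - 1)))"
    unfolding set_integrable_def eq .
  have "(LINT x:{0<..<1}|lborel. x ^ k * (x powr (b - 1) * (1 - x) powr (d - 1))) =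
      (LINT x:{0<..<1}|lborel. x powr (b + real k - 1) * (1 - x) powr (d - 1))"
    unfolding set_lebesgue_integral_def eq ..
  also have "\<dots> = integral {0<..<1} (\<lambda>x. x powr (b + real k - 1) * (1 - x) powr (d - 1))"
    using int0 by (rule set_borel_integral_eq_integral(2))
  also have "\<dots> = Beta (b + real k) d"
    using has_integral_Beta_real[of "b + real k" d] assms
    by (intro integral_unique) (simp add: has_integral_Icc_iff_Ioo)
  also have "\<dots> = Beta b d * pochhammer b k / pochhammer (b + d) k"
  proof -
    have "b \<notin> \<int>\<^sub>\<le>\<^sub>0" "b + d \<notin> \<int>\<^sub>\<le>\<^sub>0" using assms by (auto elim!: nonpos_Ints_cases)
    moreover have "Gamma b > 0" "Gamma (b + d) > 0" "Gamma (b + d + real k) > 0" using assms by auto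
    ultimately show ?thesis by (simp add: Beta_def pochhammer_Gamma add_ac field_simps)
  qed
  finally show "(LINT x:{0<..<1}|lborel. x ^ k * (x powr (b - 1) * (1 - x) powr (d - 1))) =
      Beta b d * pochhammer b k / pochhammer (b + d) k" .
qed

text \<open>The power (1 + x)^(-a) is expanded binomially and integrated termwise. Since a < 0, the
  binomial coefficients are absolutely summable, and b < c bounds every moment by
  \<open>Beta b (c - b)\<close>, so they dominate the series of integrals.\<close>

lemma euler_integral:
  fixes a b c :: real
  assumes "0 < b" "b < c" "a < 0"
  defines "f \<equiv> \<lambda>x. x powr (b - 1) * (1 - x) powr (c - b - 1) * (1 + x) powr - a"
  shows "f absolutely_integrable_on {0<..<1}"
    and "real_hyp_term a b c sums
      (integral {0<..<1} f / Beta b (c - b))"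
proof -
  define w where "w = (\<lambda>x::real. x powr (b - 1) * (1 - x) powr (c - b - 1))"
  define F where "F = (\<lambda>k x. indicator {0<..<1} x *\<^sub>R (((-a) gchoose k) * (x ^ k * w x)))"
  have m: "integrable lborel (\<lambda>x. indicator {0<..<1} x *\<^sub>R (x ^ k * w x))"
    "(\<integral>x. indicator {0<..<1} x *\<^sub>R (x ^ k * w x) \<partial>lborel) = Beta b (c - b) * (pochhammer b k / pochhammer c k)" for k
    using Beta_moment[of b "c - b" k] assms
    by (simp_all only: w_def set_integrable_def set_lebesgue_integral_def) simp_all
  have w0: "w x \<ge> 0" for x by (simp add: w_def)
  have F: "F k = (\<lambda>x. ((-a) gchoose k) * (indicator {0<..<1} x *\<^sub>R (x ^ k * w x)))" for k
    by (simp add: F_def mult.left_commute)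
  have F_int: "integrable lborel (F k)" for k
    unfolding F by (intro integrable_mult_right m)
  have coeff: "integral\<^sup>L lborel (F k) = ((-a) gchoose k) * (Beta b (c - b) * (pochhammer b k / pochhammer c k))" for k
    unfolding F by (subst integral_mult_right_zero) (simp only: m)
  have norm_F: "norm (F k x) = \<bar>(-a) gchoose k\<bar> * (indicator {0<..<1} x *\<^sub>R (x ^ k * w x))" for k x
    by (auto simp: F abs_mult w0 indicator_def)
  have norm_coeff: "integral\<^sup>L lborel (\<lambda>x. norm (F k x)) = \<bar>(-a) gchoose k\<bar> * (Beta b (c - b) * (pochhammer b k / pochhammer c k))" for k
    unfolding norm_F by (subst integral_mult_right_zero) (simp only: m)
  have summ: "summable (\<lambda>k. \<bar>(-a) gchoose k\<bar>)"
    using summable_gbinomial_real[of "-a"] assms by simp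
  have B0: "Beta b (c - b) > 0"
    using assms by (simp add: Beta_def)
  have "summable (\<lambda>k. norm (F k x))" for x
  proof (cases "x \<in> {0<..<1}")
    case True
    then have "norm (F k x) \<le> \<bar>(-a) gchoose k\<bar> * w x" for k
      using w0[of x] by (auto simp: F_def abs_mult power_le_one mult_le_cancel_left1 intro!: mult_left_mono mult_left_le_one_le)
    then show ?thesis
      by (intro summable_comparison_test[OF _ summable_mult2[OF summ]]) auto
  qed (simp add: F_def)
  then have AE: "AE x in lborel. summable (\<lambda>k. norm (F k x))" by simp
  have ratio: "pochhammer b k / pochhammer c k \<le> 1" "pochhammer b k / pochhammer c k \<ge> 0" for k
  proof -
    have "pochhammer b k \<le> pochhammer c k"
      unfolding pochhammer_prod using assms by (intro prod_mono) auto
    moreover have "pochhammer b k > 0" "pochhammer c k > 0"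
      using assms by (auto intro!: pochhammer_pos)
    ultimately show "pochhammer b k / pochhammer c k \<le> 1" "pochhammer b k / pochhammer c k \<ge> 0"
      by simp_all
  qed
  have sum_norm: "summable (\<lambda>k. integral\<^sup>L lborel (\<lambda>x. norm (F k x)))"
  proof (rule summable_comparison_test[OF _ summable_mult2[OF summ, of "Beta b (c - b)"]], intro exI allI impI)
    fix k
    have "\<bar>(-a) gchoose k\<bar> * (Beta b (c - b) * (pochhammer b k / pochhammer c k)) \<le> \<bar>(-a) gchoose k\<bar> * (Beta b (c - b) * 1)"
      using ratio B0 by (intro mult_left_mono) auto
    then show "norm (integral\<^sup>L lborel (\<lambda>x. norm (F k x))) \<le> \<bar>(-a) gchoose k\<bar> * Beta b (c - b)"
      unfolding norm_coeff unfolding real_norm_def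
      by (subst abs_of_nonneg) (auto intro!: mult_nonneg_nonneg ratio less_imp_le[OF B0] simp del: times_divide_eq_right)
  qed
  have suminf: "(\<Sum>k. F k x) = indicator {0<..<1} x *\<^sub>R f x" for x
  proof (cases "x \<in> {0<..<1}")
    case True
    then have "(\<lambda>k. ((-a) gchoose k) * x ^ k * w x) sums ((1 + x) powr - a * w x)"
      by (intro sums_mult2 gen_binomial_real) auto
    then show ?thesis
      using True by (simp add: F_def f_def w_def sums_iff mult_ac)
  qed (simp add: F_def)
  have int: "set_integrable lborel {0<..<1} f"
    using integrable_suminf[OF F_int AE sum_norm] by (simp add: suminf set_integrable_def)
  then show "f absolutely_integrable_on {0<..<1}"
    unfolding set_integrable_def by (rule integrable_completion[THEN iffD2, rotated]) (use int in \<open>auto simp: set_integrable_def\<close>)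
  have "(\<lambda>k. ((-a) gchoose k) * (Beta b (c - b) * (pochhammer b k / pochhammer c k))) sums (LINT x:{0<..<1}|lborel. f x)"
    using sums_integral[OF F_int AE sum_norm] by (simp add: suminf coeff set_lebesgue_integral_def)
  also have "(LINT x:{0<..<1}|lborel. f x) = integral {0<..<1} f"
    using int by (rule set_borel_integral_eq_integral)
  finally have "(\<lambda>k. (((-a) gchoose k) * (Beta b (c - b) * (pochhammer b k / pochhammer c k))) / Beta b (c - b))
      sums (integral {0<..<1} f / Beta b (c - b))"
    by (rule sums_divide)
  also have "(\<lambda>k. (((-a) gchoose k) * (Beta b (c - b) * (pochhammer b k / pochhammer c k))) / Beta b (c - b)) =
     real_hyp_term a b c"
    using B0 by (simp add: gbinomial_pochhammer fun_eq_iff real_hyp_term_def mult_ac)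
  finally show "real_hyp_term a b c sums
      (integral {0<..<1} f / Beta b (c - b))" .
qed

lemma Beta_integral_Ioo:
  fixes a b :: real
  assumes "a > 0" "b > 0"
  shows "(\<lambda>x. x powr (a - 1) * (1 - x) powr (b - 1)) absolutely_integrable_on {0<..<1}"
    and "integral {0<..<1} (\<lambda>x. x powr (a - 1) * (1 - x) powr (b - 1)) = Beta a b"
proof -
  have "((\<lambda>x. x powr (a - 1) * (1 - x) powr (b - 1)) has_integral Beta a b) {0<..<1}"
    using has_integral_Beta_real[OF assms] by (simp add: has_integral_Icc_iff_Ioo)
  then show "(\<lambda>x. x powr (a - 1) * (1 - x) powr (b - 1)) absolutely_integrable_on {0<..<1}"
    and "integral {0<..<1} (\<lambda>x. x powr (a - 1) * (1 - x) powr (b - 1)) = Beta a b"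
    by (auto simp: absolutely_integrable_on_iff_nonneg integral_unique has_integral_integrable)
qed

section \<open>Kummer's theorem\<close>

lemma square_powr: "(x\<^sup>2) powr r = x powr (2 * r)" if "x > 0" for x :: real
  using that by (simp add: powr_def ln_realpow)

text \<open>The factors 1 - x and 1 + x carry the same exponent and merge into a power of 1 - x^2;
  the substitution z = x^2 then yields a Beta integral.\<close>

lemma kummer_integral:
  fixes a b :: real
  assumes "a > 0" "b < 1"
  shows "integral {0<..<1} (\<lambda>x. x powr (a - 1) * (1 - x) powr - b * (1 + x) powr - b) = Beta (a / 2) (1 - b) / 2"
proof -
  define S where "S = {0<..<1::real}"
  have image: "(\<lambda>x. x\<^sup>2) ` S = S"
  proof safe
    fix x assume x: "x \<in> S"
    then show "x\<^sup>2 \<in> S" by (auto simp: S_def power_less_one_iff)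
    show "x \<in> (\<lambda>x. x\<^sup>2) ` S"
      using x by (intro image_eqI[of _ _ "sqrt x"]) (auto simp: S_def)
  qed
  have "(\<lambda>x. \<bar>2 * x\<bar> * ((x\<^sup>2) powr (a / 2 - 1) * (1 - x\<^sup>2) powr (1 - b - 1))) absolutely_integrable_on S \<and>
      integral S (\<lambda>x. \<bar>2 * x\<bar> * ((x\<^sup>2) powr (a / 2 - 1) * (1 - x\<^sup>2) powr (1 - b - 1))) = Beta (a / 2) (1 - b)"
  proof (rule has_absolute_integral_change_of_variables_1'[where g = "\<lambda>x. x\<^sup>2" and g' = "\<lambda>x. 2 * x"
        and f = "\<lambda>z. z powr (a / 2 - 1) * (1 - z) powr (1 - b - 1)", THEN iffD2])
    show "((\<lambda>x. x\<^sup>2) has_field_derivative 2 * x) (at x within S)" for x :: real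
      by (auto intro!: derivative_eq_intros)
    show "inj_on (\<lambda>x. x\<^sup>2) S" by (auto simp: inj_on_def S_def)
    show "(\<lambda>z. z powr (a / 2 - 1) * (1 - z) powr (1 - b - 1)) absolutely_integrable_on (\<lambda>x. x\<^sup>2) ` S \<and>
      integral ((\<lambda>x. x\<^sup>2) ` S) (\<lambda>z. z powr (a / 2 - 1) * (1 - z) powr (1 - b - 1)) = Beta (a / 2) (1 - b)"
      unfolding image using Beta_integral_Ioo[of "a / 2" "1 - b"] assms by (simp add: S_def)
  qed (simp add: S_def)
  then have "Beta (a / 2) (1 - b) = integral S (\<lambda>x. \<bar>2 * x\<bar> * ((x\<^sup>2) powr (a / 2 - 1) * (1 - x\<^sup>2) powr (1 - b - 1)))"
    by simp
  also have "\<dots> = integral S (\<lambda>x. 2 * (x powr (a - 1) * (1 - x) powr - b * (1 + x) powr - b))"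
  proof (rule Henstock_Kurzweil_Integration.integral_cong)
    fix x assume "x \<in> S"
    then have x: "0 < x" "x < 1" by (auto simp: S_def)
    have "1 - x\<^sup>2 = (1 - x) * (1 + x)" by (simp add: power2_eq_square algebra_simps)
    moreover have "x * (x\<^sup>2) powr (a / 2 - 1) = x powr (a - 1)"
      using x powr_mult_base[of x "a - 2"] by (simp add: square_powr)
    ultimately show "\<bar>2 * x\<bar> * ((x\<^sup>2) powr (a / 2 - 1) * (1 - x\<^sup>2) powr (1 - b - 1)) =
        2 * (x powr (a - 1) * (1 - x) powr - b * (1 + x) powr - b)"
      using x by (simp add: powr_mult)
  qed
  finally show ?thesis by (simp add: S_def)
qed

text \<open>The upper parameters are exchanged so that the negative one is expanded binomially. The
  relation c = 1 + a - b is what equalises the two exponents in Euler's integral.\<close>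

lemma kummer_sums:
  fixes a b :: real
  assumes "a > 0" "b < 0"
  shows "real_hyp_term a b (1 + a - b) sums (Beta (a / 2) (1 - b) / (2 * Beta a (1 - b)))"
proof -
  have "real_hyp_term b a (1 + a - b) sums
     (integral {0<..<1} (\<lambda>x. x powr (a - 1) * (1 - x) powr (1 + a - b - a - 1) * (1 + x) powr - b) / Beta a (1 + a - b - a))"
    using assms by (intro euler_integral) auto
  also have "(\<lambda>x::real. x powr (a - 1) * (1 - x) powr (1 + a - b - a - 1) * (1 + x) powr - b) =
      (\<lambda>x. x powr (a - 1) * (1 - x) powr - b * (1 + x) powr - b)"
    by simp
  also note kummer_integral[of a b]
  finally show ?thesis using assms by (simp add: real_hyp_term_commute)
qed

subsection \<open>Trigonometric integrals\<close>

lemma image_sin_sq: "(\<lambda>u. (sin (2 * u))\<^sup>2) ` {0<..<pi/4} = {0<..<1::real}"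
proof safe
  fix u :: real assume "u \<in> {0<..<pi/4}"
  then have "0 < sin (2 * u)" "0 < cos (2 * u)"
    by (auto intro!: sin_gt_zero cos_gt_zero)
  then have "0 < (sin (2 * u))\<^sup>2" "0 < (cos (2 * u))\<^sup>2" by simp_all
  moreover from this have "(sin (2 * u))\<^sup>2 < 1"
    using sin_cos_squared_add[of "2 * u"] by linarith
  ultimately show "(sin (2 * u))\<^sup>2 \<in> {0<..<1}" by simp
next
  fix z :: real assume z: "z \<in> {0<..<1}"
  then have s: "0 < sqrt z" "sqrt z < 1" by auto
  then have "arcsin 0 < arcsin (sqrt z)" by (subst arcsin_less_mono) auto
  moreover have "arcsin (sqrt z) < pi / 2" using arcsin_lt_bounded[of "sqrt z"] s by auto
  ultimately have "arcsin (sqrt z) / 2 \<in> {0<..<pi/4}" by simp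
  moreover have "z = (sin (2 * (arcsin (sqrt z) / 2)))\<^sup>2"
  proof -
    have "sin (arcsin (sqrt z)) = sqrt z" using s by (intro sin_arcsin) linarith+
    then show ?thesis using z by simp
  qed
  ultimately show "z \<in> (\<lambda>u. (sin (2 * u))\<^sup>2) ` {0<..<pi/4}" by blast
qed

lemma inj_on_sin_sq: "inj_on (\<lambda>u. (sin (2 * u))\<^sup>2) {0<..<pi/4}"
proof (rule inj_onI)
  fix u v :: real assume uv: "u \<in> {0<..<pi/4}" "v \<in> {0<..<pi/4}" "(sin (2 * u))\<^sup>2 = (sin (2 * v))\<^sup>2"
  then have "0 < sin (2 * u)" "0 < sin (2 * v)"
    by (auto intro!: sin_gt_zero)
  then have "sin (2 * u) = sin (2 * v)"
    using uv(3) by (simp add: power2_eq_iff)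
  then have "2 * u = 2 * v"
    by (rule sin_inj_pi[rotated 4]) (use uv in auto)
  then show "u = v" by simp
qed

lemma image_tan_sq: "(\<lambda>u. (tan u)\<^sup>2) ` {0<..<pi/4} = {0<..<1::real}"
proof safe
  fix u :: real assume u: "u \<in> {0<..<pi/4}"
  then have "0 < tan u" by (auto intro!: tan_gt_zero)
  moreover have "tan u < tan (pi / 4)" using u by (intro tan_monotone) auto
  ultimately show "(tan u)\<^sup>2 \<in> {0<..<1}"
    by (simp add: tan_45 power_less_one_iff)
next
  fix z :: real assume z: "z \<in> {0<..<1}"
  then have s: "0 < sqrt z" "sqrt z < 1" by auto
  have "arctan (sqrt z) < arctan 1" using s by (simp only: arctan_less_iff)
  then have "arctan (sqrt z) \<in> {0<..<pi/4}"
    using s by (simp add: arctan_one zero_less_arctan_iff)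
  moreover have "z = (tan (arctan (sqrt z)))\<^sup>2" using z by (simp add: tan_arctan)
  ultimately show "z \<in> (\<lambda>u. (tan u)\<^sup>2) ` {0<..<pi/4}" by blast
qed

lemma inj_on_tan_sq: "inj_on (\<lambda>u. (tan u)\<^sup>2) {0<..<pi/4}"
proof (rule inj_onI)
  fix u v :: real assume uv: "u \<in> {0<..<pi/4}" "v \<in> {0<..<pi/4}" "(tan u)\<^sup>2 = (tan v)\<^sup>2"
  then have "0 < tan u" "0 < tan v"
    by (auto intro!: tan_gt_zero)
  then have "tan u = tan v"
    using uv(3) by (simp add: power2_eq_iff)
  moreover have "arctan (tan u) = u" "arctan (tan v) = v"
    using uv by (auto intro!: arctan_tan)
  ultimately show "u = v" by metis
qed

text \<open>The weight vanishes at exactly the two endpoints of [0, pi/4] when p > 1. The exponent p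
  - 1 follows the Beta convention, making p > 0 the condition of integrability.\<close>

definition sin4_integral :: "(real \<Rightarrow> real) \<Rightarrow> real \<Rightarrow> real" where
  "sin4_integral g p = integral {0<..<pi/4} (\<lambda>u. sin (4 * u) powr (p - 1) * g u)"

lemma sin4_pos: "u \<in> {0<..<pi/4} \<Longrightarrow> sin (4 * u) > 0"
  by (auto intro!: sin_gt_zero)

text \<open>For z = sin(2u)^2 one has z (1 - z) = (sin(4u) / 2)^2 and dz = 2 sin(4u) du, so the Beta
  integral with both parameters p/2 becomes 2^(3-p) times the integral sought.\<close>

lemma sin4_integral_one:
  assumes "p > 0"
  shows "(\<lambda>u. sin (4 * u) powr (p - 1)) absolutely_integrable_on {0<..<pi/4}"
    and "sin4_integral (\<lambda>u. 1) p = 2 powr (p - 3) * Beta (p / 2) (p / 2)"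
proof -
  define S where "S = {0<..<pi/4}"
  let ?f = "\<lambda>z::real. z powr (p / 2 - 1) * (1 - z) powr (p / 2 - 1)"
  let ?h = "\<lambda>u. \<bar>2 * sin (4 * u)\<bar> * ?f ((sin (2 * u))\<^sup>2)"
  have h: "?h absolutely_integrable_on S \<and> integral S ?h = Beta (p / 2) (p / 2)"
  proof (rule has_absolute_integral_change_of_variables_1'[where g = "\<lambda>u. (sin (2 * u))\<^sup>2"
        and g' = "\<lambda>u. 2 * sin (4 * u)" and f = ?f, THEN iffD2])
    show "((\<lambda>u. (sin (2 * u))\<^sup>2) has_field_derivative 2 * sin (4 * u)) (at u within S)" for u :: real
      using sin_double[of "2 * u"] by (auto intro!: derivative_eq_intros)
    show "inj_on (\<lambda>u. (sin (2 * u))\<^sup>2) S" unfolding S_def by (rule inj_on_sin_sq)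
    show "?f absolutely_integrable_on (\<lambda>u. (sin (2 * u))\<^sup>2) ` S \<and> integral ((\<lambda>u. (sin (2 * u))\<^sup>2) ` S) ?f = Beta (p / 2) (p / 2)"
      unfolding S_def image_sin_sq using Beta_integral_Ioo[of "p / 2" "p / 2"] assms by simp
  qed (simp add: S_def)
  have eq: "?h u = 2 powr (3 - p) * (sin (4 * u) powr (p - 1) * 1)" if "u \<in> S" for u
  proof -
    define s c where "s = sin (2 * u)" and "c = cos (2 * u)"
    have pos: "0 < s" "0 < c"
      using that by (auto simp: S_def s_def c_def intro!: sin_gt_zero cos_gt_zero)
    have s4: "sin (4 * u) = 2 * s * c" using sin_double[of "2 * u"] by (simp add: s_def c_def)
    have c2: "1 - s\<^sup>2 = c\<^sup>2" by (simp add: s_def c_def cos_squared_eq)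
    have sq: "(y\<^sup>2) powr (p / 2 - 1) = y powr (p - 2)" if "y > 0" for y :: real
      using that by (simp add: square_powr right_diff_distrib)
    have e: "y powr (p - 1) = y * y powr (p - 2)" if "y > 0" for y :: real
      using that powr_add[of y 1 "p - 2"] by simp
    have two: "2 powr (3 - p) * 2 powr (p - 1) = (4::real)"
      by (simp add: powr_add[symmetric])
    have "?h u = 4 * ((s * s powr (p - 2)) * (c * c powr (p - 2)))"
      using pos by (simp add: s_def[symmetric] s4 c2 sq)
    also have "\<dots> = 4 * (s powr (p - 1) * c powr (p - 1))"
      using pos by (simp only: e)
    also have "\<dots> = 2 powr (3 - p) * 2 powr (p - 1) * (s powr (p - 1) * c powr (p - 1))"
      by (simp only: two)
    also have "\<dots> = 2 powr (3 - p) * (sin (4 * u) powr (p - 1) * 1)"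
      using pos by (simp add: s4 powr_mult)
    finally show ?thesis .
  qed
  have eq': "2 powr (p - 3) * ?h u = sin (4 * u) powr (p - 1)" if "u \<in> S" for u
    unfolding eq[OF that] by (simp add: powr_diff field_simps)
  have "(\<lambda>u. 2 powr (p - 3) * ?h u) absolutely_integrable_on S"
    using h by (intro set_integrable_mult_right) auto
  moreover have "(\<lambda>u. 2 powr (p - 3) * ?h u) absolutely_integrable_on S \<longleftrightarrow>
      (\<lambda>u. sin (4 * u) powr (p - 1)) absolutely_integrable_on S"
    by (intro set_integrable_cong) (simp_all only: eq')
  ultimately show "(\<lambda>u. sin (4 * u) powr (p - 1)) absolutely_integrable_on {0<..<pi/4}"
    unfolding S_def[symmetric] by blast
  have "sin4_integral (\<lambda>u. 1) p = integral S (\<lambda>u. 2 powr (p - 3) * ?h u)"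
    unfolding sin4_integral_def S_def[symmetric]
    by (rule Henstock_Kurzweil_Integration.integral_cong) (simp add: eq')
  also have "\<dots> = 2 powr (p - 3) * Beta (p / 2) (p / 2)"
    using h by simp
  finally show "sin4_integral (\<lambda>u. 1) p = 2 powr (p - 3) * Beta (p / 2) (p / 2)" .
qed

lemma sin4_integrable:
  assumes "p > 0" "continuous_on UNIV g"
  shows "(\<lambda>u. sin (4 * u) powr (p - 1) * g u) absolutely_integrable_on {0<..<pi/4}"
proof -
  have "bounded (g ` {0..pi/4})"
    using assms(2) by (intro compact_imp_bounded compact_continuous_image) (auto intro: continuous_on_subset)
  then have "bounded (g ` {0<..<pi/4})"
    by (rule bounded_subset) auto
  moreover have "g \<in> borel_measurable (lebesgue_on {0<..<pi/4})"
    using assms(2) by (intro continuous_imp_measurable_on_sets_lebesgue) (auto intro: continuous_on_subset)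
  ultimately have "(\<lambda>u. g u * sin (4 * u) powr (p - 1)) absolutely_integrable_on {0<..<pi/4}"
    using sin4_integral_one(1)[OF assms(1)] by (intro absolutely_integrable_bounded_measurable_product_real) auto
  then show ?thesis by (simp add: mult.commute)
qed

text \<open>Write s = sin(4u). The second derivative of s^(p+1) is a combination of s^(p-1) and
  s^(p+1), and g'' = -\<open>\<kappa>\<close> g. Hence integrating the derivative of the
  Wronskian-type expression (s^(p+1))' g - s^(p+1) g' relates the two integrals. Below,
  \<open>\<kappa>\<close> is 1 for sine and cosine and 0 for the constant 1.\<close>

lemma sin4_integral_rec:
  assumes "p > 0"
    and g: "\<And>u. (g has_real_derivative g' u) (at u)"
    and g': "\<And>u. (g' has_real_derivative - \<kappa> * g u) (at u)"
  shows "(16 * (p + 1)\<^sup>2 - \<kappa>) * sin4_integral g (p + 2) = 16 * (p + 1) * p * sin4_integral g p"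
proof -
  have cont_g: "continuous_on A g" and cont_g': "continuous_on A g'" for A
    by (rule DERIV_continuous_on, rule has_field_derivative_at_within, rule g g')+
  define F where "F = (\<lambda>u. 4 * (p + 1) * (sin (4 * u) powr p * cos (4 * u) * g u) - sin (4 * u) powr (p + 1) * g' u)"
  define f where "f = (\<lambda>u. 16 * (p + 1) * p * (sin (4 * u) powr (p - 1) * g u)
      - (16 * (p + 1)\<^sup>2 - \<kappa>) * (sin (4 * u) powr (p + 2 - 1) * g u))"
  have sin0: "sin (4 * u) \<ge> 0" if "u \<in> {0..pi/4}" for u
    using that by (auto intro!: sin_ge_zero)
  have "(f has_integral (F (pi/4) - F 0)) {0..pi/4}"
  proof (rule fundamental_theorem_of_calculus_interior)
    show "continuous_on {0..pi/4} F"
    proof -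
      have sin_powr: "continuous_on {0..pi/4} (\<lambda>u. sin (4 * u) powr r)" if "r > 0" for r
        using that sin0 by (intro continuous_on_powr' continuous_on_const) (auto intro!: continuous_intros)
      have "continuous_on {0..pi/4} (\<lambda>u. cos (4 * u))" by (intro continuous_intros)
      then show ?thesis
        unfolding F_def using assms(1)
        by (intro continuous_on_diff continuous_on_mult continuous_on_const sin_powr cont_g cont_g') auto
    qed
    fix u assume "u \<in> {0<..<pi/4}"
    then have pos: "sin (4 * u) > 0" by (rule sin4_pos)
    define s c A where "s = sin (4 * u)" and "c = cos (4 * u)" and "A = s powr (p - 1)"
    have s: "s > 0" using pos by (simp add: s_def)
    have P: "s powr p = A * s" "s powr (p + 1 - 1) = A * s" "s powr (p + 1) = A * s * s" "s powr (p + 2 - 1) = A * s * s"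
    proof -
      have "s powr p = s powr (p - 1 + 1)" by simp
      also have "\<dots> = A * s" unfolding powr_add A_def using s by simp
      finally show 1: "s powr p = A * s" .
      then show "s powr (p + 1 - 1) = A * s" by simp
      show 2: "s powr (p + 1) = A * s * s" unfolding powr_add 1 using s by simp
      have "p + 2 - 1 = p + 1" by simp
      then show "s powr (p + 2 - 1) = A * s * s" using 2 by metis
    qed
    have c2: "c * c = 1 - s * s"
      using sin_cos_squared_add[of "4 * u"] by (simp add: s_def c_def power2_eq_square)
    have ds: "((\<lambda>u. sin (4 * u)) has_real_derivative 4 * c) (at u)"
      and dc: "((\<lambda>u. cos (4 * u)) has_real_derivative - (4 * s)) (at u)"
      by (auto intro!: derivative_eq_intros simp: s_def c_def)
    have dp: "((\<lambda>u. sin (4 * u) powr r) has_real_derivative r * s powr (r - 1) * (4 * c)) (at u)" for r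
      using DERIV_fun_powr[OF ds, of r] s by (simp add: s_def)
    have "(F has_real_derivative f u) (at u)"
      unfolding F_def
    proof (rule DERIV_cong[OF DERIV_diff[OF DERIV_cmult[OF DERIV_mult[OF DERIV_mult[OF dp[of p] dc] g]]
              DERIV_mult[OF dp[of "p + 1"] g']]])
      show "4 * (p + 1) * ((p * s powr (p - 1) * (4 * c) * cos (4 * u) + - (4 * s) * sin (4 * u) powr p) * g u + g' u * (sin (4 * u) powr p * cos (4 * u)))
          - ((p + 1) * s powr (p + 1 - 1) * (4 * c) * g' u + - \<kappa> * g u * sin (4 * u) powr (p + 1)) = f u"
        unfolding f_def s_def[symmetric] c_def[symmetric] P A_def[symmetric] using c2 by algebra
    qed
    then show "(F has_vector_derivative f u) (at u)"
      by (simp add: has_real_derivative_iff_has_vector_derivative)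
  qed simp
  \<comment> \<open>Every term of \<open>F\<close> contains a positive power of sin(4u), which is
    zero at both ends.\<close>
  moreover have "F (pi/4) = 0" "F 0 = 0"
    using assms(1) by (simp_all add: F_def)
  ultimately have "integral {0<..<pi/4} f = 0"
    by (simp add: has_integral_Icc_iff_Ioo integral_unique)
  moreover have "integral {0<..<pi/4} f = 16 * (p + 1) * p * sin4_integral g p - (16 * (p + 1)\<^sup>2 - \<kappa>) * sin4_integral g (p + 2)"
  proof -
    have i: "(\<lambda>u. sin (4 * u) powr (p - 1) * g u) integrable_on {0<..<pi/4}"
      "(\<lambda>u. sin (4 * u) powr (p + 2 - 1) * g u) integrable_on {0<..<pi/4}"
      using sin4_integrable[of p g] sin4_integrable[of "p + 2" g] assms(1) cont_g
      by (simp_all add: set_lebesgue_integral_eq_integral(1))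
    show ?thesis
      unfolding f_def sin4_integral_def
      by (subst Henstock_Kurzweil_Integration.integral_diff[OF integrable_on_mult_right[OF i(1)] integrable_on_mult_right[OF i(2)]])
         (simp only: integral_mult_right)
  qed
  ultimately show ?thesis by simp
qed

lemma sin4_integral_one_pos: "p > 0 \<Longrightarrow> sin4_integral (\<lambda>u. 1) p > 0"
  by (simp add: sin4_integral_one Beta_def)

text \<open>Repeated doubling gives sin 8w = 8 sin w cos w cos 2w cos 4w. All three cosines are at
  least 1/2 on the given range, which compensates the factor 8.\<close>

lemma abs_sin_le_abs_sin_8:
  fixes w :: real
  assumes "\<bar>w\<bar> \<le> pi / 16"
  shows "\<bar>sin w\<bar> \<le> \<bar>sin (8 * w)\<bar>"
proof -
  have half: "cos x \<ge> 1 / 2" if "\<bar>x\<bar> \<le> pi / 4" for x :: real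
  proof -
    have "cos (pi / 3) \<le> cos \<bar>x\<bar>" using that by (intro cos_monotone_0_pi_le) auto
    then show ?thesis by (simp add: cos_60)
  qed
  define P where "P = cos w * (cos (2 * w) * cos (4 * w))"
  have "sin (8 * w) = 8 * (sin w * P)"
    using sin_double[of "4 * w"] sin_double[of "2 * w"] sin_double[of w] by (simp add: P_def)
  moreover have "P \<ge> 1/2 * (1/2 * (1/2))"
    unfolding P_def using assms by (intro mult_mono half) (auto intro!: mult_nonneg_nonneg order_trans[OF _ half])
  ultimately have "\<bar>sin (8 * w)\<bar> = \<bar>sin w\<bar> * (8 * P)" "8 * P \<ge> 1"
    by (simp_all add: abs_mult)
  then show ?thesis
    by (metis abs_ge_zero mult.right_neutral mult_left_mono)
qed

text \<open>With \<open>w\<close> half the distance from u to pi/8, both differences contain the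
  factor 2 sin w, whereas cos(4u) is -sin(8w).\<close>

lemma trig_oscillation:
  assumes "u \<in> {0<..<pi/4}"
  shows "\<bar>cos u - cos (pi/8)\<bar> \<le> 2 * \<bar>cos (4 * u)\<bar>" "\<bar>sin u - sin (pi/8)\<bar> \<le> 2 * \<bar>cos (4 * u)\<bar>"
proof -
  define w where "w = (u - pi/8) / 2"
  have "4 * u = 8 * w + pi / 2" by (simp add: w_def field_simps)
  then have "cos (4 * u) = - sin (8 * w)" by (simp add: minus_sin_cos_eq)
  moreover have "\<bar>sin w\<bar> \<le> \<bar>sin (8 * w)\<bar>"
    using assms by (intro abs_sin_le_abs_sin_8) (simp add: w_def abs_le_iff field_simps)
  ultimately have w: "\<bar>sin w\<bar> \<le> \<bar>cos (4 * u)\<bar>" by simp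
  have "cos u - cos (pi/8) = 2 * sin ((u + pi/8) / 2) * sin (- w)"
    unfolding cos_diff_cos w_def by (simp add: minus_divide_left del: sin_minus)
  then have "\<bar>cos u - cos (pi/8)\<bar> = 2 * (\<bar>sin ((u + pi/8) / 2)\<bar> * \<bar>sin w\<bar>)"
    by (simp add: abs_mult)
  also have "\<dots> \<le> 2 * (1 * \<bar>sin w\<bar>)"
    by (intro mult_left_mono mult_right_mono) auto
  finally show "\<bar>cos u - cos (pi/8)\<bar> \<le> 2 * \<bar>cos (4 * u)\<bar>" using w by simp
  have "sin u - sin (pi/8) = 2 * sin w * cos ((u + pi/8) / 2)"
    unfolding sin_diff_sin w_def by (simp only:)
  then have "\<bar>sin u - sin (pi/8)\<bar> = 2 * (\<bar>sin w\<bar> * \<bar>cos ((u + pi/8) / 2)\<bar>)"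
    by (simp add: abs_mult)
  also have "\<dots> \<le> 2 * (\<bar>sin w\<bar> * 1)"
    by (intro mult_left_mono) auto
  finally show "\<bar>sin u - sin (pi/8)\<bar> \<le> 2 * \<bar>cos (4 * u)\<bar>" using w by simp
qed

text \<open>The weight \<open>sin (4 * u) powr (p - 1)\<close> concentrates at \<open>pi / 8\<close> as \<open>p\<close> grows.\<close>

lemma sin4_integral_concentration:
  assumes "p > 0" and cont: "continuous_on UNIV g"
    and osc: "\<And>u. u \<in> {0<..<pi/4} \<Longrightarrow> \<bar>g u - g (pi/8)\<bar> \<le> 2 * \<bar>cos (4 * u)\<bar>"
  shows "\<bar>sin4_integral g p - g (pi/8) * sin4_integral (\<lambda>u. 1) p\<bar> \<le> 2 / sqrt (p + 1) * sin4_integral (\<lambda>u. 1) p"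
proof -
  \<comment> \<open>The bound 2|cos 4u| <= \<open>\<epsilon>\<close> + cos(4u)^2 /
    \<open>\<epsilon>\<close> will be averaged against the weight. The mean of cos(4u)^2 is 1/(p +
    1), and this \<open>\<epsilon>\<close> makes both contributions equal.\<close>
  define \<epsilon> where "\<epsilon> = 1 / sqrt (p + 1)"
  have \<epsilon>: "\<epsilon> > 0" using assms(1) by (simp add: \<epsilon>_def)
  have \<epsilon>2: "1 / \<epsilon> * (1 / (p + 1)) = \<epsilon>"
    using assms(1) by (simp add: \<epsilon>_def field_simps real_sqrt_mult_self power2_eq_square[symmetric])
  let ?w = "\<lambda>u. sin (4 * u) powr (p - 1)"
  have i: "(\<lambda>u. ?w u * h u) integrable_on {0<..<pi/4}" if "continuous_on UNIV h" for h
    using sin4_integrable[OF assms(1) that] by (rule set_lebesgue_integral_eq_integral(1))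
  have rec: "(p + 1) * sin4_integral (\<lambda>u. 1) (p + 2) = p * sin4_integral (\<lambda>u. 1) p"
  proof -
    have "(16 * (p + 1)\<^sup>2 - 0) * sin4_integral (\<lambda>u. 1) (p + 2) = 16 * (p + 1) * p * sin4_integral (\<lambda>u. 1) p"
      by (rule sin4_integral_rec[OF assms(1), where g' = "\<lambda>u. 0"]) auto
    then have "16 * (p + 1) * ((p + 1) * sin4_integral (\<lambda>u. 1) (p + 2) - p * sin4_integral (\<lambda>u. 1) p) = 0"
      by algebra
    then show ?thesis using assms(1) by simp
  qed
  have cos2: "integral {0<..<pi/4} (\<lambda>u. ?w u * (cos (4 * u))\<^sup>2) = sin4_integral (\<lambda>u. 1) p / (p + 1)"
  proof -
    have "integral {0<..<pi/4} (\<lambda>u. ?w u * (cos (4 * u))\<^sup>2) = integral {0<..<pi/4} (\<lambda>u. ?w u * 1 - sin (4 * u) powr (p + 2 - 1) * 1)"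
    proof (rule Henstock_Kurzweil_Integration.integral_cong)
      fix u assume "u \<in> {0<..<pi/4}"
      then have "sin (4 * u) > 0" by (rule sin4_pos)
      then have "sin (4 * u) powr (p - 1 + 2) = ?w u * (sin (4 * u))\<^sup>2"
        unfolding powr_add by (simp add: powr_numeral)
      then show "?w u * (cos (4 * u))\<^sup>2 = ?w u * 1 - sin (4 * u) powr (p + 2 - 1) * 1"
        by (simp add: cos_squared_eq algebra_simps)
    qed
    also have "\<dots> = sin4_integral (\<lambda>u. 1) p - sin4_integral (\<lambda>u. 1) (p + 2)"
      unfolding sin4_integral_def
      using sin4_integrable[of p "\<lambda>u. 1"] sin4_integrable[of "p + 2" "\<lambda>u. 1"] assms(1)
      by (intro Henstock_Kurzweil_Integration.integral_diff) (auto dest!: set_lebesgue_integral_eq_integral(1))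
    also have "\<dots> = sin4_integral (\<lambda>u. 1) p / (p + 1)"
      using rec assms(1) by (simp add: field_simps)
    finally show ?thesis .
  qed
  have "sin4_integral g p - g (pi/8) * sin4_integral (\<lambda>u. 1) p = integral {0<..<pi/4} (\<lambda>u. ?w u * g u - g (pi/8) * (?w u * 1))"
    unfolding sin4_integral_def using i[OF cont] i[OF continuous_on_const, of 1]
    by (subst Henstock_Kurzweil_Integration.integral_diff) (auto intro: integrable_on_mult_right)
  also have "\<dots> = integral {0<..<pi/4} (\<lambda>u. ?w u * (g u - g (pi/8)))"
    by (simp add: algebra_simps)
  finally have "\<bar>sin4_integral g p - g (pi/8) * sin4_integral (\<lambda>u. 1) p\<bar> = norm (integral {0<..<pi/4} (\<lambda>u. ?w u * (g u - g (pi/8))))"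
    by simp
  also have "\<dots> \<le> integral {0<..<pi/4} (\<lambda>u. \<epsilon> * (?w u * 1) + 1 / \<epsilon> * (?w u * (cos (4 * u))\<^sup>2))"
  proof (rule integral_norm_bound_integral)
    show "(\<lambda>u. ?w u * (g u - g (pi/8))) integrable_on {0<..<pi/4}"
      by (intro i continuous_intros cont)
    show "(\<lambda>u. \<epsilon> * (?w u * 1) + 1 / \<epsilon> * (?w u * (cos (4 * u))\<^sup>2)) integrable_on {0<..<pi/4}"
      by (intro integrable_add integrable_on_mult_right i continuous_intros)
    fix u assume u: "u \<in> {0<..<pi/4}"
    have "0 \<le> (\<epsilon> - \<bar>cos (4 * u)\<bar>)\<^sup>2 / \<epsilon>" using \<epsilon> by simp
    also have "\<dots> = \<epsilon> + 1 / \<epsilon> * (cos (4 * u))\<^sup>2 - 2 * \<bar>cos (4 * u)\<bar>"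
      using \<epsilon> by (simp add: power2_eq_square field_simps)
    finally have "\<bar>g u - g (pi/8)\<bar> \<le> \<epsilon> + 1 / \<epsilon> * (cos (4 * u))\<^sup>2" using osc[OF u] by simp
    then have "?w u * \<bar>g u - g (pi/8)\<bar> \<le> ?w u * (\<epsilon> + 1 / \<epsilon> * (cos (4 * u))\<^sup>2)"
      by (rule mult_left_mono) simp
    then show "norm (?w u * (g u - g (pi/8))) \<le> \<epsilon> * (?w u * 1) + 1 / \<epsilon> * (?w u * (cos (4 * u))\<^sup>2)"
    proof -
      have "norm (?w u * (g u - g (pi/8))) = ?w u * \<bar>g u - g (pi/8)\<bar>"
        by (simp only: real_norm_def abs_mult abs_of_nonneg[OF powr_ge_zero])
      moreover have "\<epsilon> * (?w u * 1) + 1 / \<epsilon> * (?w u * (cos (4 * u))\<^sup>2) = ?w u * (\<epsilon> + 1 / \<epsilon> * (cos (4 * u))\<^sup>2)"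
        by (simp add: algebra_simps)
      ultimately show ?thesis using \<open>?w u * \<bar>g u - g (pi/8)\<bar> \<le> _\<close> by (simp only:)
    qed
  qed
  also have "\<dots> = \<epsilon> * sin4_integral (\<lambda>u. 1) p + 1 / \<epsilon> * (sin4_integral (\<lambda>u. 1) p / (p + 1))"
  proof -
    have i1: "(\<lambda>u. \<epsilon> * (?w u * 1)) integrable_on {0<..<pi/4}"
      and i2: "(\<lambda>u. 1 / \<epsilon> * (?w u * (cos (4 * u))\<^sup>2)) integrable_on {0<..<pi/4}"
      by (intro integrable_on_mult_right i continuous_intros)+
    show ?thesis
      by (subst Henstock_Kurzweil_Integration.integral_add[OF i1 i2])
         (simp only: integral_mult_right cos2 sin4_integral_def)
  qed
  also have "\<dots> = 2 / sqrt (p + 1) * sin4_integral (\<lambda>u. 1) p"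
  proof -
    have "1 / \<epsilon> * (sin4_integral (\<lambda>u. 1) p / (p + 1)) = (1 / \<epsilon> * (1 / (p + 1))) * sin4_integral (\<lambda>u. 1) p"
      by simp
    then show ?thesis unfolding \<epsilon>2 by (simp add: \<epsilon>_def)
  qed
  finally show ?thesis .
qed

text \<open>The quotient \<open>r\<close> by the integral of the bare weight satisfies r(q + 2) ((q
  + 1)^2 - 1/16) = r(q) (q + 1)^2. For q + 1 = 2y the left factor is 4 (y - 1/8) (y + 1/8), so
  iteration yields Pochhammer symbols at y and y +- 1/8, whose limit is the gamma quotient.
  Concentration gives the limit of \<open>r\<close> itself.\<close>

lemma sin4_integral_eq:
  assumes "p > 0"
    and g: "\<And>u. (g has_real_derivative g' u) (at u)"
    and g': "\<And>u. (g' has_real_derivative - g u) (at u)"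
    and osc: "\<And>u. u \<in> {0<..<pi/4} \<Longrightarrow> \<bar>g u - g (pi/8)\<bar> \<le> 2 * \<bar>cos (4 * u)\<bar>"
  defines "y \<equiv> (p + 1) / 2"
  shows "sin4_integral g p = g (pi/8) * (2 powr (p - 3) * Beta (p / 2) (p / 2)) *
      ((Gamma y)\<^sup>2 / (Gamma (y - 1/8) * Gamma (y + 1/8)))"
proof -
  define r where "r = (\<lambda>p. sin4_integral g p / sin4_integral (\<lambda>u. 1) p)"
  have cont: "continuous_on UNIV g"
    using g by (auto intro: DERIV_continuous_on has_field_derivative_at_within)
  have y: "y > 1/2" using assms(1) by (simp add: y_def)
  have r_rec: "r (q + 2) * ((q + 1)\<^sup>2 - 1/16) = r q * (q + 1)\<^sup>2" if "q > 0" for q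
  proof -
    define A A' B B' where "A = sin4_integral g q" and "A' = sin4_integral g (q + 2)"
      and "B = sin4_integral (\<lambda>u. 1) q" and "B' = sin4_integral (\<lambda>u. 1) (q + 2)"
    have 1: "(16 * (q + 1)\<^sup>2 - 1) * A' = 16 * (q + 1) * q * A"
      unfolding A_def A'_def by (rule sin4_integral_rec[OF that g]) (use g' in simp)
    have 2: "16 * (q + 1)\<^sup>2 * B' = 16 * (q + 1) * q * B"
      using sin4_integral_rec[OF that, of "\<lambda>u. 1" "\<lambda>u. 0" 0] by (simp add: B_def B'_def)
    have B: "B > 0" "B' > 0" using that sin4_integral_one_pos by (auto simp: B_def B'_def)
    have "((16 * (q + 1)\<^sup>2 - 1) * A') * (16 * (q + 1)\<^sup>2 * B) = (16 * (q + 1)\<^sup>2 * B') * (16 * (q + 1)\<^sup>2 * A)"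
      unfolding 1 2 by (simp add: mult_ac)
    then have "16 * (q + 1)\<^sup>2 * ((16 * (q + 1)\<^sup>2 - 1) * A' * B) = 16 * (q + 1)\<^sup>2 * (16 * (q + 1)\<^sup>2 * A * B')"
      by (simp only: mult_ac)
    moreover have "16 * (q + 1)\<^sup>2 \<noteq> 0" using that by simp
    ultimately have "(16 * (q + 1)\<^sup>2 - 1) * A' * B = 16 * (q + 1)\<^sup>2 * A * B'"
      by (metis mult_left_cancel)
    then show ?thesis
      unfolding r_def A_def[symmetric] A'_def[symmetric] B_def[symmetric] B'_def[symmetric]
      using B by (simp add: field_simps)
  qed
  have iter: "r (p + 2 * real N) * (pochhammer (y - 1/8) N * pochhammer (y + 1/8) N) = r p * (pochhammer y N)\<^sup>2" for N
  proof (induction N)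
    case (Suc N)
    define n where "n = p + 2 * real N"
    have n: "n > 0" "n + 1 = 2 * (y + real N)" using assms(1) by (simp_all add: n_def y_def)
    have "r (n + 2) * (4 * ((y - 1/8 + real N) * (y + 1/8 + real N))) = r n * (4 * (y + real N)\<^sup>2)"
    proof -
      have "4 * ((y - 1/8 + real N) * (y + 1/8 + real N)) = (2 * (y + real N))\<^sup>2 - 1/16"
        "4 * (y + real N)\<^sup>2 = (2 * (y + real N))\<^sup>2"
        by (simp_all add: power2_eq_square field_simps)
      then show ?thesis using r_rec[OF n(1)] unfolding n(2) by (simp only:)
    qed
    then have step: "r (n + 2) * ((y - 1/8 + real N) * (y + 1/8 + real N)) = r n * (y + real N)\<^sup>2"
      by simp
    have "r (p + 2 * real (Suc N)) * (pochhammer (y - 1/8) (Suc N) * pochhammer (y + 1/8) (Suc N))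
        = (r (n + 2) * ((y - 1/8 + real N) * (y + 1/8 + real N))) * (pochhammer (y - 1/8) N * pochhammer (y + 1/8) N)"
      by (simp add: pochhammer_Suc n_def algebra_simps)
    also have "\<dots> = (r n * (pochhammer (y - 1/8) N * pochhammer (y + 1/8) N)) * (y + real N)\<^sup>2"
      unfolding step by (simp only: mult_ac)
    also have "r n * (pochhammer (y - 1/8) N * pochhammer (y + 1/8) N) = r p * (pochhammer y N)\<^sup>2"
      using Suc by (simp add: n_def)
    finally show ?case by (simp add: pochhammer_Suc power_mult_distrib mult_ac)
  qed simp
  have r_bound: "\<bar>r q - g (pi/8)\<bar> \<le> 2 / sqrt (q + 1)" if "q > 0" for q
  proof -
    have B: "sin4_integral (\<lambda>u. 1) q > 0" using that by (rule sin4_integral_one_pos)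
    have eq: "r q - g (pi/8) = (sin4_integral g q - g (pi/8) * sin4_integral (\<lambda>u. 1) q) / sin4_integral (\<lambda>u. 1) q"
      using B by (simp add: r_def field_simps)
    show ?thesis
      unfolding eq abs_divide using sin4_integral_concentration[OF that cont osc] B
      by (simp only: abs_of_pos pos_divide_le_eq)
  qed
  have lim: "(\<lambda>N. r (p + 2 * real (Suc N))) \<longlonglongrightarrow> g (pi/8)"
  proof (rule LIM_zero_cancel, rule Lim_null_comparison)
    show "\<forall>\<^sub>F N in sequentially. norm (r (p + 2 * real (Suc N)) - g (pi/8)) \<le> 2 / sqrt (p + 2 * real (Suc N) + 1)"
      using assms(1) by (intro always_eventually allI) (simp only: real_norm_def, rule r_bound, simp)
    show "(\<lambda>N. 2 / sqrt (p + 2 * real (Suc N) + 1)) \<longlonglongrightarrow> 0"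
    proof (rule tendsto_divide_0[OF tendsto_const], rule filterlim_at_top_imp_at_infinity, rule filterlim_compose[OF sqrt_at_top])
      show "filterlim (\<lambda>N. p + 2 * real (Suc N) + 1) at_top sequentially"
        by (rule filterlim_at_top_mono[OF filterlim_real_sequentially]) (use assms(1) in auto)
    qed
  qed
  \<comment> \<open>\<open>Gamma_series z N\<close> contains a Pochhammer symbol with N + 1 factors,
    hence \<open>Suc N\<close> in the argument of \<open>r\<close>.\<close>
  have "(\<lambda>N. r (p + 2 * real (Suc N)) * ((Gamma_series y N)\<^sup>2 / (Gamma_series (y - 1/8) N * Gamma_series (y + 1/8) N)))
      \<longlonglongrightarrow> g (pi/8) * ((Gamma y)\<^sup>2 / (Gamma (y - 1/8) * Gamma (y + 1/8)))"
    using y by (intro tendsto_intros lim) (auto simp: Gamma_eq_zero_iff elim!: nonpos_Ints_cases)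
  moreover have "r (p + 2 * real (Suc N)) * ((Gamma_series y N)\<^sup>2 / (Gamma_series (y - 1/8) N * Gamma_series (y + 1/8) N)) = r p" for N
  proof -
    define E where "E = (\<lambda>z::real. exp (z * ln (real N)))"
    define P where "P = (\<lambda>z::real. pochhammer z (Suc N))"
    \<comment> \<open>The powers of N and the factorials in the three Gamma series cancel because y
      - 1/8 and y + 1/8 add up to 2y.\<close>
    have E: "E y ^ 2 = E (y - 1/8) * E (y + 1/8)" "E z > 0" for z
      by (simp_all add: E_def power2_eq_square exp_add[symmetric] algebra_simps)
    have P: "P y > 0" "P (y - 1/8) > 0" "P (y + 1/8) > 0"
      using y by (auto simp: P_def intro!: pochhammer_pos)
    have G: "Gamma_series z N = fact N * E z / P z" for z
      by (simp add: Gamma_series_def E_def P_def)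
    have ratio: "(Gamma_series y N)\<^sup>2 / (Gamma_series (y - 1/8) N * Gamma_series (y + 1/8) N) = (P (y - 1/8) * P (y + 1/8)) / (P y)\<^sup>2"
      unfolding G power_divide power_mult_distrib E
      using E(2)[of "y - 1/8"] E(2)[of "y + 1/8"] P by (simp add: power2_eq_square field_simps)
    have "r (p + 2 * real (Suc N)) * (P (y - 1/8) * P (y + 1/8)) = r p * (P y)\<^sup>2"
      unfolding P_def by (rule iter)
    then show ?thesis unfolding ratio times_divide_eq_right using P by (simp only:) simp
  qed
  ultimately have "r p = g (pi/8) * ((Gamma y)\<^sup>2 / (Gamma (y - 1/8) * Gamma (y + 1/8)))"
    by (simp add: LIMSEQ_const_iff)
  then have "sin4_integral g p = (g (pi/8) * ((Gamma y)\<^sup>2 / (Gamma (y - 1/8) * Gamma (y + 1/8)))) * sin4_integral (\<lambda>u. 1) p"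
    using sin4_integral_one_pos[OF assms(1)] by (simp add: r_def field_simps)
  then show ?thesis
    unfolding sin4_integral_one(2)[OF assms(1)] by (simp only: mult_ac)
qed

text \<open>This is Euler's integral with upper parameters 4t - 1/2 and t + e and lower parameter 3t
  + e. Apart from the last factor, the powers of sin u, cos u and cos 2u assemble into a power of
  sin 4u = 4 sin u cos u cos 2u. The remaining factor is cos u for e = 0 and sin u for e =
  1/2.\<close>

lemma tan_sq_substitution:
  fixes t e :: real
  assumes "t > 0"
  defines "f \<equiv> \<lambda>x. x powr (t + e - 1) * (1 - x) powr (2 * t - 1) * (1 + x) powr - (4 * t - 1/2)"
  assumes f: "f absolutely_integrable_on {0<..<1}"
  shows "integral {0<..<1} f = 2 * 4 powr (1 - 2 * t) * sin4_integral (\<lambda>u. cos u * tan u powr (2 * e)) (2 * t)"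
proof -
  define S where "S = {0<..<pi/4}"
  define h where "h = (\<lambda>u. \<bar>2 * tan u * inverse ((cos u)\<^sup>2)\<bar> * f ((tan u)\<^sup>2))"
  have "h absolutely_integrable_on S \<and> integral S h = integral {0<..<1} f"
    unfolding h_def
  proof (rule has_absolute_integral_change_of_variables_1'[where g = "\<lambda>u. (tan u)\<^sup>2"
        and g' = "\<lambda>u. 2 * tan u * inverse ((cos u)\<^sup>2)" and f = f, THEN iffD2])
    show "((\<lambda>u. (tan u)\<^sup>2) has_field_derivative 2 * tan u * inverse ((cos u)\<^sup>2)) (at u within S)" if "u \<in> S" for u :: real
    proof -
      have "cos u > 0" using that by (auto simp: S_def intro!: cos_gt_zero)
      then show ?thesis by (auto intro!: derivative_eq_intros)
    qed
    show "inj_on (\<lambda>u. (tan u)\<^sup>2) S" unfolding S_def by (rule inj_on_tan_sq)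
    show "f absolutely_integrable_on (\<lambda>u. (tan u)\<^sup>2) ` S \<and> integral ((\<lambda>u. (tan u)\<^sup>2) ` S) f = integral {0<..<1} f"
      unfolding S_def image_tan_sq using f by simp
  qed (simp add: S_def)
  then have "integral {0<..<1} f = integral S h" by simp
  also have "\<dots> = integral S (\<lambda>u. 2 * 4 powr (1 - 2 * t) * (sin (4 * u) powr (2 * t - 1) * (cos u * tan u powr (2 * e))))"
  proof (rule Henstock_Kurzweil_Integration.integral_cong)
    fix u assume u: "u \<in> S"
    have pos: "sin u > 0" "cos u > 0" "cos (2 * u) > 0"
      using u by (auto simp: S_def intro!: sin_gt_zero cos_gt_zero)
    \<comment> \<open>Passing to logarithms turns the identity between powers into a linear identity
      between exponents.\<close>
    define a b d where "a = ln (sin u)" and "b = ln (cos u)" and "d = ln (cos (2 * u))"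
    have ex: "sin u = exp a" "cos u = exp b" "cos (2 * u) = exp d"
      using pos by (simp_all add: a_def b_def d_def)
    have tan: "tan u = exp (a - b)" by (simp add: tan_def ex exp_diff)
    have tan2: "(tan u)\<^sup>2 = exp (2 * (a - b))" unfolding tan by (simp add: power2_eq_square exp_add[symmetric])
    have cos2: "(cos u)\<^sup>2 = exp (2 * b)" unfolding ex by (simp add: power2_eq_square exp_add[symmetric])
    have t1: "1 - (tan u)\<^sup>2 = exp (d - 2 * b)"
    proof -
      have "1 - (tan u)\<^sup>2 = ((cos u)\<^sup>2 - (sin u)\<^sup>2) / (cos u)\<^sup>2"
        using pos by (simp add: tan_def field_simps)
      also have "(cos u)\<^sup>2 - (sin u)\<^sup>2 = exp d" using cos_double[of u] ex(3) by simp
      finally show ?thesis by (simp only: cos2 exp_diff)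
    qed
    have t2: "1 + (tan u)\<^sup>2 = exp (- 2 * b)"
    proof -
      have "1 + (tan u)\<^sup>2 = ((cos u)\<^sup>2 + (sin u)\<^sup>2) / (cos u)\<^sup>2"
        using pos by (simp add: tan_def field_simps)
      also have "\<dots> = 1 / (cos u)\<^sup>2" by (simp only: sin_cos_squared_add2)
      also have "\<dots> = 1 / exp (2 * b)" by (simp only: cos2)
      finally show ?thesis by (simp add: exp_minus inverse_eq_divide)
    qed
    have s4: "sin (4 * u) = exp (ln 4 + a + b + d)"
      using sin_double[of "2 * u"] sin_double[of u] by (simp add: exp_add ex)
    have h: "h u = 2 * exp ((a - b) - 2 * b + (t + e - 1) * (2 * (a - b)) + (2 * t - 1) * (d - 2 * b) + - (4 * t - 1/2) * (- 2 * b))"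
      unfolding h_def f_def t1 t2 unfolding tan2 unfolding tan cos2 exp_minus[symmetric] powr_def ln_exp
      by (simp add: abs_mult exp_add[symmetric] exp_minus[symmetric] mult.assoc algebra_simps)
    have "2 * 4 powr (1 - 2 * t) * (sin (4 * u) powr (2 * t - 1) * (cos u * tan u powr (2 * e)))
        = 2 * exp ((1 - 2 * t) * ln 4 + ((2 * t - 1) * (ln 4 + a + b + d) + (b + 2 * e * (a - b))))"
    proof -
      have pw: "exp z powr x = exp (x * z)" "4 powr x = exp (x * ln 4)" for x z :: real
        by (simp_all add: powr_def)
      show ?thesis unfolding s4 tan ex(2) pw by (simp only: exp_add mult.assoc)
    qed
    also have "(1 - 2 * t) * ln 4 + ((2 * t - 1) * (ln 4 + a + b + d) + (b + 2 * e * (a - b)))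
        = (a - b) - 2 * b + (t + e - 1) * (2 * (a - b)) + (2 * t - 1) * (d - 2 * b) + - (4 * t - 1/2) * (- 2 * b)"
      by (simp add: algebra_simps)
    finally show "h u = 2 * 4 powr (1 - 2 * t) * (sin (4 * u) powr (2 * t - 1) * (cos u * tan u powr (2 * e)))"
      unfolding h by simp
  qed
  also have "\<dots> = 2 * 4 powr (1 - 2 * t) * sin4_integral (\<lambda>u. cos u * tan u powr (2 * e)) (2 * t)"
    by (simp add: sin4_integral_def S_def)
  finally show ?thesis .
qed

subsection \<open>Evaluation on the four lines\<close>

lemma Gamma_duplication_real:
  fixes x :: real
  assumes "x > 0"
  shows "Gamma x * Gamma (x + 1/2) = 2 powr (1 - 2 * x) * sqrt pi * Gamma (2 * x)"
proof -
  have pos: "complex_of_real y \<notin> \<int>\<^sub>\<le>\<^sub>0" if "y > 0" for y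
    using that by (simp add: of_real_in_nonpos_Ints_iff) (auto elim!: nonpos_Ints_cases)
  have "complex_of_real (Gamma x * Gamma (x + 1/2)) = Gamma (of_real x) * Gamma (of_real x + 1/2)"
    by (simp flip: Gamma_complex_of_real)
  also have "\<dots> = exp ((1 - 2 * of_real x) * of_real (ln 2)) * of_real (sqrt pi) * Gamma (2 * of_real x)"
    using assms pos[of x] pos[of "x + 1/2"] by (intro Gamma_legendre_duplication) simp_all
  also have "exp ((1 - 2 * of_real x) * of_real (ln 2)) = complex_of_real (2 powr (1 - 2 * x))"
    by (simp add: powr_def flip: exp_of_real)
  also have "Gamma (2 * of_real x) = complex_of_real (Gamma (2 * x))"
    by (simp flip: Gamma_complex_of_real)
  finally have "complex_of_real (Gamma x * Gamma (x + 1/2)) = of_real (2 powr (1 - 2 * x) * sqrt pi * Gamma (2 * x))"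
    by simp
  then show ?thesis by (simp only: of_real_eq_iff)
qed

lemma Gamma_reflection_real:
  fixes x :: real
  shows "Gamma x * Gamma (1 - x) = pi / sin (pi * x)"
proof -
  have "complex_of_real (Gamma x * Gamma (1 - x)) = Gamma (of_real x) * Gamma (1 - of_real x)"
    by (simp flip: Gamma_complex_of_real)
  also have "\<dots> = of_real (pi / sin (pi * x))"
    unfolding Gamma_reflection_complex by (simp flip: sin_of_real)
  finally show ?thesis by (simp only: of_real_eq_iff)
qed

lemma not_nonpos_Ints: "x \<notin> \<int>\<^sub>\<le>\<^sub>0" if "x > -1" "x \<noteq> 0" for x :: real
  using that by (auto elim!: nonpos_Ints_cases)

lemma Gamma_Suc_real: "Gamma (x + 1) = x * Gamma x" if "x > -1" "x \<noteq> 0" for x :: real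
  using Gamma_plus1[OF not_nonpos_Ints[OF that]] .

text \<open>The pair is (slope, intercept). The polymorphic result lets one list of real pairs
  describe both the real base case and the complex statement.\<close>

definition affine_fun :: "real \<times> real \<Rightarrow> 'a::real_algebra_1 \<Rightarrow> 'a" where
  "affine_fun q z = of_real (fst q) * z + of_real (snd q)"

lemma affine_fun_of_real: "affine_fun q (of_real x) = of_real (affine_fun q x)"
  by (simp add: affine_fun_def)

lemma affine_fun_holomorphic: "affine_fun q holomorphic_on S"
  unfolding affine_fun_def by (intro holomorphic_intros)

lemma hyp2F1_term_of_real:
  "hyp2F1_term (vector [of_real a, of_real b, of_real c]) k = of_real (real_hyp_term a b c k)"
  by (simp add: hyp2F1_term_def real_hyp_term_def pochhammer_of_real)

lemma gamma_quotient_of_real: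
  "gamma_quotient (map of_real us) (map of_real ls) = of_real ((\<Prod>u\<leftarrow>us. Gamma u) * (\<Prod>u\<leftarrow>ls. rGamma u))"
proof -
  have "(\<Prod>u\<leftarrow>map complex_of_real us. Gamma u) = of_real (\<Prod>u\<leftarrow>us. Gamma u)"
    by (induction us) (simp_all add: Gamma_complex_of_real)
  moreover have "(\<Prod>u\<leftarrow>map complex_of_real ls. rGamma u) = of_real (\<Prod>u\<leftarrow>ls. rGamma u)"
    by (induction ls) (simp_all add: rGamma_complex_of_real)
  ultimately show ?thesis by (simp only: gamma_quotient_def of_real_mult)
qed

lemma connected_affine_halfplane: "connected {t. Re (of_real \<alpha> * t + of_real \<beta>) > \<gamma>}"
proof -
  have "{t. Re (of_real \<alpha> * t + of_real \<beta>) > \<gamma>} = {t. complex_of_real \<alpha> \<bullet> t > \<gamma> - \<beta>}"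
    by (auto simp: inner_complex_def)
  then show ?thesis by (simp add: convex_halfspace_gt convex_connected)
qed

text \<open>All arguments on the four lines are real-affine in the parameter, so holomorphy and
  connectedness of the half-plane are automatic; only a real summation on an interval
  remains.\<close>

lemma gamma_evaluation_from_interval:
  fixes A B C :: "real \<times> real" and us ls :: "(real \<times> real) list" and l r :: real
  assumes "l < r"
    and base: "\<And>x. l < x \<Longrightarrow> x < r \<Longrightarrow> affine_fun C x - affine_fun A x - affine_fun B x > -1 \<and>
        affine_fun C x \<notin> \<int>\<^sub>\<le>\<^sub>0 \<and> (\<forall>u\<in>set us. affine_fun u x \<notin> \<int>\<^sub>\<le>\<^sub>0) \<and>
        real_hyp_term (affine_fun A x) (affine_fun B x) (affine_fun C x) sums
          ((\<Prod>u\<leftarrow>us. Gamma (affine_fun u x)) * (\<Prod>u\<leftarrow>ls. rGamma (affine_fun u x)))"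
  shows "gamma_evaluation (vector [affine_fun A a, affine_fun B a, affine_fun C a])
    (map (\<lambda>u. affine_fun u a) us) (map (\<lambda>u. affine_fun u a) ls)"
proof -
  define p :: "complex \<Rightarrow> complex^3" where "p = (\<lambda>a. vector [affine_fun A a, affine_fun B a, affine_fun C a])"
  have "gamma_evaluation (p a) (map (\<lambda>f. f a) (map affine_fun us)) (map (\<lambda>f. f a) (map affine_fun ls))"
  proof (rule gamma_evaluation_continuation[OF _ _ _ _ \<open>l < r\<close>])
    have "\<forall>i. (\<lambda>t. p t $ i) holomorphic_on UNIV"
      unfolding forall_3 by (simp add: p_def affine_fun_holomorphic)
    then show "(\<lambda>t. p t $ i) holomorphic_on UNIV" for i by blast
    show "\<forall>f\<in>set (map affine_fun us). f holomorphic_on (UNIV :: complex set)"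
      "\<forall>f\<in>set (map affine_fun ls). f holomorphic_on (UNIV :: complex set)"
      by (auto simp: affine_fun_holomorphic)
    have "excess (p t) = of_real (fst C - fst A - fst B) * t + of_real (snd C - snd A - snd B)" for t
      by (simp add: excess_def p_def affine_fun_def algebra_simps)
    then show "connected {t. Re (excess (p t)) > -1}"
      by (simp only: connected_affine_halfplane)
    fix x assume x: "l < x" "x < r"
    note b = base[OF x]
    have p_x: "p (of_real x) = vector [of_real (affine_fun A x), of_real (affine_fun B x), of_real (affine_fun C x)]"
      by (simp add: p_def affine_fun_of_real)
    have maps: "map (\<lambda>f. f (of_real x)) (map affine_fun qs) = map complex_of_real (map (\<lambda>q. affine_fun q x) qs)" for qs
      by (simp add: affine_fun_of_real)
    have "hyp2F1_term (p (of_real x)) sums gamma_quotient (map (\<lambda>f. f (of_real x)) (map affine_fun us)) (map (\<lambda>f. f (of_real x)) (map affine_fun ls))"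
      unfolding maps gamma_quotient_of_real p_x hyp2F1_term_of_real sums_of_real_iff using b by (simp add: comp_def)
    moreover have "Re (excess (p (of_real x))) > -1" "p (of_real x) $ 3 \<notin> \<int>\<^sub>\<le>\<^sub>0"
      using b by (simp_all add: p_x excess_def of_real_in_nonpos_Ints_iff)
    moreover have "\<forall>f\<in>set (map affine_fun us). f (of_real x) \<notin> (\<int>\<^sub>\<le>\<^sub>0 :: complex set)"
      using b by (simp add: affine_fun_of_real of_real_in_nonpos_Ints_iff)
    ultimately show "Re (excess (p (of_real x))) > -1 \<and> p (of_real x) $ 3 \<notin> \<int>\<^sub>\<le>\<^sub>0 \<and>
        (\<forall>f\<in>set (map affine_fun us). f (of_real x) \<notin> (\<int>\<^sub>\<le>\<^sub>0 :: complex set)) \<and>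
        hyp2F1_term (p (of_real x)) sums
          gamma_quotient (map (\<lambda>f. f (of_real x)) (map affine_fun us)) (map (\<lambda>f. f (of_real x)) (map affine_fun ls))"
      by blast
  qed
  then show ?thesis by (simp add: p_def comp_def)
qed

section \<open>Telescoping reduction to Kummer's theorem on lines (i) and (iv)\<close>

text \<open>The convergence result is applied to constant parameter functions; the terms of a
  convergent series tend to zero. This removes boundary terms even where convergence is only
  conditional.\<close>

lemma real_hyp_term_tendsto_0:
  assumes "c \<notin> \<int>\<^sub>\<le>\<^sub>0" "c - a - b > -1"
  shows "real_hyp_term a b c \<longlonglongrightarrow> 0"
proof -
  define p :: "complex^3" where "p = vector [of_real a, of_real b, of_real c]"
  have c: "p $ 3 \<notin> \<int>\<^sub>\<le>\<^sub>0" using assms(1) by (simp add: p_def of_real_in_nonpos_Ints_iff)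
  obtain g where "\<And>t::complex. t \<in> UNIV \<Longrightarrow> (\<lambda>k. hyp_coeff (p$1) (p$2) (p$3) k * (-1) ^ k) sums g t"
    using hyp_series_holomorphic[of UNIV "\<lambda>_. p$1" "\<lambda>_. p$2" "\<lambda>_. p$3"] assms(2)
    by (auto simp: p_def)
  then have "(\<lambda>k. rGamma (p$3) * hyp2F1_term p k) \<longlonglongrightarrow> 0"
    unfolding hyp2F1_term_conv_hyp_coeff[OF c] by (auto dest: sums_summable summable_LIMSEQ_zero)
  then have "(\<lambda>k. inverse (rGamma (p$3)) * (rGamma (p$3) * hyp2F1_term p k)) \<longlonglongrightarrow> inverse (rGamma (p$3)) * 0"
    by (rule tendsto_mult_left)
  then have "(\<lambda>k. complex_of_real (real_hyp_term a b c k)) \<longlonglongrightarrow> of_real 0"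
    using c by (simp add: rGamma_eq_zero_iff p_def hyp2F1_term_of_real flip: mult.assoc)
  then show ?thesis by (simp only: tendsto_of_real_iff)
qed

lemma linear_fraction_tendsto: "(\<lambda>k. (a + b * real k) / (c + real k)) \<longlonglongrightarrow> b"
proof -
  have lim: "filterlim (\<lambda>k. c + real k) at_top sequentially"
    by (intro filterlim_tendsto_add_at_top[OF tendsto_const] filterlim_real_sequentially)
  have "(\<lambda>k. b + (a - b * c) / (c + real k)) \<longlonglongrightarrow> b + 0"
    by (intro tendsto_add tendsto_const tendsto_divide_0[OF tendsto_const] filterlim_at_top_imp_at_infinity lim)
  moreover have "\<forall>\<^sub>F k in sequentially. c + real k > 0"
    using lim by (simp add: filterlim_at_top_dense)
  then have "\<forall>\<^sub>F k in sequentially. b + (a - b * c) / (c + real k) = (a + b * real k) / (c + real k)"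
    by eventually_elim (simp add: field_simps)
  ultimately show ?thesis by (simp add: Lim_transform_eventually)
qed

lemma gosper_sums:
  fixes f h G :: "nat \<Rightarrow> real"
  assumes "\<And>k. f k = R * h k + (G (Suc k) - G k)" "G \<longlonglongrightarrow> 0" "G 0 = 0" "h sums H"
  shows "f sums (R * H)"
proof -
  have "(\<lambda>k. R * h k + (G (Suc k) - G k)) sums (R * H + (0 - G 0))"
    by (intro sums_add sums_mult telescope_sums assms)
  moreover have "f = (\<lambda>k. R * h k + (G (Suc k) - G k))"
    using assms(1) by (intro ext)
  ultimately show ?thesis using assms(3) by simp
qed

lemma pochhammer_shift: "a * pochhammer (a + 1) k = pochhammer a k * (a + of_nat k)"
  for a :: "'a::comm_semiring_1"
  using pochhammer_rec[of a k] pochhammer_Suc[of a k] by simp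

lemma real_hyp_term_Suc:
  "(c + real k) * real (Suc k) * real_hyp_term a b c (Suc k) = - ((a + real k) * (b + real k) * real_hyp_term a b c k)"
  if "c \<notin> \<int>\<^sub>\<le>\<^sub>0"
proof -
  have nz: "pochhammer c k \<noteq> 0" "c + real k \<noteq> 0"
    using that pochhammer_eq_0_imp_nonpos_Int[of c "Suc k"] by (auto simp: pochhammer_Suc)
  have "u * n * (A * x * (B * y) / (C * u * (n * F)) * (- s)) = - (x * y * (A * B / (C * F) * s))"
    if "u \<noteq> 0" "n \<noteq> 0" "C \<noteq> 0" "F \<noteq> 0" for u n A x B y C F s :: real
    using that by (simp add: field_simps)
  from this[OF nz(2) _ nz(1), of "real (Suc k)" "fact k" "pochhammer a k" "a + real k" "pochhammer b k" "b + real k" "(-1) ^ k"]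
  show ?thesis
    by (simp add: real_hyp_term_def pochhammer_Suc del: of_nat_Suc)
qed

lemma divide_eqI:
  fixes x y z :: real
  shows "z * x = y \<Longrightarrow> z \<noteq> 0 \<Longrightarrow> x = y / z"
    and "y = x * z \<Longrightarrow> x \<noteq> 0 \<Longrightarrow> y \<noteq> 0 \<Longrightarrow> 1 / x = z / y"
  by (auto simp: field_simps)

text \<open>Raising the lower parameter by 3 reaches t + 3 = 1 + (3t + 2) - 2t, the case of Kummer's
  theorem. The bound t < -1/4 makes the excess -4t - 2 of the given series exceed -1.\<close>

lemma contiguous_kummer_iv:
  fixes t :: real
  assumes t: "-1/2 < t" "t < -1/4"
  shows "real_hyp_term (3 * t + 2) (2 * t) t sums
    ((t - 2) * (t + 1/2) / ((t + 1) * (t + 2)) * (Beta ((3 * t + 2) / 2) (1 - 2 * t) / (2 * Beta (3 * t + 2) (1 - 2 * t))))"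
proof -
  define f h where "f = real_hyp_term (3 * t + 2) (2 * t) t" and "h = real_hyp_term (3 * t + 2) (2 * t) (t + 3)"
  define D where "D = t * (t + 1) * (t + 2)"
  \<comment> \<open>a telescoping certificate found by Gosper's algorithm; it exists only on this line\<close>
  define G where "G = (\<lambda>k. - h k * (real k * (t + 2 + real k) * (2 * real k + 1)) / (4 * D))"
  have D: "D \<noteq> 0" using t by (simp add: D_def)
  have nz: "t \<notin> \<int>\<^sub>\<le>\<^sub>0" "t + 3 \<notin> \<int>\<^sub>\<le>\<^sub>0" using t by (intro not_nonpos_Ints; simp)+
  have tk: "t + real k \<noteq> 0" "t + 1 + real k \<noteq> 0" "t + 2 + real k \<noteq> 0" "t + 3 + real k \<noteq> 0" for k
    using t by (cases k; simp)+
  have f: "f k = h k * ((t + real k) * (t + 1 + real k) * (t + 2 + real k)) / D" for k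
  proof -
    have "D * pochhammer (t + 3) k = pochhammer t k * ((t + real k) * (t + 1 + real k) * (t + 2 + real k))"
      using pochhammer_shift[of t k] pochhammer_shift[of "t + 1" k] pochhammer_shift[of "t + 2" k]
      unfolding D_def by (simp add: add.assoc) algebra
    moreover have "pochhammer t k \<noteq> 0" "pochhammer (t + 3) k \<noteq> 0"
      using nz pochhammer_eq_0_imp_nonpos_Int by blast+
    ultimately have "1 / pochhammer t k = ((t + real k) * (t + 1 + real k) * (t + 2 + real k)) / (D * pochhammer (t + 3) k)"
      using D by (intro divide_eqI(2)) auto
    then show ?thesis
      unfolding f_def h_def real_hyp_term_def using D
      by (simp add: divide_inverse mult_ac)
  qed
  have step: "f k = (t - 2) * (t + 1/2) / ((t + 1) * (t + 2)) * h k + (G (Suc k) - G k)" for k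
  proof -
    have E: "(t + 3 + real k) * real (Suc k) * h (Suc k) = - ((3 * t + 2 + real k) * (2 * t + real k) * h k)"
      unfolding h_def by (rule real_hyp_term_Suc[OF nz(2)])
    have "G (Suc k) = - ((t + 3 + real k) * real (Suc k) * h (Suc k)) * (2 * real k + 3) / (4 * D)"
      unfolding G_def by (rule arg_cong[where f = "\<lambda>z. z / (4 * D)"]) (simp add: algebra_simps)
    then have G1: "G (Suc k) = h k * ((3 * t + 2 + real k) * (2 * t + real k) * (2 * real k + 3)) / (4 * D)"
      unfolding E by simp
    have R: "(t - 2) * (t + 1/2) / ((t + 1) * (t + 2)) = t * (t - 2) * (4 * t + 2) / (4 * D)"
    proof -
      have "x / E = (t * (4 * x)) / (4 * (t * E))" for x E using t by simp
      moreover have "t * (4 * ((t - 2) * (t + 1/2))) = t * (t - 2) * (4 * t + 2)" by (simp add: field_simps)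
      ultimately show ?thesis unfolding D_def by (metis mult.assoc)
    qed
    have combine: "h k * X / (4 * D) = Y / (4 * D) * h k + (h k * Z / (4 * D) - - h k * W / (4 * D))"
      if "X = Y + (Z + W)" for X Y Z W
      unfolding that by (simp add: add_divide_distrib distrib_left)
    have "f k = h k * (4 * ((t + real k) * (t + 1 + real k) * (t + 2 + real k))) / (4 * D)"
      unfolding f by simp
    then show ?thesis
      unfolding G1 R unfolding G_def
      by (simp only:) (rule combine, simp add: algebra_simps)
  qed
  have "f \<longlonglongrightarrow> 0" unfolding f_def using t nz by (intro real_hyp_term_tendsto_0) auto
  \<comment> \<open>\<open>f\<close> and \<open>G\<close> are both cubic polynomials in k times
    \<open>h\<close>, so \<open>G\<close> is \<open>f\<close> times a convergent factor and inherits
    the limit zero.\<close>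
  then have "(\<lambda>k. f k * (- (1/4) * (((0 + 1 * real k) / (t + real k)) * ((1 + 2 * real k) / (t + 1 + real k))))) \<longlonglongrightarrow> 0 * (- (1/4) * (1 * 2))"
    by (intro tendsto_mult tendsto_const linear_fraction_tendsto)
  moreover have "f k * (- (1/4) * (((0 + 1 * real k) / (t + real k)) * ((1 + 2 * real k) / (t + 1 + real k)))) = G k" for k
  proof -
    have "H * (p * q * r) / D * (- (1/4) * (((0 + 1 * n) / p) * ((1 + 2 * n) / q))) = - H * (n * r * (2 * n + 1)) / (4 * D)"
      if "p \<noteq> 0" "q \<noteq> 0" for H p q r n
      using that D by (simp add: field_simps)
    from this[OF tk(1,2)[of k]] show ?thesis unfolding f G_def .
  qed
  ultimately have lim: "G \<longlonglongrightarrow> 0" by simp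
  have h_sums: "h sums (Beta ((3 * t + 2) / 2) (1 - 2 * t) / (2 * Beta (3 * t + 2) (1 - 2 * t)))"
    using kummer_sums[of "3 * t + 2" "2 * t"] t unfolding h_def by (simp add: algebra_simps)
  show ?thesis
    unfolding f_def[symmetric] by (rule gosper_sums[where h = h and G = G, OF _ lim _ h_sums], rule step) (simp add: G_def)
qed

text \<open>The Kummer series \<open>h\<close> has lower parameter t + 2 = 1 + (3t - 2) - (2t - 3).
  Here both upper parameters change, in opposite directions, so \<open>e\<close> combines the
  smaller upper parameters with the larger lower one; \<open>f\<close> and \<open>h\<close> are then
  polynomial multiples of \<open>e\<close>.\<close>

lemma contiguous_kummer_i:
  fixes t :: real
  assumes t: "1 < t" "t < 4/3"
  shows "real_hyp_term (3 * t - 4) (2 * t - 1) (t + 1) sums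
    (3 * (4 - t) / (4 * (t + 1)) * (Beta ((3 * t - 2) / 2) (4 - 2 * t) / (2 * Beta (3 * t - 2) (4 - 2 * t))))"
proof -
  define f h e where "f = real_hyp_term (3 * t - 4) (2 * t - 1) (t + 1)"
    and "h = real_hyp_term (3 * t - 2) (2 * t - 3) (t + 2)"
    and "e = real_hyp_term (3 * t - 4) (2 * t - 3) (t + 2)"
  define D where "D = (2 * t - 3) * (2 * t - 2) * (t + 1)"
  define Q where "Q = 7 * t * t - 18 * t + 12"
  \<comment> \<open>The telescoping certificate, now expressed through \<open>e\<close>. The factors
    k and t + 1 + k make its shift computable from the ratio of consecutive terms of
    \<open>e\<close> and give \<open>G 0 = 0\<close>.\<close>
  define G where "G = (\<lambda>k. - e k * (real k * (t + 1 + real k) * (Q + (3 * t - 4) * real k)) / (2 * D * (3 * t - 4)))"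
  have D: "D \<noteq> 0" "3 * t - 4 \<noteq> 0" "3 * t - 3 \<noteq> 0" "2 * t - 3 \<noteq> 0" "2 * t - 2 \<noteq> 0" "t + 1 \<noteq> 0" using t by (auto simp: D_def)
  have nz: "t + 1 \<notin> \<int>\<^sub>\<le>\<^sub>0" "t + 2 \<notin> \<int>\<^sub>\<le>\<^sub>0" using t by (intro not_nonpos_Ints; simp)+
  have tk: "2 * t - 3 + real k \<noteq> 0" "2 * t - 2 + real k \<noteq> 0" "t + 1 + real k \<noteq> 0" for k
    using t by (cases k; simp)+
  have f: "f k = e k * ((2 * t - 3 + real k) * (2 * t - 2 + real k) * (t + 1 + real k)) / D" for k
  proof -
    have num: "(2 * t - 3) * (2 * t - 2) * pochhammer (2 * t - 1) k = pochhammer (2 * t - 3) k * ((2 * t - 3 + real k) * (2 * t - 2 + real k))"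
      using pochhammer_shift[of "2 * t - 3" k] pochhammer_shift[of "2 * t - 2" k]
      by simp algebra
    have den: "(t + 1) * pochhammer (t + 2) k = pochhammer (t + 1) k * (t + 1 + real k)"
      using pochhammer_shift[of "t + 1" k] by (simp add: add.assoc)
    have "pochhammer (t + 1) k \<noteq> 0" "pochhammer (t + 2) k \<noteq> 0"
      using nz pochhammer_eq_0_imp_nonpos_Int by blast+
    then have "1 / pochhammer (t + 1) k = (t + 1 + real k) / ((t + 1) * pochhammer (t + 2) k)"
      using den D by (intro divide_eqI(2)) auto
    moreover have "pochhammer (2 * t - 1) k = pochhammer (2 * t - 3) k * ((2 * t - 3 + real k) * (2 * t - 2 + real k)) / ((2 * t - 3) * (2 * t - 2))"
      using num D by (intro divide_eqI(1)) auto
    ultimately show ?thesis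
      unfolding f_def e_def real_hyp_term_def D_def
      by (simp add: divide_inverse mult_ac)
  qed
  have h: "h k = e k * ((3 * t - 4 + real k) * (3 * t - 3 + real k)) / ((3 * t - 4) * (3 * t - 3))" for k
  proof -
    have num: "(3 * t - 4) * (3 * t - 3) * pochhammer (3 * t - 2) k = pochhammer (3 * t - 4) k * ((3 * t - 4 + real k) * (3 * t - 3 + real k))"
      using pochhammer_shift[of "3 * t - 4" k] pochhammer_shift[of "3 * t - 3" k]
      by simp algebra
    then have "pochhammer (3 * t - 2) k = pochhammer (3 * t - 4) k * ((3 * t - 4 + real k) * (3 * t - 3 + real k)) / ((3 * t - 4) * (3 * t - 3))"
      using D by (intro divide_eqI(1)) auto
    then show ?thesis
      unfolding h_def e_def real_hyp_term_def by (simp add: divide_inverse mult_ac)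
  qed
  have step: "f k = 3 * (4 - t) / (4 * (t + 1)) * h k + (G (Suc k) - G k)" for k
  proof -
    define M where "M = 2 * D * (3 * t - 4)"
    have M: "M \<noteq> 0" using D by (simp add: M_def)
    have E: "(t + 2 + real k) * real (Suc k) * e (Suc k) = - ((3 * t - 4 + real k) * (2 * t - 3 + real k) * e k)"
      unfolding e_def by (rule real_hyp_term_Suc[OF nz(2)])
    have "G (Suc k) = - ((t + 2 + real k) * real (Suc k) * e (Suc k)) * (Q + (3 * t - 4) * (real k + 1)) / M"
      unfolding G_def M_def by (rule arg_cong[where f = "\<lambda>z. z / (2 * D * (3 * t - 4))"]) (simp add: algebra_simps)
    then have G1: "G (Suc k) = e k * ((3 * t - 4 + real k) * (2 * t - 3 + real k) * (Q + (3 * t - 4) * (real k + 1))) / M"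
      unfolding E by simp
    have R: "3 * (4 - t) / (4 * (t + 1)) * h k = e k * ((4 - t) * (2 * t - 3) * ((3 * t - 4 + real k) * (3 * t - 3 + real k))) / M"
    proof -
      have "3 * x / (4 * y) * (H * X / (a * (3 * c))) = H * (x * b * X) / (2 * (b * (2 * c) * y) * a)"
        if "b \<noteq> 0" for x y H X a b c :: real
        using that by (simp add: field_simps)
      moreover have "3 * t - 3 = 3 * (t - 1)" "2 * t - 2 = 2 * (t - 1)" by simp_all
      ultimately show ?thesis unfolding h M_def D_def using D(4) by metis
    qed
    have combine: "e k * X / M = e k * Y / M + (e k * Z / M - - e k * W / M)"
      if "X = Y + (Z + W)" for X Y Z W
      unfolding that by (simp add: add_divide_distrib distrib_left)
    have "f k = e k * (2 * (3 * t - 4) * ((2 * t - 3 + real k) * (2 * t - 2 + real k) * (t + 1 + real k))) / M"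
    proof -
      have "E * X / D = E * (2 * a * X) / (2 * D * a)" if "a \<noteq> 0" for E X a
        using that by simp
      from this[OF D(2)] show ?thesis unfolding f M_def .
    qed
    then show ?thesis
      unfolding G1 R unfolding G_def M_def[symmetric]
      by (simp only:) (rule combine, simp add: Q_def algebra_simps)
  qed
  have "f \<longlonglongrightarrow> 0" unfolding f_def using t nz by (intro real_hyp_term_tendsto_0) auto
  then have "(\<lambda>k. f k * (- (1 / (2 * (3 * t - 4))) * (((0 + 1 * real k) / (2 * t - 3 + real k)) * ((Q + (3 * t - 4) * real k) / (2 * t - 2 + real k)))))
      \<longlonglongrightarrow> 0 * (- (1 / (2 * (3 * t - 4))) * (1 * (3 * t - 4)))"
    by (intro tendsto_mult tendsto_const linear_fraction_tendsto)
  moreover have "f k * (- (1 / (2 * (3 * t - 4))) * (((0 + 1 * real k) / (2 * t - 3 + real k)) * ((Q + (3 * t - 4) * real k) / (2 * t - 2 + real k)))) = G k" for k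
  proof -
    have "H * (p * q * r) / D * (- (1 / (2 * a)) * (((0 + 1 * n) / p) * (X / q))) = - H * (n * r * X) / (2 * D * a)"
      if "p \<noteq> 0" "q \<noteq> 0" "a \<noteq> 0" for H p q r n X a
      using that D(1) by (simp add: field_simps)
    from this[OF tk(1,2)[of k] D(2)] show ?thesis unfolding f G_def .
  qed
  ultimately have lim: "G \<longlonglongrightarrow> 0" by simp
  have h_sums: "h sums (Beta ((3 * t - 2) / 2) (4 - 2 * t) / (2 * Beta (3 * t - 2) (4 - 2 * t)))"
    using kummer_sums[of "3 * t - 2" "2 * t - 3"] t unfolding h_def by (simp add: algebra_simps)
  show ?thesis
    unfolding f_def[symmetric] by (rule gosper_sums[where h = h and G = G, OF _ lim _ h_sums], rule step) (simp add: G_def)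
qed

section \<open>Lines (ii) and (iii) from the trigonometric integrals\<close>

lemma sin4_integral_cong:
  assumes "\<And>u. u \<in> {0<..<pi/4} \<Longrightarrow> g u = h u"
  shows "sin4_integral g p = sin4_integral h p"
  unfolding sin4_integral_def
  by (rule Henstock_Kurzweil_Integration.integral_cong) (simp only: assms)

lemma tan_pos_quarter: "tan u > 0" if "u \<in> {0<..<pi/4}" for u
  using that by (auto intro!: tan_gt_zero)

text \<open>Reflection at 3/8 and at 1/8 converts the concentration constants cos(pi/8) and
  sin(pi/8) into gamma values.\<close>

lemma Gamma_eighths:
  "Gamma (3/8) * Gamma (5/8) = pi / cos (pi/8)"
  "Gamma (7/8) * Gamma (9/8) = pi / (8 * sin (pi/8))" for dummy :: real
proof -
  have "sin (pi * (3/8)) = cos (pi/8)"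
    using sin_cos_eq[of "pi * (3/8)"] by (simp add: field_simps)
  then show "Gamma (3/8) * Gamma (5/8) = pi / cos (pi/8)"
    using Gamma_reflection_real[of "3/8"] by simp
  have "Gamma (9/8) = 1/8 * Gamma (1/8 :: real)"
    using Gamma_Suc_real[of "1/8"] by simp
  then have "Gamma (7/8) * Gamma (9/8) = 1/8 * (Gamma (1/8) * Gamma (1 - 1/8 :: real))"
    by simp
  then show "Gamma (7/8) * Gamma (9/8) = pi / (8 * sin (pi/8))"
    unfolding Gamma_reflection_real by simp
qed

text \<open>\<open>c\<close> stands for the value at pi/8 of the trigonometric factor. The bound t <
  1/8 makes 4t - 1/2 negative, as Euler's integral requires. Duplication at t and at 2t removes all
  powers of 2, which are expressed through \<open>w\<close>.\<close>

lemma sums_from_sin4_integral: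
  fixes t e :: real
  assumes t: "0 < t" "t < 1/8" and "e \<ge> 0" and "c > 0"
    and g: "sin4_integral (\<lambda>u. cos u * tan u powr (2 * e)) (2 * t) =
      c * (2 powr (2 * t - 3) * Beta (2 * t / 2) (2 * t / 2)) *
      ((Gamma ((2 * t + 1) / 2))\<^sup>2 / (Gamma ((2 * t + 1) / 2 - 1/8) * Gamma ((2 * t + 1) / 2 + 1/8)))"
  shows "real_hyp_term (4 * t - 1/2) (t + e) (3 * t + e) sums
    (c * Gamma t * Gamma (t + 1/2) * Gamma (2 * t + 1/2) * Gamma (3 * t + e) /
      (Gamma (t + e) * Gamma (4 * t) * Gamma (t + 3/8) * Gamma (t + 5/8)))"
proof -
  define f where "f = (\<lambda>x. x powr (t + e - 1) * (1 - x) powr (2 * t - 1) * (1 + x) powr - (4 * t - 1/2))"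
  have c1: "3 * t + e - (t + e) = 2 * t" by simp
  have f: "f absolutely_integrable_on {0<..<1}"
    and sums: "real_hyp_term (4 * t - 1/2) (t + e) (3 * t + e) sums (integral {0<..<1} f / Beta (t + e) (2 * t))"
    using euler_integral[of "t + e" "3 * t + e" "4 * t - 1/2"] assms unfolding c1 f_def by auto
  define w where "w = 2 powr (2 * t)"
  have w: "w > 0" by (simp add: w_def)
  have powers: "4 powr (1 - 2 * t) = 4 / w\<^sup>2" "2 powr (2 * t - 3) = w / 8"
    "2 powr (1 - 2 * t) = 2 / w" "2 powr (1 - 2 * (2 * t)) = 2 / w\<^sup>2"
  proof -
    have "4 powr (2 * t) = w\<^sup>2" unfolding w_def power2_eq_square powr_mult[symmetric] by simp
    then show "4 powr (1 - 2 * t) = 4 / w\<^sup>2" by (simp add: powr_diff)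
    have "2 powr (2 * (2 * t)) = w\<^sup>2" unfolding w_def power2_eq_square powr_add[symmetric] by simp
    then show "2 powr (1 - 2 * (2 * t)) = 2 / w\<^sup>2" unfolding powr_diff by simp
  qed (simp_all add: w_def powr_diff)
  define g1 g2 g4 h1 h2 A B s where "g1 = Gamma t" and "g2 = Gamma (2 * t)" and "g4 = Gamma (4 * t)"
    and "h1 = Gamma (t + 1/2)" and "h2 = Gamma (2 * t + 1/2)" and "A = Gamma (t + 3/8)" and "B = Gamma (t + 5/8)"
    and "s = sqrt pi"
  have pos: "g1 > 0" "g2 > 0" "g4 > 0" "h1 > 0" "h2 > 0" "A > 0" "B > 0" "s > 0" "Gamma (t + e) > 0" "Gamma (3 * t + e) > 0"
    using t assms(3) by (auto simp: g1_def g2_def g4_def h1_def h2_def A_def B_def s_def)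
  have dup1: "g1 * h1 = 2 / w * s * g2"
    using Gamma_duplication_real[of t] t by (simp add: powers g1_def h1_def s_def g2_def)
  have dup2: "g2 * h2 = 2 / w\<^sup>2 * s * g4"
    using Gamma_duplication_real[of "2 * t"] t unfolding powers by (simp add: g2_def h2_def s_def g4_def)
  have y: "(2 * t + 1) / 2 = t + 1/2" "t + 1/2 - 1/8 = t + 3/8" "t + 1/2 + 1/8 = t + 5/8" "2 * t / 2 = t"
    by (simp_all add: field_simps)
  have "integral {0<..<1} f / Beta (t + e) (2 * t) =
      2 * (4 / w\<^sup>2) * (c * (w / 8 * (g1 * g1 / g2)) * (h1\<^sup>2 / (A * B))) / (Gamma (t + e) * g2 / Gamma (3 * t + e))"
  proof -
    have "t + t = 2 * t" "t + e + 2 * t = 3 * t + e" by simp_all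
    then show ?thesis
      unfolding tan_sq_substitution[OF t(1) f[unfolded f_def], folded f_def] g y powers
      by (simp add: Beta_def g1_def g2_def h1_def A_def B_def)
  qed
  also have "\<dots> = (c * Gamma (3 * t + e) * h1 / (A * B * Gamma (t + e))) * (g1 * (g1 * h1) / (w * g2 * g2))"
    using pos w by (simp add: field_simps power2_eq_square)
  also have "g1 * (g1 * h1) / (w * g2 * g2) = g1 * (h2 / g4)"
  proof -
    have "(g1 * h1) * (g2 * w\<^sup>2) = (2 / w * s * g2) * (g2 * w\<^sup>2)" by (simp only: dup1)
    moreover have "h2 = 2 / w\<^sup>2 * s * g4 / g2" using dup2 pos by (intro divide_eqI(1)) auto
    ultimately show ?thesis unfolding dup1 using pos w by (simp add: field_simps power2_eq_square)
  qed
  finally have "integral {0<..<1} f / Beta (t + e) (2 * t) =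
     c * g1 * h1 * h2 * Gamma (3 * t + e) / (Gamma (t + e) * g4 * A * B)"
    by (simp add: mult_ac)
  then show ?thesis
    using sums by (simp only: g1_def h1_def h2_def g4_def A_def B_def)
qed

text \<open>The case e = 0, with line parameter a = 4t.\<close>

lemma sums_iii:
  fixes t :: real
  assumes t: "0 < t" "t < 1/8"
  shows "real_hyp_term (4 * t - 1/2) t (3 * t) sums
    (Gamma (1/2) * Gamma (1/2) * Gamma (t + 1/2) * Gamma (2 * t + 1/2) * Gamma (3 * t) /
      (Gamma (3/8) * Gamma (5/8) * Gamma (4 * t) * Gamma (t + 3/8) * Gamma (t + 5/8)))"
proof -
  have "cos (pi/8) > 0" by (intro cos_gt_zero) auto
  moreover have "sin4_integral (\<lambda>u. cos u * tan u powr (2 * 0)) (2 * t) =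
      cos (pi/8) * (2 powr (2 * t - 3) * Beta (2 * t / 2) (2 * t / 2)) *
      ((Gamma ((2 * t + 1) / 2))\<^sup>2 / (Gamma ((2 * t + 1) / 2 - 1/8) * Gamma ((2 * t + 1) / 2 + 1/8)))"
  proof -
    have "sin4_integral (\<lambda>u. cos u * tan u powr (2 * 0)) (2 * t) = sin4_integral cos (2 * t)"
      by (rule sin4_integral_cong) (use tan_pos_quarter in force)
    also have "\<dots> = cos (pi/8) * (2 powr (2 * t - 3) * Beta (2 * t / 2) (2 * t / 2)) *
      ((Gamma ((2 * t + 1) / 2))\<^sup>2 / (Gamma ((2 * t + 1) / 2 - 1/8) * Gamma ((2 * t + 1) / 2 + 1/8)))"
      using t by (intro sin4_integral_eq[where g' = "\<lambda>u. - sin u"] trig_oscillation) (auto intro!: derivative_eq_intros)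
    finally show ?thesis .
  qed
  ultimately have "real_hyp_term (4 * t - 1/2) (t + 0) (3 * t + 0) sums
    (cos (pi/8) * Gamma t * Gamma (t + 1/2) * Gamma (2 * t + 1/2) * Gamma (3 * t + 0) /
      (Gamma (t + 0) * Gamma (4 * t) * Gamma (t + 3/8) * Gamma (t + 5/8)))"
    using t by (intro sums_from_sin4_integral) auto
  also have "cos (pi/8) * Gamma t * Gamma (t + 1/2) * Gamma (2 * t + 1/2) * Gamma (3 * t + 0) /
      (Gamma (t + 0) * Gamma (4 * t) * Gamma (t + 3/8) * Gamma (t + 5/8)) =
     Gamma (1/2) * Gamma (1/2) * Gamma (t + 1/2) * Gamma (2 * t + 1/2) * Gamma (3 * t) /
      (Gamma (3/8) * Gamma (5/8) * Gamma (4 * t) * Gamma (t + 3/8) * Gamma (t + 5/8))"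
  proof -
    have "Gamma t > 0" using t by simp
    moreover have "Gamma (1/2) * Gamma (1/2) = (pi :: real)" by (simp add: Gamma_one_half_real)
    ultimately show ?thesis
      unfolding Gamma_eighths(1) by simp
  qed
  finally show ?thesis by simp
qed

text \<open>The case e = 1/2, with line parameter a = 4t + 1. The shifted values
  \<open>Gamma (t + 1)\<close> and \<open>Gamma (4 * t + 1)\<close> and the constants account for
  the factors t, 4t and sin(pi/8).\<close>

lemma sums_ii:
  fixes t :: real
  assumes t: "0 < t" "t < 1/8"
  shows "real_hyp_term (4 * t - 1/2) (t + 1/2) (3 * t + 1/2) sums
    (Gamma (1/2) * Gamma (3/2) * Gamma (t + 1) * Gamma (2 * t + 1/2) * Gamma (3 * t + 1/2) /
      (Gamma (7/8) * Gamma (9/8) * Gamma (4 * t + 1) * Gamma (t + 3/8) * Gamma (t + 5/8)))"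
proof -
  have s0: "sin (pi/8) > 0" by (intro sin_gt_zero) auto
  moreover have "sin4_integral (\<lambda>u. cos u * tan u powr (2 * (1/2))) (2 * t) =
      sin (pi/8) * (2 powr (2 * t - 3) * Beta (2 * t / 2) (2 * t / 2)) *
      ((Gamma ((2 * t + 1) / 2))\<^sup>2 / (Gamma ((2 * t + 1) / 2 - 1/8) * Gamma ((2 * t + 1) / 2 + 1/8)))"
  proof -
    have "sin4_integral (\<lambda>u. cos u * tan u powr (2 * (1/2))) (2 * t) = sin4_integral sin (2 * t)"
    proof (rule sin4_integral_cong)
      fix u assume u: "u \<in> {0<..<pi/4}"
      then have "cos u > 0" by (auto intro!: cos_gt_zero)
      moreover have "tan u powr (2 * (1/2)) = tan u" using tan_pos_quarter[OF u] by simp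
      ultimately show "cos u * tan u powr (2 * (1/2)) = sin u" by (simp add: tan_def)
    qed
    also have "\<dots> = sin (pi/8) * (2 powr (2 * t - 3) * Beta (2 * t / 2) (2 * t / 2)) *
      ((Gamma ((2 * t + 1) / 2))\<^sup>2 / (Gamma ((2 * t + 1) / 2 - 1/8) * Gamma ((2 * t + 1) / 2 + 1/8)))"
      using t by (intro sin4_integral_eq[where g' = cos] trig_oscillation) (auto intro!: derivative_eq_intros)
    finally show ?thesis .
  qed
  ultimately have "real_hyp_term (4 * t - 1/2) (t + 1/2) (3 * t + 1/2) sums
    (sin (pi/8) * Gamma t * Gamma (t + 1/2) * Gamma (2 * t + 1/2) * Gamma (3 * t + 1/2) /
      (Gamma (t + 1/2) * Gamma (4 * t) * Gamma (t + 3/8) * Gamma (t + 5/8)))"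
    using t by (intro sums_from_sin4_integral) auto
  also have "sin (pi/8) * Gamma t * Gamma (t + 1/2) * Gamma (2 * t + 1/2) * Gamma (3 * t + 1/2) /
      (Gamma (t + 1/2) * Gamma (4 * t) * Gamma (t + 3/8) * Gamma (t + 5/8)) =
     Gamma (1/2) * Gamma (3/2) * Gamma (t + 1) * Gamma (2 * t + 1/2) * Gamma (3 * t + 1/2) /
      (Gamma (7/8) * Gamma (9/8) * Gamma (4 * t + 1) * Gamma (t + 3/8) * Gamma (t + 5/8))"
  proof -
    have pos: "Gamma (t + 1/2) > 0" "Gamma (4 * t) > 0" "Gamma (t + 3/8) > 0" "Gamma (t + 5/8) > 0" using t by auto
    have "Gamma (3/2) = 1/2 * Gamma (1/2 :: real)" using Gamma_Suc_real[of "1/2"] by simp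
    then have "Gamma (1/2) * Gamma (3/2) = 1/2 * (Gamma (1/2) * Gamma (1/2 :: real))" by simp
    also have "Gamma (1/2) * Gamma (1/2) = (pi :: real)" by (simp add: Gamma_one_half_real)
    finally have half: "Gamma (1/2) * Gamma (3/2) = (pi / 2 :: real)" by simp
    have shift: "Gamma (t + 1) = t * Gamma t" "Gamma (4 * t + 1) = 4 * t * Gamma (4 * t)"
      using t by (auto intro!: Gamma_Suc_real)
    have "S * G * h1 * h2 * g3 / (h1 * g4 * A * B) = pi / 2 * (t * G) * h2 * g3 / (pi / (8 * S) * (4 * t * g4) * A * B)"
      if "S > 0" "h1 > 0" "g4 > 0" "A > 0" "B > 0" for S G h1 h2 g3 g4 A B :: real
      using that t by (simp add: field_simps)
    from this[OF s0 pos] show ?thesis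
      unfolding Gamma_eighths(2) half shift .
  qed
  finally show ?thesis .
qed

section \<open>Gamma quotients for lines (iv) and (i)\<close>

text \<open>Duplication at 2t + 3/2, t/2 + 1/2 and 3t/2 + 1 matches the quotient of Beta values with
  the stated product. \<open>Gamma (1 - 2 * t)\<close> cancels between the two Beta values.\<close>

lemma sums_iv:
  fixes t :: real
  assumes t: "-1/2 < t" "t < -1/4"
  shows "real_hyp_term (3 * t + 2) (2 * t) t sums
    (Gamma (1/2) * Gamma t * Gamma (t + 1) * Gamma (2 * t + 3/2) * Gamma (2 * t + 2) /
      (Gamma (3 * t / 2 + 3/2) * Gamma (t / 2 + 1/2) * Gamma (t / 2 + 1) * Gamma (- t / 2) * Gamma (4 * t + 2)))"
proof -
  define w where "w = 2 powr - t"
  have w: "w > 0" by (simp add: w_def)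
  have powers: "2 powr (1 - 2 * (2 * t + 3/2)) = w ^ 4 / 4" "2 powr (1 - 2 * (t / 2 + 1/2)) = w"
    "2 powr (1 - 2 * (3 * t / 2 + 1)) = w ^ 3 / 2"
  proof -
    have "2 powr (1 - 2 * (2 * t + 3/2)) = 2 powr (- t * 4 - 2)" by (rule arg_cong[where f = "\<lambda>x. 2 powr x"]) (simp add: field_simps)
    also have "\<dots> = (2 powr - t) powr 4 / 2 powr 2" by (simp add: powr_diff powr_powr)
    finally show "2 powr (1 - 2 * (2 * t + 3/2)) = w ^ 4 / 4" using w by (simp add: w_def[symmetric] powr_numeral)
    show "2 powr (1 - 2 * (t / 2 + 1/2)) = w" by (simp add: w_def algebra_simps)
    have "2 powr (1 - 2 * (3 * t / 2 + 1)) = 2 powr (- t * 3 - 1)" by (rule arg_cong[where f = "\<lambda>x. 2 powr x"]) (simp add: field_simps)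
    also have "\<dots> = (2 powr - t) powr 3 / 2 powr 1" by (simp add: powr_diff powr_powr)
    finally show "2 powr (1 - 2 * (3 * t / 2 + 1)) = w ^ 3 / 2" using w by (simp add: w_def[symmetric] powr_numeral)
  qed
  define x1 x2 x3 x4 x5 x6 x7 x8 x9 x10 x11 s
    where "x1 = Gamma (2 * t + 3/2)" and "x2 = Gamma (2 * t + 2)" and "x3 = Gamma (3 * t / 2 + 3/2)"
    and "x4 = Gamma (t / 2 + 1/2)" and "x5 = Gamma (t / 2 + 1)" and "x6 = Gamma (- t / 2)" and "x7 = Gamma (4 * t + 2)"
    and "x8 = Gamma t" and "x9 = Gamma (t + 1)" and "x10 = Gamma (3 * t / 2 + 1)" and "x11 = Gamma (3 * t + 2)" and "s = sqrt pi"
  have pos: "x3 > 0" "x4 > 0" "x5 > 0" "x6 > 0" "x9 > 0" "x10 > 0" "x11 > 0" "s > 0"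
    using t by (auto simp: x3_def x4_def x5_def x6_def x9_def x10_def x11_def s_def)
  have x7: "x7 \<noteq> 0" using t unfolding x7_def Gamma_eq_zero_iff by (intro not_nonpos_Ints) auto
  have d1: "x1 * x2 = w ^ 4 / 4 * s * ((4 * t + 2) * x7)"
  proof -
    have "Gamma (4 * t + 2 + 1) = (4 * t + 2) * Gamma (4 * t + 2)"
      using t by (intro Gamma_Suc_real) auto
    moreover have "2 * (2 * t + 3/2) = 4 * t + 2 + 1" "2 * t + 3/2 + 1/2 = 2 * t + 2" by simp_all
    ultimately show ?thesis
      using Gamma_duplication_real[of "2 * t + 3/2"] t unfolding powers by (simp only: x1_def x2_def x7_def s_def)
  qed
  have d2: "x4 * x5 = w * s * x9"
  proof -
    have "2 * (t / 2 + 1/2) = t + 1" "t / 2 + 1/2 + 1/2 = t / 2 + 1" by simp_all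
    then show ?thesis
      using Gamma_duplication_real[of "t / 2 + 1/2"] t unfolding powers by (simp only: x4_def x5_def x9_def s_def)
  qed
  have d3: "x10 * x3 = w ^ 3 / 2 * s * x11"
  proof -
    have "2 * (3 * t / 2 + 1) = 3 * t + 2" "3 * t / 2 + 1 + 1/2 = 3 * t / 2 + 3/2" by simp_all
    then show ?thesis
      using Gamma_duplication_real[of "3 * t / 2 + 1"] t unfolding powers by (simp only: x10_def x3_def x11_def s_def)
  qed
  have "(t - 2) * (t + 1/2) / ((t + 1) * (t + 2)) * (Beta ((3 * t + 2) / 2) (1 - 2 * t) / (2 * Beta (3 * t + 2) (1 - 2 * t)))
     = (1 + 2 * t) * x8 * x10 / (x6 * x11)"
  proof -
    have e: "(3 * t + 2) / 2 = 3 * t / 2 + 1" "3 * t / 2 + 1 + (1 - 2 * t) = - t / 2 + 1 + 1" "3 * t + 2 + (1 - 2 * t) = t + 1 + 1 + 1"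
      by (simp_all add: field_simps)
    have g1: "Gamma (- t / 2 + 1 + 1) = (- t / 2 + 1) * (- t / 2 * x6)"
      using t Gamma_Suc_real[of "- t / 2 + 1"] Gamma_Suc_real[of "- t / 2"] by (simp add: x6_def)
    have g2: "Gamma (t + 1 + 1 + 1) = (t + 2) * ((t + 1) * (t * x8))"
      using t Gamma_Suc_real[of "t + 1 + 1"] Gamma_Suc_real[of "t + 1"] Gamma_Suc_real[of t] by (simp add: x8_def)
    \<comment> \<open>The cancellation is proved for abstract atoms. Its first premise becomes (t -
      2)(t + 1/2) t = (1 + 2t) 2 p q with p = 1 - t/2 and q = -t/2, the factors produced by shifting
      the gammas.\<close>
    have reduce: "K / (u * v) * (X * b / (p * (q * Z)) / (2 * (Y * b / (v * (u * (t * V)))))) = m * V * X / (Z * Y)"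
      if "K * t = m * (2 * p * q)" "u \<noteq> 0" "v \<noteq> 0" "b \<noteq> 0" "p \<noteq> 0" "q \<noteq> 0" "Z \<noteq> 0" "Y \<noteq> 0"
      for K u v b p q X Y Z V m :: real
    proof -
      have "K / (u * v) * (X * b / (p * (q * Z)) / (2 * (Y * b / (v * (u * (t * V)))))) = (K * t) * (V * X) / ((2 * p * q) * (Z * Y))"
        using that(2-) by (simp add: field_simps)
      then show ?thesis unfolding that(1) using that(2-) by (simp add: field_simps)
    qed
    have "Gamma (1 - 2 * t) \<noteq> 0" using t by (intro less_imp_neq[OF Gamma_real_pos, symmetric]) simp
    then show ?thesis
      unfolding Beta_def e g1 g2 x10_def[symmetric] x11_def[symmetric]
      using pos t by (intro reduce) (simp_all add: field_simps)
  qed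
  also have "(1 + 2 * t) * x8 * x10 / (x6 * x11) = s * x8 * x9 * x1 * x2 / (x3 * x4 * x5 * x6 * x7)"
  proof -
    have "s * x8 * x9 * x1 * x2 / (x3 * x4 * x5 * x6 * x7) = s * x8 * x9 * (x1 * x2) / (x3 * (x4 * x5) * x6 * x7)"
      by (simp add: mult_ac)
    also have "\<dots> = s * x8 * (w ^ 3 / 4 * (4 * t + 2)) / (x3 * x6)"
      unfolding d1 d2 using pos w x7 by (simp add: field_simps eval_nat_numeral)
    also have "\<dots> = s * x8 * (w ^ 3 / 4 * (4 * t + 2)) / (w ^ 3 / 2 * s * x11 / x10 * x6)"
    proof -
      have "x3 = w ^ 3 / 2 * s * x11 / x10"
        using d3 pos by (intro divide_eqI(1)) auto
      then show ?thesis by (simp only:)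
    qed
    also have "s * x8 * (w ^ 3 / 4 * (4 * t + 2)) / (w ^ 3 / 2 * s * x11 / x10 * x6) = (1 + 2 * t) * x8 * x10 / (x6 * x11)"
      using pos w by (simp add: field_simps)
    finally show ?thesis by simp
  qed
  finally show ?thesis
    using contiguous_kummer_iv[OF t]
    by (simp only: x1_def x2_def x3_def x4_def x5_def x6_def x7_def x8_def x9_def s_def Gamma_one_half_real)
qed

text \<open>Same pattern as on line (iv), with duplication at 2t - 2, t/2 and 3t/2 - 3/2. The
  factors t - 1 left by the shifts at 4t - 4 and 3t - 3 cancel.\<close>

lemma sums_i:
  fixes t :: real
  assumes t: "1 < t" "t < 4/3"
  shows "real_hyp_term (3 * t - 4) (2 * t - 1) (t + 1) sums
    (Gamma (1/2) * Gamma t * Gamma (t + 1) * Gamma (2 * t - 3/2) * Gamma (2 * t - 2) /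
      (Gamma (3 * t / 2 - 3/2) * Gamma (t / 2) * Gamma (t / 2 + 1/2) * Gamma (2 - t / 2) * Gamma (4 * t - 3)))"
proof -
  define w where "w = 2 powr - t"
  have w: "w > 0" by (simp add: w_def)
  have powers: "2 powr (1 - 2 * (2 * t - 2)) = w ^ 4 * 32" "2 powr (1 - 2 * (t / 2)) = w * 2"
    "2 powr (1 - 2 * (3 * t / 2 - 3/2)) = w ^ 3 * 16"
  proof -
    have "2 powr (1 - 2 * (2 * t - 2)) = 2 powr (- t * 4 + 5)" by (rule arg_cong[where f = "\<lambda>x. 2 powr x"]) (simp add: field_simps)
    also have "\<dots> = (2 powr - t) powr 4 * 2 powr 5" by (simp only: powr_add powr_powr)
    finally show "2 powr (1 - 2 * (2 * t - 2)) = w ^ 4 * 32" using w by (simp add: w_def[symmetric] powr_numeral)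
    have "2 powr (1 - 2 * (t / 2)) = 2 powr (- t + 1)" by (rule arg_cong[where f = "\<lambda>x. 2 powr x"]) (simp add: field_simps)
    then show "2 powr (1 - 2 * (t / 2)) = w * 2" unfolding powr_add by (simp add: w_def)
    have "2 powr (1 - 2 * (3 * t / 2 - 3/2)) = 2 powr (- t * 3 + 4)" by (rule arg_cong[where f = "\<lambda>x. 2 powr x"]) (simp add: field_simps)
    also have "\<dots> = (2 powr - t) powr 3 * 2 powr 4" by (simp only: powr_add powr_powr)
    finally show "2 powr (1 - 2 * (3 * t / 2 - 3/2)) = w ^ 3 * 16" using w by (simp add: w_def[symmetric] powr_numeral)
  qed
  define x1 x2 x3 x4 x5 x6 x7 x8 x9 x10 x11 s
    where "x1 = Gamma (2 * t - 3/2)" and "x2 = Gamma (2 * t - 2)" and "x3 = Gamma (3 * t / 2 - 3/2)"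
    and "x4 = Gamma (t / 2)" and "x5 = Gamma (t / 2 + 1/2)" and "x6 = Gamma (2 - t / 2)" and "x7 = Gamma (4 * t - 3)"
    and "x8 = Gamma t" and "x9 = Gamma (t + 1)" and "x10 = Gamma (3 * t / 2 - 1)" and "x11 = Gamma (3 * t - 2)" and "s = sqrt pi"
  have pos: "x3 > 0" "x4 > 0" "x5 > 0" "x6 > 0" "x7 > 0" "x8 > 0" "x9 > 0" "x10 > 0" "x11 > 0" "s > 0"
    using t by (auto simp: x3_def x4_def x5_def x6_def x7_def x8_def x9_def x10_def x11_def s_def)
  have t1: "t - 1 > 0" using t by simp
  have d1: "x2 * x1 = w ^ 4 * 32 * s * (x7 / (4 * (t - 1)))"
  proof -
    have "x7 = (4 * t - 4) * Gamma (4 * t - 4)"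
      using t Gamma_Suc_real[of "4 * t - 4"] by (simp add: x7_def)
    then have "Gamma (2 * (2 * t - 2)) = x7 / (4 * (t - 1))" using t by (simp add: field_simps)
    moreover have "2 * t - 2 + 1/2 = 2 * t - 3/2" by simp
    ultimately show ?thesis
      using Gamma_duplication_real[of "2 * t - 2"] t unfolding powers by (simp only: x1_def x2_def s_def)
  qed
  have d2: "x4 * x5 = w * 2 * s * x8"
    using Gamma_duplication_real[of "t / 2"] t unfolding powers by (simp add: x4_def x5_def x8_def s_def)
  have d3: "x3 * x10 = w ^ 3 * 16 * s * (x11 / (3 * (t - 1)))"
  proof -
    have "x11 = (3 * t - 3) * Gamma (3 * t - 3)"
      using t Gamma_Suc_real[of "3 * t - 3"] by (simp add: x11_def)
    then have "Gamma (3 * t - 3) = x11 / (3 * (t - 1))" using t by (simp add: field_simps)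
    moreover have "2 * (3 * t / 2 - 3/2) = 3 * t - 3" by simp
    ultimately have "Gamma (2 * (3 * t / 2 - 3/2)) = x11 / (3 * (t - 1))" by (simp only:)
    moreover have "3 * t / 2 - 3/2 + 1/2 = 3 * t / 2 - 1" by simp
    ultimately show ?thesis
      using Gamma_duplication_real[of "3 * t / 2 - 3/2"] t unfolding powers by (simp only: x3_def x10_def s_def)
  qed
  have "3 * (4 - t) / (4 * (t + 1)) * (Beta ((3 * t - 2) / 2) (4 - 2 * t) / (2 * Beta (3 * t - 2) (4 - 2 * t)))
     = 3 / 4 * x9 * x10 / (x6 * x11)"
  proof -
    have e: "(3 * t - 2) / 2 = 3 * t / 2 - 1" "3 * t / 2 - 1 + (4 - 2 * t) = 2 - t / 2 + 1" "3 * t - 2 + (4 - 2 * t) = t + 1 + 1"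
      by (simp_all add: field_simps)
    have g1: "Gamma (2 - t / 2 + 1) = (2 - t / 2) * x6"
      using t Gamma_Suc_real[of "2 - t / 2"] by (simp add: x6_def)
    have g2: "Gamma (t + 1 + 1) = (t + 1) * x9"
      using t Gamma_Suc_real[of "t + 1"] by (simp add: x9_def)
    have reduce: "3 * K / (4 * u) * (X * b / (p * Z) / (2 * (Y * b / (u * V)))) = 3 / 4 * V * X / (Z * Y)"
      if "K = 2 * p" "u \<noteq> 0" "b \<noteq> 0" "p \<noteq> 0" "Z \<noteq> 0" "Y \<noteq> 0" for K u b p X Y Z V :: real
      unfolding that(1) using that(2-) by (simp add: field_simps)
    have "Gamma (4 - 2 * t) \<noteq> 0" using t by (intro less_imp_neq[OF Gamma_real_pos, symmetric]) simp
    then show ?thesis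
      unfolding Beta_def e g1 g2 x10_def[symmetric] x11_def[symmetric]
      using pos t by (intro reduce) simp_all
  qed
  also have "3 / 4 * x9 * x10 / (x6 * x11) = s * x8 * x9 * x1 * x2 / (x3 * x4 * x5 * x6 * x7)"
  proof -
    have "s * x8 * x9 * x1 * x2 / (x3 * x4 * x5 * x6 * x7) = s * x8 * x9 * (x2 * x1) / (x3 * (x4 * x5) * x6 * x7)"
      by (simp add: mult_ac)
    also have "\<dots> = s * x9 * (w ^ 3 * 4 / (t - 1)) / (x3 * x6)"
      unfolding d1 d2 using pos w t1 by (simp add: field_simps eval_nat_numeral)
    also have "\<dots> = s * x9 * (w ^ 3 * 4 / (t - 1)) / (w ^ 3 * 16 * s * (x11 / (3 * (t - 1))) / x10 * x6)"
    proof -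
      have "x3 = w ^ 3 * 16 * s * (x11 / (3 * (t - 1))) / x10"
        using d3[unfolded mult.commute[of x3]] pos by (intro divide_eqI(1)) auto
      then show ?thesis by (simp only:)
    qed
    also have "s * x9 * (w ^ 3 * 4 / (t - 1)) / (w ^ 3 * 16 * s * (x11 / (3 * (t - 1))) / x10 * x6) = 3 / 4 * x9 * x10 / (x6 * x11)"
    proof -
      define d where "d = t - 1"
      have "d > 0" using t1 by (simp add: d_def)
      then show ?thesis unfolding d_def[symmetric] using pos w by (simp add: field_simps)
    qed
    finally show ?thesis by simp
  qed
  finally show ?thesis
    using contiguous_kummer_i[OF t]
    by (simp only: x1_def x2_def x3_def x4_def x5_def x6_def x7_def x8_def x9_def s_def Gamma_one_half_real)
qed

section \<open>The four evaluations\<close>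

text \<open>The left side has the shape of two unfolded list products; the trailing ones are their
  empty products.\<close>

lemma quotient_of_five:
  fixes g1 :: real
  shows "g1 * (g2 * (g3 * (g4 * (g5 * 1)))) *
      (inverse h1 * (inverse h2 * (inverse h3 * (inverse h4 * (inverse h5 * 1))))) =
    g1 * g2 * g3 * g4 * g5 / (h1 * h2 * h3 * h4 * h5)"
  by (simp add: divide_inverse)

lemma evaluation_i: "gamma_evaluation (line_i a)
   [1/2, 1/3 * a, 1 + 1/3 * a, 2/3 * a - 3/2, 2/3 * a - 2]
   [1/2 * a - 3/2, 1/6 * a, 1/2 + 1/6 * a, 2 - 1/6 * a, 4/3 * a - 3]"
proof -
  let ?us = "[(0, 1/2), (1/3, 0), (1/3, 1), (2/3, -3/2), (2/3, -2)] :: (real \<times> real) list"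
  let ?ls = "[(1/2, -3/2), (1/6, 0), (1/6, 1/2), (-1/6, 2), (4/3, -3)] :: (real \<times> real) list"
  have "gamma_evaluation (vector [affine_fun (1, -4) a, affine_fun (2/3, -1) a, affine_fun (1/3, 1) a])
      (map (\<lambda>u. affine_fun u a) ?us) (map (\<lambda>u. affine_fun u a) ?ls)"
  \<comment> \<open>For a > 3 every gamma argument is positive up to 4, and a < 4 keeps the divisor
    a - 4 of the telescoping certificate away from zero.\<close>
  proof (rule gamma_evaluation_from_interval[of 3 4])
    fix x :: real assume x: "3 < x" "x < 4"
    define t where "t = x / 3"
    have t: "1 < t" "t < 4/3" using x by (auto simp: t_def)
    have x_t: "x = 3 * t" by (simp add: t_def)
    have args: "affine_fun (1, -4) x = 3 * t - 4" "affine_fun (2/3, -1) x = 2 * t - 1" "affine_fun (1/3, 1) x = t + 1"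
      "affine_fun (0, 1/2) x = 1/2" "affine_fun (1/3, 0) x = t" "affine_fun (2/3, -3/2) x = 2 * t - 3/2"
      "affine_fun (2/3, -2) x = 2 * t - 2" "affine_fun (1/2, -3/2) x = 3 * t / 2 - 3/2" "affine_fun (1/6, 0) x = t / 2"
      "affine_fun (1/6, 1/2) x = t / 2 + 1/2" "affine_fun (-1/6, 2) x = 2 - t / 2" "affine_fun (4/3, -3) x = 4 * t - 3"
      by (simp_all add: affine_fun_def x_t)
    have "real_hyp_term (3 * t - 4) (2 * t - 1) (t + 1) sums
        ((\<Prod>u\<leftarrow>?us. Gamma (affine_fun u x)) * (\<Prod>u\<leftarrow>?ls. rGamma (affine_fun u x)))"
      using sums_i[OF t] by (simp only: list.map prod_list.Cons prod_list.Nil args rGamma_inverse_Gamma quotient_of_five)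
    moreover have "\<forall>u\<in>set ?us. affine_fun u x \<notin> \<int>\<^sub>\<le>\<^sub>0"
      using t by (simp only: list.set ball_simps args) (intro conjI TrueI not_nonpos_Ints; linarith)
    moreover have "t + 1 \<notin> \<int>\<^sub>\<le>\<^sub>0" using t by (intro not_nonpos_Ints) auto
    ultimately show "affine_fun (1/3, 1) x - affine_fun (1, -4) x - affine_fun (2/3, -1) x > -1 \<and>
        affine_fun (1/3, 1) x \<notin> \<int>\<^sub>\<le>\<^sub>0 \<and> (\<forall>u\<in>set ?us. affine_fun u x \<notin> \<int>\<^sub>\<le>\<^sub>0) \<and>
        real_hyp_term (affine_fun (1, -4) x) (affine_fun (2/3, -1) x) (affine_fun (1/3, 1) x) sums
          ((\<Prod>u\<leftarrow>?us. Gamma (affine_fun u x)) * (\<Prod>u\<leftarrow>?ls. rGamma (affine_fun u x)))"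
      using t by (simp only: args(1-3)) auto
  qed simp
  then show ?thesis
    by (simp add: affine_fun_def line_i_def algebra_simps)
qed

lemma evaluation_ii: "gamma_evaluation (line_ii a)
   [1/2, 3/2, 3/4 + 1/4 * a, 1/2 * a, 3/4 * a - 1/4]
   [7/8, 9/8, a, 1/8 + 1/4 * a, 3/8 + 1/4 * a]"
proof -
  let ?us = "[(0, 1/2), (0, 3/2), (1/4, 3/4), (1/2, 0), (3/4, -1/4)] :: (real \<times> real) list"
  let ?ls = "[(0, 7/8), (0, 9/8), (1, 0), (1/4, 1/8), (1/4, 3/8)] :: (real \<times> real) list"
  have "gamma_evaluation (vector [affine_fun (1, -3/2) a, affine_fun (1/4, 1/4) a, affine_fun (3/4, -1/4) a])
      (map (\<lambda>u. affine_fun u a) ?us) (map (\<lambda>u. affine_fun u a) ?ls)"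
  \<comment> \<open>The bound a < 3/2 makes the first upper parameter negative for Euler's integral;
    a > 1 makes the weight exponent 2t positive.\<close>
  proof (rule gamma_evaluation_from_interval[of 1 "3/2"])
    fix x :: real assume x: "1 < x" "x < 3/2"
    define t where "t = (x - 1) / 4"
    have t: "0 < t" "t < 1/8" using x by (auto simp: t_def)
    have x_t: "x = 4 * t + 1" by (simp add: t_def field_simps)
    have args: "affine_fun (1, -3/2) x = 4 * t - 1/2" "affine_fun (1/4, 1/4) x = t + 1/2" "affine_fun (3/4, -1/4) x = 3 * t + 1/2"
      "affine_fun (0, 1/2) x = 1/2" "affine_fun (0, 3/2) x = 3/2" "affine_fun (1/4, 3/4) x = t + 1"
      "affine_fun (1/2, 0) x = 2 * t + 1/2" "affine_fun (0, 7/8) x = 7/8" "affine_fun (0, 9/8) x = 9/8"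
      "affine_fun (1, 0) x = 4 * t + 1" "affine_fun (1/4, 1/8) x = t + 3/8" "affine_fun (1/4, 3/8) x = t + 5/8"
      by (simp_all add: affine_fun_def x_t field_simps)
    have "real_hyp_term (4 * t - 1/2) (t + 1/2) (3 * t + 1/2) sums
        ((\<Prod>u\<leftarrow>?us. Gamma (affine_fun u x)) * (\<Prod>u\<leftarrow>?ls. rGamma (affine_fun u x)))"
      using sums_ii[OF t] by (simp only: list.map prod_list.Cons prod_list.Nil args rGamma_inverse_Gamma quotient_of_five)
    moreover have "\<forall>u\<in>set ?us. affine_fun u x \<notin> \<int>\<^sub>\<le>\<^sub>0"
      using t by (simp only: list.set ball_simps args) (intro conjI TrueI not_nonpos_Ints; linarith)
    moreover have "3 * t + 1/2 \<notin> \<int>\<^sub>\<le>\<^sub>0" using t by (intro not_nonpos_Ints) auto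
    ultimately show "affine_fun (3/4, -1/4) x - affine_fun (1, -3/2) x - affine_fun (1/4, 1/4) x > -1 \<and>
        affine_fun (3/4, -1/4) x \<notin> \<int>\<^sub>\<le>\<^sub>0 \<and> (\<forall>u\<in>set ?us. affine_fun u x \<notin> \<int>\<^sub>\<le>\<^sub>0) \<and>
        real_hyp_term (affine_fun (1, -3/2) x) (affine_fun (1/4, 1/4) x) (affine_fun (3/4, -1/4) x) sums
          ((\<Prod>u\<leftarrow>?us. Gamma (affine_fun u x)) * (\<Prod>u\<leftarrow>?ls. rGamma (affine_fun u x)))"
      using t by (simp only: args(1-3)) auto
  qed simp
  then show ?thesis
    by (simp add: affine_fun_def line_ii_def algebra_simps)
qed

lemma evaluation_iii: "gamma_evaluation (line_iii a)
   [1/2, 1/2, 1/2 + 1/4 * a, 1/2 + 1/2 * a, 3/4 * a]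
   [3/8, 5/8, a, 3/8 + 1/4 * a, 5/8 + 1/4 * a]"
proof -
  let ?us = "[(0, 1/2), (0, 1/2), (1/4, 1/2), (1/2, 1/2), (3/4, 0)] :: (real \<times> real) list"
  let ?ls = "[(0, 3/8), (0, 5/8), (1, 0), (1/4, 3/8), (1/4, 5/8)] :: (real \<times> real) list"
  have "gamma_evaluation (vector [affine_fun (1, -1/2) a, affine_fun (1/4, 0) a, affine_fun (3/4, 0) a])
      (map (\<lambda>u. affine_fun u a) ?us) (map (\<lambda>u. affine_fun u a) ?ls)"
  \<comment> \<open>As on line (ii): a - 1/2 must be negative and t = a/4 positive.\<close>
  proof (rule gamma_evaluation_from_interval[of 0 "1/2"])
    fix x :: real assume x: "0 < x" "x < 1/2"
    define t where "t = x / 4"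
    have t: "0 < t" "t < 1/8" using x by (auto simp: t_def)
    have x_t: "x = 4 * t" by (simp add: t_def)
    have args: "affine_fun (1, -1/2) x = 4 * t - 1/2" "affine_fun (1/4, 0) x = t" "affine_fun (3/4, 0) x = 3 * t"
      "affine_fun (0, 1/2) x = 1/2" "affine_fun (1/4, 1/2) x = t + 1/2" "affine_fun (1/2, 1/2) x = 2 * t + 1/2"
      "affine_fun (0, 3/8) x = 3/8" "affine_fun (0, 5/8) x = 5/8"
      "affine_fun (1, 0) x = 4 * t" "affine_fun (1/4, 3/8) x = t + 3/8" "affine_fun (1/4, 5/8) x = t + 5/8"
      by (simp_all add: affine_fun_def x_t)
    have "real_hyp_term (4 * t - 1/2) t (3 * t) sums
        ((\<Prod>u\<leftarrow>?us. Gamma (affine_fun u x)) * (\<Prod>u\<leftarrow>?ls. rGamma (affine_fun u x)))"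
      using sums_iii[OF t] by (simp only: list.map prod_list.Cons prod_list.Nil args rGamma_inverse_Gamma quotient_of_five)
    moreover have "\<forall>u\<in>set ?us. affine_fun u x \<notin> \<int>\<^sub>\<le>\<^sub>0"
      using t by (simp only: list.set ball_simps args) (intro conjI TrueI not_nonpos_Ints; linarith)
    moreover have "3 * t \<notin> \<int>\<^sub>\<le>\<^sub>0" using t by (intro not_nonpos_Ints) auto
    ultimately show "affine_fun (3/4, 0) x - affine_fun (1, -1/2) x - affine_fun (1/4, 0) x > -1 \<and>
        affine_fun (3/4, 0) x \<notin> \<int>\<^sub>\<le>\<^sub>0 \<and> (\<forall>u\<in>set ?us. affine_fun u x \<notin> \<int>\<^sub>\<le>\<^sub>0) \<and>
        real_hyp_term (affine_fun (1, -1/2) x) (affine_fun (1/4, 0) x) (affine_fun (3/4, 0) x) sums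
          ((\<Prod>u\<leftarrow>?us. Gamma (affine_fun u x)) * (\<Prod>u\<leftarrow>?ls. rGamma (affine_fun u x)))"
      using t by (simp only: args(1-3)) auto
  qed simp
  then show ?thesis
    by (simp add: affine_fun_def line_iii_def algebra_simps)
qed

lemma evaluation_iv: "gamma_evaluation (line_iv a)
   [1/2, 1/3 * a, 1 + 1/3 * a, 3/2 + 2/3 * a, 2 + 2/3 * a]
   [3/2 + 1/2 * a, 1/2 + 1/6 * a, 1 + 1/6 * a, - (1/6 * a), 2 + 4/3 * a]"
proof -
  let ?us = "[(0, 1/2), (1/3, 0), (1/3, 1), (2/3, 3/2), (2/3, 2)] :: (real \<times> real) list"
  let ?ls = "[(1/2, 3/2), (1/6, 1/2), (1/6, 1), (-1/6, 0), (4/3, 2)] :: (real \<times> real) list"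
  have "gamma_evaluation (vector [affine_fun (1, 2) a, affine_fun (2/3, 0) a, affine_fun (1/3, 0) a])
      (map (\<lambda>u. affine_fun u a) ?us) (map (\<lambda>u. affine_fun u a) ?ls)"
  \<comment> \<open>The excess -4a/3 - 2 exceeds -1 exactly for a < -3/4. The left end keeps 2 +
    4a/3 positive, so a/3 is the only negative gamma argument.\<close>
  proof (rule gamma_evaluation_from_interval[of "-3/2" "-3/4"])
    fix x :: real assume x: "-3/2 < x" "x < -3/4"
    define t where "t = x / 3"
    have t: "-1/2 < t" "t < -1/4" using x by (auto simp: t_def)
    have x_t: "x = 3 * t" by (simp add: t_def)
    have args: "affine_fun (1, 2) x = 3 * t + 2" "affine_fun (2/3, 0) x = 2 * t" "affine_fun (1/3, 0) x = t"
      "affine_fun (0, 1/2) x = 1/2" "affine_fun (1/3, 1) x = t + 1" "affine_fun (2/3, 3/2) x = 2 * t + 3/2"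
      "affine_fun (2/3, 2) x = 2 * t + 2" "affine_fun (1/2, 3/2) x = 3 * t / 2 + 3/2" "affine_fun (1/6, 1/2) x = t / 2 + 1/2"
      "affine_fun (1/6, 1) x = t / 2 + 1" "affine_fun (-1/6, 0) x = - t / 2" "affine_fun (4/3, 2) x = 4 * t + 2"
      by (simp_all add: affine_fun_def x_t)
    have "real_hyp_term (3 * t + 2) (2 * t) t sums
        ((\<Prod>u\<leftarrow>?us. Gamma (affine_fun u x)) * (\<Prod>u\<leftarrow>?ls. rGamma (affine_fun u x)))"
      using sums_iv[OF t] by (simp only: list.map prod_list.Cons prod_list.Nil args rGamma_inverse_Gamma quotient_of_five)
    moreover have "\<forall>u\<in>set ?us. affine_fun u x \<notin> \<int>\<^sub>\<le>\<^sub>0"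
      using t by (simp only: list.set ball_simps args) (intro conjI TrueI not_nonpos_Ints; linarith)
    moreover have "t \<notin> \<int>\<^sub>\<le>\<^sub>0" using t by (intro not_nonpos_Ints) auto
    ultimately show "affine_fun (1/3, 0) x - affine_fun (1, 2) x - affine_fun (2/3, 0) x > -1 \<and>
        affine_fun (1/3, 0) x \<notin> \<int>\<^sub>\<le>\<^sub>0 \<and> (\<forall>u\<in>set ?us. affine_fun u x \<notin> \<int>\<^sub>\<le>\<^sub>0) \<and>
        real_hyp_term (affine_fun (1, 2) x) (affine_fun (2/3, 0) x) (affine_fun (1/3, 0) x) sums
          ((\<Prod>u\<leftarrow>?us. Gamma (affine_fun u x)) * (\<Prod>u\<leftarrow>?ls. rGamma (affine_fun u x)))"
      using t by (simp only: args(1-3)) auto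
  qed simp
  then show ?thesis
    by (simp add: affine_fun_def line_iv_def algebra_simps)
qed

theorem theorem4p1:
  shows "saturation projected_intersection =
           saturation (kummer_plane \<union> range line_i \<union> range line_ii \<union> range line_iii \<union> range line_iv) \<and>
         card (saturation ` {range line_i, range line_ii, range line_iii, range line_iv}) = 4 \<and>
         (\<forall>L\<in>{range line_i, range line_ii, range line_iii, range line_iv}.
            \<not> L \<subseteq> saturation kummer_plane) \<and>
         (\<forall>a. gamma_evaluation (line_i a)
            [1/2, 1/3 * a, 1 + 1/3 * a, 2/3 * a - 3/2, 2/3 * a - 2]
            [1/2 * a - 3/2, 1/6 * a, 1/2 + 1/6 * a, 2 - 1/6 * a, 4/3 * a - 3]) \<and>
         (\<forall>a. gamma_evaluation (line_ii a)
            [1/2, 3/2, 3/4 + 1/4 * a, 1/2 * a, 3/4 * a - 1/4]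
            [7/8, 9/8, a, 1/8 + 1/4 * a, 3/8 + 1/4 * a]) \<and>
         (\<forall>a. gamma_evaluation (line_iii a)
            [1/2, 1/2, 1/2 + 1/4 * a, 1/2 + 1/2 * a, 3/4 * a]
            [3/8, 5/8, a, 3/8 + 1/4 * a, 5/8 + 1/4 * a]) \<and>
         (\<forall>a. gamma_evaluation (line_iv a)
            [1/2, 1/3 * a, 1 + 1/3 * a, 3/2 + 2/3 * a, 2 + 2/3 * a]
            [3/2 + 1/2 * a, 1/2 + 1/6 * a, 1 + 1/6 * a, - (1/6 * a), 2 + 4/3 * a])"
  using saturation_projected_intersection card_line_saturations lines_not_kummer
    evaluation_i evaluation_ii evaluation_iii evaluation_iv
  by blast

end
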